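(* Let $G$ be a compact Lie group with Lie algebra $\mathfrak g$ acting by quaternionic isometries on a quaternion-Kähler manifold $M$, with moment map $\mu$ satisfying the conformality assumption $B_i=\lambda v_i$ (see context), and let $\Psi:M_0\to\mathbb{G}_3(\mathfrak g)$ be the map induced by $\mu$. Then there exists a lift $\hat\Psi:S^2H\to\mathbf{V}$ of the map $\Psi$ (a morphism of vector bundles covering $\Psi$, with $S^2H$ taken over $M_0$) such that $$\hat\Psi(\mu_A)=s_A\qquad (A\in\mathfrak g),$$ i.e. $\hat\Psi(\mu_A(x))=s_A(\Psi(x))$ for $x\in M_0$, inducing a bijective linear map $$(\ker\mathscr{D})_{\mathfrak g}\longrightarrow\ker D.$$
   Context: $M$ is a quaternion-Kähler (QK) manifold with Levi-Civita connection $\nabla$. $S^2H$ denotes the rank 3 vector bundle over $M$ locally spanned by almost complex structures $I_1,I_2,I_3$ with $I_i^2=-\mathrm{Id}$ and $I_iI_j=\epsilon^{ijk}I_k$ ($\epsilon^{ijk}$ the sign of the permutation); it carries its natural metric, and its structure group is $SO(3)$. The complexified cotangent bundle of $M$ is $E\otimes H$, where $E,H$ are associated with the standard representations of $Sp(n)$ and $Sp(1)$. For $A\in\mathfrak g$, $\tilde A$ is the Killing field on $M$ generated by $A$. $\mathfrak g$ carries the inner product $\langle\cdot,\cdot\rangle$ induced by (minus) the Killing form. The moment map $\mu$ is a section of $S^2H\otimes\mathfrak g$; its contraction with $A\in\mathfrak g$ is the section $\mu_A$ of $S^2H$, which up to a constant is the $S^2H$-component of $\nabla\tilde A$. Locally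 $\mu=\sum_{i=1}^3\omega_i\otimes B_i$, with $\omega_i$ a local orthonormal basis of $S^2H$ and $B_i$ taking values in $\mathfrak g$. $M_0\subset M$ is the set of points $x$ at which $\mathrm{span}\{B_1(x),B_2(x),B_3(x)\}$ is 3-dimensional, and $\Psi$ maps $x\in M_0$ to this span, regarded as a point of the Grassmannian $\mathbb{G}_3(\mathfrak g)$ of oriented 3-dimensional subspaces of $\mathfrak g$. Conformality assumption: $B_i=\lambda(x)v_i$, where $v_1,v_2,v_3$ is an orthonormal basis of $\Psi(x)$ and $\lambda$ is a function. $\mathscr{D}$ is the QK twistor operator on sections of $S^2H$: the covariant derivative $\nabla:S^2H\to E\otimes H\otimes S^2H$ followed by symmetrization to $E\otimes S^3H$. For nonzero scalar curvature (Salamon), $\ker\mathscr D$ is in bijection with the space of Killing vector fields preserving the QK structure, $\mu_A\in\ker\mathscr D$ corresponding to $\tilde A$. $(\ker\mathscr D)_{\mathfrak g}$ is the space of twistor sections corresponding to the subspace of Killing fields induced by $\mathfrak g$, i.e. the space of the sections $\mu_A$, $A\in\mathfrak g$. $\mathbf{V}$ is the tautological rank 3 bundle over $\mathbb{G}_3(\mathfrak g)$, $\mathbf{V}^\perp$ its orthogonal complement in the trivial bundle with fibre $\mathfrak g$, $\pi$ the orthogonal projection onto $\mathbf V$, and $s_A=\pi A$ the section of $\mathbf V$ obtained by projecting the constant section $A\in\mathfrak g$. The connection on $\mathbf V$ is $\nabla^{\mathbf V}=\pi\circ d$. Identifying $T^*\mathbb{G}_3(\mathfrak g)\cong\mathbf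 V\otimes\mathbf V^\perp$, the operator $D$ on sections of $\mathbf V$ is $D=\pi_2\circ\nabla^{\mathbf V}$, where $\pi_2$ is the projection of $\mathbf V^\perp\otimes\mathbf V\otimes\mathbf V$ onto $\mathbf V^\perp\otimes(\mathbf V\otimes\mathbf V)_0$, with $(\cdot)_0$ the trace-free part.
   Formalization: Formalized with dim g > 3 and A ↦ Ã injective, since the bijection fails otherwise (for dim g = 3, ker D has dimension 6); M is connected of dimension 4n, n ≥ 2, with nonzero scalar curvature, and minus the Killing form is positive definite. *)

theory Defs
  imports "HOL-Analysis.Analysis" "HOL-Algebra.Group_Action"
begin

section \<open>Smooth manifolds\<close>

text \<open>
  Tensor calculus is done in charts.  A manifold is a
  Hausdorff second countable type with a smooth atlas.  A tensor field is the family of its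
  coordinate expressions, one for every chart, that transform correctly; the value of a field
  \<open>T\<close> in the chart \<open>c\<close> at the point with coordinates \<open>x\<close> is \<open>T c x\<close>.  A tangent vector at a point
  of the chart \<open>c\<close> is given by its coordinate vector with respect to \<open>c\<close>.
\<close>

primrec Ck_on :: "nat \<Rightarrow> 'a::real_normed_vector set \<Rightarrow> ('a \<Rightarrow> 'b::real_normed_vector) \<Rightarrow> bool" where
  "Ck_on 0 S f = continuous_on S f"
| "Ck_on (Suc k) S f =
     ((\<forall>x\<in>S. f differentiable (at x)) \<and> (\<forall>v. Ck_on k S (\<lambda>x. frechet_derivative f (at x) v)))"

text \<open>To be used on open sets of finite-dimensional spaces.\<close>

definition smooth_on :: "'a::real_normed_vector set \<Rightarrow> ('a \<Rightarrow> 'b::real_normed_vector) \<Rightarrow> bool" where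
  "smooth_on S f \<longleftrightarrow> (\<forall>k. Ck_on k S f)"

type_synonym ('m, 'e) chart = "'m set \<times> ('m \<Rightarrow> 'e)"

definition chart_image :: "('m, 'e) chart \<Rightarrow> 'e set" where
  "chart_image c = snd c ` fst c"

definition chart_inv :: "('m, 'e) chart \<Rightarrow> 'e \<Rightarrow> 'm" where
  "chart_inv c = inv_into (fst c) (snd c)"

definition in_charts :: "('m, 'e) chart \<Rightarrow> ('k, 'f) chart \<Rightarrow> ('m \<Rightarrow> 'k) \<Rightarrow> 'e \<Rightarrow> 'f" where
  "in_charts c d f = snd d \<circ> f \<circ> chart_inv c"

definition smooth_atlas ::
    "('m::topological_space, 'e::euclidean_space) chart set \<Rightarrow> bool" where
  "smooth_atlas \<A> \<longleftrightarrow>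
     (\<Union>c\<in>\<A>. fst c) = UNIV \<and>
     (\<forall>c\<in>\<A>. open (fst c) \<and> open (chart_image c) \<and>
        homeomorphism (fst c) (chart_image c) (snd c) (chart_inv c)) \<and>
     (\<forall>c\<in>\<A>. \<forall>d\<in>\<A>. smooth_on (snd c ` (fst c \<inter> fst d)) (in_charts c d id))"

definition smooth_map ::
    "('m::topological_space, 'e::euclidean_space) chart set \<Rightarrow>
     ('k::topological_space, 'f::euclidean_space) chart set \<Rightarrow> ('m \<Rightarrow> 'k) \<Rightarrow> bool" where
  "smooth_map \<A> \<B> f \<longleftrightarrow> continuous_on UNIV f \<and>
     (\<forall>c\<in>\<A>. \<forall>d\<in>\<B>. smooth_on (snd c ` {p \<in> fst c. f p \<in> fst d}) (in_charts c d f))"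

definition product_atlas ::
    "('m, 'e) chart set \<Rightarrow> ('k, 'f) chart set \<Rightarrow> ('m \<times> 'k, 'e \<times> 'f) chart set" where
  "product_atlas \<A> \<B> =
     {(fst c \<times> fst d, \<lambda>(p, q). (snd c p, snd d q)) |c d. c \<in> \<A> \<and> d \<in> \<B>}"

definition tangent_map ::
    "('m, 'e::real_normed_vector) chart \<Rightarrow> ('k, 'f::real_normed_vector) chart \<Rightarrow>
     ('m \<Rightarrow> 'k) \<Rightarrow> 'e \<Rightarrow> 'e \<Rightarrow> 'f" where
  "tangent_map c d f x = frechet_derivative (in_charts c d f) (at x)"

definition endo_trace :: "('a::euclidean_space \<Rightarrow> 'a) \<Rightarrow> real" where
  "endo_trace T = (\<Sum>b\<in>Basis. T b \<bullet> b)"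


section \<open>Lie groups, their Lie algebras and the Killing form\<close>

definition lie_group ::
    "'g::topological_space monoid \<Rightarrow> ('g, 'h::euclidean_space) chart set \<Rightarrow> bool" where
  "lie_group G \<B> \<longleftrightarrow>
     group G \<and> carrier G = UNIV \<and> smooth_atlas \<B> \<and>
     smooth_map (product_atlas \<B> \<B>) \<B> (\<lambda>(a, b). a \<otimes>\<^bsub>G\<^esub> b) \<and>
     smooth_map \<B> \<B> (\<lambda>a. inv\<^bsub>G\<^esub> a)"

text \<open>
  The Lie algebra is the tangent space at the unit.  It is identified with the model space \<open>'h\<close> by
  means of a chart \<open>b\<close> around the unit.  The standard inner product of \<open>'h\<close> plays no role.
  \<open>left_invariant_field G b A\<close> is the coordinate expression in \<open>b\<close> of the left invariant
  vector field with value \<open>A\<close> at the unit.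
\<close>

definition left_invariant_field ::
    "'g monoid \<Rightarrow> ('g, 'h::euclidean_space) chart \<Rightarrow> 'h \<Rightarrow> 'h \<Rightarrow> 'h" where
  "left_invariant_field G b A y =
     frechet_derivative (\<lambda>z. snd b (chart_inv b y \<otimes>\<^bsub>G\<^esub> chart_inv b z)) (at (snd b \<one>\<^bsub>G\<^esub>)) A"

definition lie_bracket ::
    "'g monoid \<Rightarrow> ('g, 'h::euclidean_space) chart \<Rightarrow> 'h \<Rightarrow> 'h \<Rightarrow> 'h" where
  "lie_bracket G b A B =
     frechet_derivative (left_invariant_field G b B) (at (snd b \<one>\<^bsub>G\<^esub>)) A -
     frechet_derivative (left_invariant_field G b A) (at (snd b \<one>\<^bsub>G\<^esub>)) B"

definition killing_form ::
    "'g monoid \<Rightarrow> ('g, 'h::euclidean_space) chart \<Rightarrow> 'h \<Rightarrow> 'h \<Rightarrow> real" where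
  "killing_form G b A B = endo_trace (\<lambda>C. lie_bracket G b A (lie_bracket G b B C))"

definition neg_killing ::
    "'g monoid \<Rightarrow> ('g, 'h::euclidean_space) chart \<Rightarrow> 'h \<Rightarrow> 'h \<Rightarrow> real" where
  "neg_killing G b A B = - killing_form G b A B"


section \<open>Riemannian metrics\<close>

type_synonym ('m, 'e) metric = "('m, 'e) chart \<Rightarrow> 'e \<Rightarrow> 'e \<Rightarrow> 'e \<Rightarrow> real"

definition riemannian_metric ::
    "('m::topological_space, 'e::euclidean_space) chart set \<Rightarrow> ('m, 'e) metric \<Rightarrow> bool" where
  "riemannian_metric \<A> g \<longleftrightarrow>
     (\<forall>c\<in>\<A>. \<forall>x\<in>chart_image c.
        bilinear (g c x) \<and> (\<forall>u v. g c x u v = g c x v u) \<and> (\<forall>u. u \<noteq> 0 \<longrightarrow> g c x u u > 0)) \<and>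
     (\<forall>c\<in>\<A>. \<forall>u v. smooth_on (chart_image c) (\<lambda>x. g c x u v)) \<and>
     (\<forall>c\<in>\<A>. \<forall>d\<in>\<A>. \<forall>p\<in>fst c \<inter> fst d. \<forall>u v.
        g d (snd d p) (tangent_map c d id (snd c p) u) (tangent_map c d id (snd c p) v) =
        g c (snd c p) u v)"

text \<open>
  The Levi-Civita connection in a chart is \<open>\<nabla>\<^sub>u X = \<partial>\<^sub>u X + \<Gamma>(u, X)\<close>, where \<open>\<Gamma>\<close> is determined by
  the Koszul formula for the coordinate fields.
\<close>

definition christoffel ::
    "('m, 'e::euclidean_space) metric \<Rightarrow> ('m, 'e) chart \<Rightarrow> 'e \<Rightarrow> 'e \<Rightarrow> 'e \<Rightarrow> 'e" where
  "christoffel g c x u v = (THE z. \<forall>w. g c x z w =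
     (frechet_derivative (\<lambda>y. g c y v w) (at x) u +
      frechet_derivative (\<lambda>y. g c y u w) (at x) v -
      frechet_derivative (\<lambda>y. g c y u v) (at x) w) / 2)"

text \<open>Covariant derivatives of a vector field and of an endomorphism field.\<close>

definition nabla_vec ::
    "('m, 'e::euclidean_space) metric \<Rightarrow> ('m, 'e) chart \<Rightarrow> ('e \<Rightarrow> 'e) \<Rightarrow> 'e \<Rightarrow> 'e \<Rightarrow> 'e" where
  "nabla_vec g c X x u = frechet_derivative X (at x) u + christoffel g c x u (X x)"

definition nabla_end ::
    "('m, 'e::euclidean_space) metric \<Rightarrow> ('m, 'e) chart \<Rightarrow> ('e \<Rightarrow> 'e \<Rightarrow> 'e) \<Rightarrow>
     'e \<Rightarrow> 'e \<Rightarrow> 'e \<Rightarrow> 'e" where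
  "nabla_end g c S x u v = frechet_derivative (\<lambda>y. S y v) (at x) u +
     christoffel g c x u (S x v) - S x (christoffel g c x u v)"

definition curvature ::
    "('m, 'e::euclidean_space) metric \<Rightarrow> ('m, 'e) chart \<Rightarrow> 'e \<Rightarrow> 'e \<Rightarrow> 'e \<Rightarrow> 'e \<Rightarrow> 'e" where
  "curvature g c x u v w =
     frechet_derivative (\<lambda>y. christoffel g c y v w) (at x) u -
     frechet_derivative (\<lambda>y. christoffel g c y u w) (at x) v +
     christoffel g c x u (christoffel g c x v w) - christoffel g c x v (christoffel g c x u w)"

definition ricci ::
    "('m, 'e::euclidean_space) metric \<Rightarrow> ('m, 'e) chart \<Rightarrow> 'e \<Rightarrow> 'e \<Rightarrow> 'e \<Rightarrow> real" where
  "ricci g c x v w = endo_trace (\<lambda>u. curvature g c x u v w)"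

definition scalar_curvature ::
    "('m, 'e::euclidean_space) metric \<Rightarrow> ('m, 'e) chart \<Rightarrow> 'e \<Rightarrow> real" where
  "scalar_curvature g c x = endo_trace (\<lambda>v. THE z. \<forall>w. g c x z w = ricci g c x v w)"


section \<open>Quaternion-Kaehler manifolds\<close>

text \<open>Indices run through the cyclic type \<open>3\<close>, so that \<open>i, i + 1, i + 2\<close> is always an even
  permutation.\<close>

definition quaternion_triple :: "(3 \<Rightarrow> 'e::euclidean_space \<Rightarrow> 'e) \<Rightarrow> bool" where
  "quaternion_triple I \<longleftrightarrow>
     (\<forall>i. linear (I i)) \<and>
     (\<forall>i u. I i (I i u) = - u) \<and>
     (\<forall>i u. I i (I (i + 1) u) = I (i + 2) u \<and> I (i + 1) (I i u) = - I (i + 2) u)"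

text \<open>The rank 3 bundle \<open>S\<^sup>2H\<close>: its fibre over a point is a set of endomorphisms.\<close>

type_synonym ('m, 'e) end_bundle = "('m, 'e) chart \<Rightarrow> 'e \<Rightarrow> ('e \<Rightarrow> 'e) set"

text \<open>The last clause in the scope of the local frame \<open>I\<close> says that the Levi-Civita connection
  preserves the bundle.\<close>

definition parallel_quaternionic_structure ::
    "('m::topological_space, 'e::euclidean_space) chart set \<Rightarrow> ('m, 'e) metric \<Rightarrow>
     ('m, 'e) end_bundle \<Rightarrow> bool" where
  "parallel_quaternionic_structure \<A> g Q \<longleftrightarrow>
     (\<forall>c\<in>\<A>. \<forall>x\<in>chart_image c. \<exists>U I. open U \<and> x \<in> U \<and> U \<subseteq> chart_image c \<and>
        (\<forall>i v. smooth_on U (\<lambda>y. I y i v)) \<and>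
        (\<forall>y\<in>U. quaternion_triple (I y) \<and>
           (\<forall>i u v. g c y (I y i u) (I y i v) = g c y u v) \<and>
           Q c y = {S. \<exists>a :: real^3. S = (\<lambda>u. \<Sum>i\<in>UNIV. a $ i *\<^sub>R I y i u)} \<and>
           (\<forall>i u. nabla_end g c (\<lambda>z. I z i) y u \<in> Q c y))) \<and>
     (\<forall>c\<in>\<A>. \<forall>d\<in>\<A>. \<forall>p\<in>fst c \<inter> fst d.
        Q d (snd d p) = {T. \<exists>S\<in>Q c (snd c p).
          T \<circ> tangent_map c d id (snd c p) = tangent_map c d id (snd c p) \<circ> S})"

definition quaternion_kaehler ::
    "nat \<Rightarrow> ('m::topological_space, 'e::euclidean_space) chart set \<Rightarrow> ('m, 'e) metric \<Rightarrow>
     ('m, 'e) end_bundle \<Rightarrow> bool" where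
  "quaternion_kaehler n \<A> g Q \<longleftrightarrow>
     2 \<le> n \<and> DIM('e) = 4 * n \<and> connected (UNIV :: 'm set) \<and> smooth_atlas \<A> \<and>
     riemannian_metric \<A> g \<and> parallel_quaternionic_structure \<A> g Q"

text \<open>The natural metric of \<open>S\<^sup>2H\<close> makes the quaternion triples orthonormal; the quaternion triples
  are exactly the oriented orthonormal bases of the fibre.\<close>

definition S2H_basis ::
    "('m, 'e::euclidean_space) end_bundle \<Rightarrow> ('m, 'e) chart \<Rightarrow> 'e \<Rightarrow> (3 \<Rightarrow> 'e \<Rightarrow> 'e) \<Rightarrow> bool" where
  "S2H_basis Q c x I \<longleftrightarrow> quaternion_triple I \<and> (\<forall>i. I i \<in> Q c x)"

text \<open>The orthogonal projection of an endomorphism to \<open>S\<^sup>2H\<close>.  Elements of \<open>S\<^sup>2H\<close> are skew-adjoint,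
  so orthogonality may be tested with the trace of the product.\<close>

definition S2H_component ::
    "('m, 'e::euclidean_space) end_bundle \<Rightarrow> ('m, 'e) chart \<Rightarrow> 'e \<Rightarrow> ('e \<Rightarrow> 'e) \<Rightarrow> 'e \<Rightarrow> 'e" where
  "S2H_component Q c x T =
     (THE S. S \<in> Q c x \<and> (\<forall>J\<in>Q c x. endo_trace (T \<circ> J) = endo_trace (S \<circ> J)))"

text \<open>Sections of \<open>S\<^sup>2H\<close> over the whole manifold.  Outside the meaningful arguments they are zero,
  so that equal sections are equal as functions.\<close>

type_synonym ('m, 'e) end_field = "('m, 'e) chart \<Rightarrow> 'e \<Rightarrow> 'e \<Rightarrow> 'e"

definition S2H_section ::
    "('m, 'e::euclidean_space) chart set \<Rightarrow> ('m, 'e) end_bundle \<Rightarrow> ('m, 'e) end_field \<Rightarrow> bool" where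
  "S2H_section \<A> Q \<sigma> \<longleftrightarrow>
     (\<forall>c\<in>\<A>. \<forall>x\<in>chart_image c. \<sigma> c x \<in> Q c x) \<and>
     (\<forall>c x. \<not> (c \<in> \<A> \<and> x \<in> chart_image c) \<longrightarrow> \<sigma> c x = (\<lambda>u. 0)) \<and>
     (\<forall>c\<in>\<A>. \<forall>u. smooth_on (chart_image c) (\<lambda>x. \<sigma> c x u)) \<and>
     (\<forall>c\<in>\<A>. \<forall>d\<in>\<A>. \<forall>p\<in>fst c \<inter> fst d.
        \<sigma> d (snd d p) \<circ> tangent_map c d id (snd c p) =
        tangent_map c d id (snd c p) \<circ> \<sigma> c (snd c p))"


section \<open>The twistor operator\<close>

text \<open>
  Let \<open>h\<^sub>A\<close> be a basis of \<open>H\<close> on which \<open>I\<^sub>1, I\<^sub>2, I\<^sub>3\<close> act by the matrices \<open>\<tau>\<^sub>1, \<tau>\<^sub>2, \<tau>\<^sub>3\<close> below, and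
  \<open>e\<^sub>a\<close> (\<open>a < 2 n\<close>) a basis of \<open>E\<close>.  An EH coframe consists of the complex covectors
  \<open>\<theta>\<^sub>a\<^sub>A = e\<^sub>a \<otimes> h\<^sub>A\<close>.  The action of \<open>I\<^sub>i\<close> on covectors is dual to that on vectors, which accounts
  for the minus sign in the definition of EH coframes.
\<close>

definition tau :: "3 \<Rightarrow> 2 \<Rightarrow> 2 \<Rightarrow> complex" where
  "tau i A B =
     (if i = 1 then (if A = B then (if A = 1 then \<i> else - \<i>) else 0)
      else if i = 2 then (if A = B then 0 else if A = 1 then 1 else - 1)
      else (if A = B then 0 else \<i>))"

definition EH_coframe :: "nat \<Rightarrow> (3 \<Rightarrow> 'e::euclidean_space \<Rightarrow> 'e) \<Rightarrow> (nat \<Rightarrow> 2 \<Rightarrow> 'e \<Rightarrow> complex) \<Rightarrow> bool" where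
  "EH_coframe n I \<theta> \<longleftrightarrow>
     (\<forall>a<2*n. \<forall>A. linear (\<theta> a A)) \<and>
     (\<forall>\<phi>. linear \<phi> \<longrightarrow> (\<exists>!t. (\<forall>a\<ge>2*n. \<forall>A. t a A = 0) \<and>
        (\<forall>u. \<phi> u = (\<Sum>a<2*n. \<Sum>A\<in>UNIV. t a A * \<theta> a A u)))) \<and>
     (\<forall>a<2*n. \<forall>A i u. - \<theta> a A (I i u) = (\<Sum>B\<in>UNIV. tau i B A * \<theta> a B u))"

definition EH_coeff :: "nat \<Rightarrow> (nat \<Rightarrow> 2 \<Rightarrow> 'e::euclidean_space \<Rightarrow> complex) \<Rightarrow> ('e \<Rightarrow> complex) \<Rightarrow>
    nat \<Rightarrow> 2 \<Rightarrow> complex" where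
  "EH_coeff n \<theta> \<phi> = (THE t. (\<forall>a\<ge>2*n. \<forall>A. t a A = 0) \<and>
     (\<forall>u. \<phi> u = (\<Sum>a<2*n. \<Sum>A\<in>UNIV. t a A * \<theta> a A u)))"

text \<open>The symplectic form of \<open>H\<close> identifies \<open>H\<^sup>*\<close> with \<open>H\<close>, hence \<open>\<tau>\<^sub>i\<close> in \<open>H \<otimes> H\<^sup>*\<close> with an element
  of \<open>H \<otimes> H\<close>.  That element has the components \<open>tau_sym i\<close>, which are symmetric.\<close>

definition eps :: "2 \<Rightarrow> 2 \<Rightarrow> complex" where
  "eps A B = (if A = B then 0 else if A = 1 then 1 else - 1)"

definition tau_sym :: "3 \<Rightarrow> 2 \<Rightarrow> 2 \<Rightarrow> complex" where
  "tau_sym i B C = (\<Sum>D\<in>UNIV. tau i B D * eps D C)"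

text \<open>Coordinates of an element of a fibre of \<open>S\<^sup>2H\<close>.\<close>

definition S2H_coords :: "(3 \<Rightarrow> 'e::euclidean_space \<Rightarrow> 'e) \<Rightarrow> ('e \<Rightarrow> 'e) \<Rightarrow> real^3" where
  "S2H_coords I S = (THE a. \<forall>u. S u = (\<Sum>i\<in>UNIV. a $ i *\<^sub>R I i u))"

text \<open>Components of \<open>\<nabla>\<sigma>\<close> in \<open>E \<otimes> H \<otimes> S\<^sup>2H \<subseteq> E \<otimes> H \<otimes> H \<otimes> H\<close>, and of its symmetrization
  \<open>\<D>\<sigma>\<close> in \<open>E \<otimes> S\<^sup>3H\<close>.\<close>

definition nabla_EHHH ::
    "nat \<Rightarrow> ('m, 'e::euclidean_space) metric \<Rightarrow> ('m, 'e) chart \<Rightarrow> 'e \<Rightarrow>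
     (3 \<Rightarrow> 'e \<Rightarrow> 'e) \<Rightarrow> (nat \<Rightarrow> 2 \<Rightarrow> 'e \<Rightarrow> complex) \<Rightarrow> ('m, 'e) end_field \<Rightarrow>
     nat \<Rightarrow> 2 \<Rightarrow> 2 \<Rightarrow> 2 \<Rightarrow> complex" where
  "nabla_EHHH n g c x I \<theta> \<sigma> a A B C =
     (\<Sum>i\<in>UNIV. EH_coeff n \<theta> (\<lambda>u. of_real (S2H_coords I (nabla_end g c (\<sigma> c) x u) $ i)) a A *
        tau_sym i B C)"

definition twistor_op ::
    "nat \<Rightarrow> ('m, 'e::euclidean_space) metric \<Rightarrow> ('m, 'e) chart \<Rightarrow> 'e \<Rightarrow>
     (3 \<Rightarrow> 'e \<Rightarrow> 'e) \<Rightarrow> (nat \<Rightarrow> 2 \<Rightarrow> 'e \<Rightarrow> complex) \<Rightarrow> ('m, 'e) end_field \<Rightarrow>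
     nat \<Rightarrow> 2 \<Rightarrow> 2 \<Rightarrow> 2 \<Rightarrow> complex" where
  "twistor_op n g c x I \<theta> \<sigma> a A B C =
     (let t = nabla_EHHH n g c x I \<theta> \<sigma> a
      in (t A B C + t A C B + t B A C + t B C A + t C A B + t C B A) / 6)"

definition ker_twistor ::
    "nat \<Rightarrow> ('m, 'e::euclidean_space) chart set \<Rightarrow> ('m, 'e) metric \<Rightarrow> ('m, 'e) end_bundle \<Rightarrow>
     ('m, 'e) end_field set" where
  "ker_twistor n \<A> g Q = {\<sigma>. S2H_section \<A> Q \<sigma> \<and>
     (\<forall>c\<in>\<A>. \<forall>x\<in>chart_image c. \<forall>I \<theta>. S2H_basis Q c x I \<and> EH_coframe n I \<theta> \<longrightarrow>
        (\<forall>a<2*n. \<forall>A B C. twistor_op n g c x I \<theta> \<sigma> a A B C = 0))}"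


section \<open>Quaternionic isometric actions\<close>

definition quaternionic_isometric_action ::
    "'g::topological_space monoid \<Rightarrow> ('g, 'h::euclidean_space) chart set \<Rightarrow>
     ('m::topological_space, 'e::euclidean_space) chart set \<Rightarrow> ('m, 'e) metric \<Rightarrow>
     ('m, 'e) end_bundle \<Rightarrow> ('g \<Rightarrow> 'm \<Rightarrow> 'm) \<Rightarrow> bool" where
  "quaternionic_isometric_action G \<B> \<A> g Q act \<longleftrightarrow>
     group_action G UNIV act \<and>
     smooth_map (product_atlas \<B> \<A>) \<A> (\<lambda>(a, p). act a p) \<and>
     (\<forall>a. \<forall>c\<in>\<A>. \<forall>d\<in>\<A>. \<forall>p\<in>fst c. act a p \<in> fst d \<longrightarrow>
        (let T = tangent_map c d (act a) (snd c p); y = snd d (act a p)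
         in (\<forall>u v. g d y (T u) (T v) = g c (snd c p) u v) \<and>
            Q d y = {S'. \<exists>S\<in>Q c (snd c p). S' \<circ> T = T \<circ> S}))"

text \<open>The Killing field generated by an element of the Lie algebra is the derivative of the orbit
  map at the unit.\<close>

definition fundamental_field ::
    "'g monoid \<Rightarrow> ('g, 'h::euclidean_space) chart \<Rightarrow> ('g \<Rightarrow> 'm \<Rightarrow> 'm) \<Rightarrow> 'h \<Rightarrow>
     ('m, 'e::euclidean_space) chart \<Rightarrow> 'e \<Rightarrow> 'e" where
  "fundamental_field G b act A c x =
     frechet_derivative (\<lambda>z. snd c (act (chart_inv b z) (chart_inv c x))) (at (snd b \<one>\<^bsub>G\<^esub>)) A"

definition infinitesimally_effective ::
    "'g monoid \<Rightarrow> ('g, 'h::euclidean_space) chart \<Rightarrow>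
     ('m, 'e::euclidean_space) chart set \<Rightarrow> ('g \<Rightarrow> 'm \<Rightarrow> 'm) \<Rightarrow> bool" where
  "infinitesimally_effective G b \<A> act \<longleftrightarrow>
     (\<forall>A. (\<forall>c\<in>\<A>. \<forall>x\<in>chart_image c. fundamental_field G b act A c x = 0) \<longrightarrow> A = 0)"

text \<open>\<open>\<mu> A\<close> is the contraction of the moment map with \<open>A\<close>; up to a constant it is the
  \<open>S\<^sup>2H\<close>-component of the covariant derivative of the Killing field.\<close>

definition moment_map ::
    "'g monoid \<Rightarrow> ('g, 'h::euclidean_space) chart \<Rightarrow> ('m, 'e::euclidean_space) chart set \<Rightarrow>
     ('m, 'e) metric \<Rightarrow> ('m, 'e) end_bundle \<Rightarrow> ('g \<Rightarrow> 'm \<Rightarrow> 'm) \<Rightarrow>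
     ('h \<Rightarrow> ('m, 'e) end_field) \<Rightarrow> bool" where
  "moment_map G b \<A> g Q act \<mu> \<longleftrightarrow>
     (\<forall>A. S2H_section \<A> Q (\<mu> A)) \<and>
     (\<exists>k::real. k \<noteq> 0 \<and> (\<forall>A. \<forall>c\<in>\<A>. \<forall>x\<in>chart_image c.
        \<mu> A c x = (\<lambda>u. k *\<^sub>R
          S2H_component Q c x (nabla_vec g c (fundamental_field G b act A c) x) u)))"

definition ker_twistor_lie ::
    "nat \<Rightarrow> ('m, 'e::euclidean_space) chart set \<Rightarrow> ('m, 'e) metric \<Rightarrow> ('m, 'e) end_bundle \<Rightarrow>
     ('h \<Rightarrow> ('m, 'e) end_field) \<Rightarrow> ('m, 'e) end_field set" where
  "ker_twistor_lie n \<A> g Q \<mu> = {\<sigma> \<in> ker_twistor n \<A> g Q. \<exists>A. \<sigma> = \<mu> A}"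


section \<open>The Grassmannian of oriented 3-planes\<close>

text \<open>From here on \<open>ip\<close> is the inner product of the Lie algebra \<open>'h\<close>.  An oriented 3-plane is the
  set of its positively oriented bases.\<close>

definition frame3 :: "'h::euclidean_space^3 \<Rightarrow> bool" where
  "frame3 v \<longleftrightarrow> (\<forall>a :: real^3. (\<Sum>i\<in>UNIV. a $ i *\<^sub>R v $ i) = 0 \<longrightarrow> a = 0)"

definition orthonormal3 :: "('h::euclidean_space \<Rightarrow> 'h \<Rightarrow> real) \<Rightarrow> 'h^3 \<Rightarrow> bool" where
  "orthonormal3 ip v \<longleftrightarrow> (\<forall>i j. ip (v $ i) (v $ j) = (if i = j then 1 else 0))"

definition ospan :: "'h::euclidean_space^3 \<Rightarrow> ('h^3) set" where
  "ospan v = {w. \<exists>a :: real^3^3. det a > 0 \<and> (\<forall>i. w $ i = (\<Sum>j\<in>UNIV. a $ i $ j *\<^sub>R v $ j))}"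

definition Gr3 :: "('h::euclidean_space^3) set set" where
  "Gr3 = ospan ` {v. frame3 v}"

text \<open>The fibres of the tautological bundle and of its orthogonal complement, and the projection.\<close>

definition taut :: "('h::euclidean_space^3) set \<Rightarrow> 'h set" where
  "taut P = (\<Union>v\<in>P. span (range (($) v)))"

definition perp :: "('h::euclidean_space \<Rightarrow> 'h \<Rightarrow> real) \<Rightarrow> ('h^3) set \<Rightarrow> 'h set" where
  "perp ip P = {w. \<forall>u\<in>taut P. ip w u = 0}"

definition proj_taut :: "('h::euclidean_space \<Rightarrow> 'h \<Rightarrow> real) \<Rightarrow> ('h^3) set \<Rightarrow> 'h \<Rightarrow> 'h" where
  "proj_taut ip P A = (THE u. u \<in> taut P \<and> A - u \<in> perp ip P)"

text \<open>The Grassmannian carries the smooth structure of a quotient of the open set of all frames, so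
  smoothness of a section is smoothness as a function of frames.\<close>

definition taut_section :: "(('h::euclidean_space^3) set \<Rightarrow> 'h) \<Rightarrow> bool" where
  "taut_section s \<longleftrightarrow>
     (\<forall>P\<in>Gr3. s P \<in> taut P) \<and> (\<forall>P. P \<notin> Gr3 \<longrightarrow> s P = 0) \<and>
     smooth_on {v. frame3 v} (\<lambda>v. s (ospan v))"

definition const_proj :: "('h::euclidean_space \<Rightarrow> 'h \<Rightarrow> real) \<Rightarrow> 'h \<Rightarrow> ('h^3) set \<Rightarrow> 'h" where
  "const_proj ip A P = (if P \<in> Gr3 then proj_taut ip P A else 0)"

text \<open>A tangent vector at \<open>P\<close> is a linear map \<open>X\<close> from the fibre of \<open>V\<close> at \<open>P\<close> to that of its
  orthogonal complement; it is the velocity of the curve of graphs of \<open>t X\<close> at \<open>t = 0\<close>.\<close>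

definition graph_plane :: "('h::euclidean_space^3) set \<Rightarrow> ('h \<Rightarrow> 'h) \<Rightarrow> ('h^3) set" where
  "graph_plane P X = (\<lambda>v. \<chi> i. v $ i + X (v $ i)) ` P"

definition nabla_taut ::
    "('h::euclidean_space \<Rightarrow> 'h \<Rightarrow> real) \<Rightarrow> (('h^3) set \<Rightarrow> 'h) \<Rightarrow> ('h^3) set \<Rightarrow> ('h \<Rightarrow> 'h) \<Rightarrow> 'h" where
  "nabla_taut ip s P X =
     proj_taut ip P (vector_derivative (\<lambda>t::real. s (graph_plane P (\<lambda>u. t *\<^sub>R X u))) (at 0))"

text \<open>\<open>\<nabla>s\<close> as a trilinear form on \<open>V\<^sup>\<bottom> \<times> V \<times> V\<close>: the covector \<open>w \<otimes> u\<close> corresponds to the tangent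
  vector \<open>z \<mapsto> \<langle>u, z\<rangle> w\<close>.\<close>

definition nabla_taut_form ::
    "('h::euclidean_space \<Rightarrow> 'h \<Rightarrow> real) \<Rightarrow> (('h^3) set \<Rightarrow> 'h) \<Rightarrow> ('h^3) set \<Rightarrow> 'h \<Rightarrow> 'h \<Rightarrow> 'h \<Rightarrow> real" where
  "nabla_taut_form ip s P w u u' = ip (nabla_taut ip s P (\<lambda>z. ip u z *\<^sub>R w)) u'"

definition form_trace ::
    "('h::euclidean_space \<Rightarrow> 'h \<Rightarrow> real) \<Rightarrow> ('h^3) set \<Rightarrow> ('h \<Rightarrow> 'h \<Rightarrow> real) \<Rightarrow> real" where
  "form_trace ip P T = (THE t. \<forall>e\<in>P. orthonormal3 ip e \<longrightarrow> t = (\<Sum>i\<in>UNIV. T (e $ i) (e $ i)))"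

definition D_op ::
    "('h::euclidean_space \<Rightarrow> 'h \<Rightarrow> real) \<Rightarrow> (('h^3) set \<Rightarrow> 'h) \<Rightarrow> ('h^3) set \<Rightarrow> 'h \<Rightarrow> 'h \<Rightarrow> 'h \<Rightarrow> real" where
  "D_op ip s P w u u' = nabla_taut_form ip s P w u u' -
     form_trace ip P (nabla_taut_form ip s P w) / 3 * ip u u'"

definition ker_D :: "('h::euclidean_space \<Rightarrow> 'h \<Rightarrow> real) \<Rightarrow> (('h^3) set \<Rightarrow> 'h) set" where
  "ker_D ip = {s. taut_section s \<and>
     (\<forall>P\<in>Gr3. \<forall>w\<in>perp ip P. \<forall>u\<in>taut P. \<forall>u'\<in>taut P. D_op ip s P w u u' = 0)}"


section \<open>The map to the Grassmannian and its lifts\<close>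

text \<open>\<open>\<mu> = \<Sum>\<^sub>i I\<^sub>i \<otimes> B\<^sub>i\<close> at a point.\<close>

definition moment_components ::
    "('h::euclidean_space \<Rightarrow> 'h \<Rightarrow> real) \<Rightarrow> ('h \<Rightarrow> ('m, 'e::euclidean_space) end_field) \<Rightarrow>
     ('m, 'e) chart \<Rightarrow> 'e \<Rightarrow> (3 \<Rightarrow> 'e \<Rightarrow> 'e) \<Rightarrow> 'h^3 \<Rightarrow> bool" where
  "moment_components ip \<mu> c x I B \<longleftrightarrow>
     (\<forall>A. \<mu> A c x = (\<lambda>u. \<Sum>i\<in>UNIV. ip (B $ i) A *\<^sub>R I i u))"

definition M0 ::
    "('h::euclidean_space \<Rightarrow> 'h \<Rightarrow> real) \<Rightarrow> ('m, 'e::euclidean_space) chart set \<Rightarrow>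
     ('m, 'e) end_bundle \<Rightarrow> ('h \<Rightarrow> ('m, 'e) end_field) \<Rightarrow> 'm set" where
  "M0 ip \<A> Q \<mu> = {p. \<exists>c\<in>\<A>. p \<in> fst c \<and> (\<exists>I B. S2H_basis Q c (snd c p) I \<and>
     moment_components ip \<mu> c (snd c p) I B \<and> frame3 B)}"

definition Psi ::
    "('h::euclidean_space \<Rightarrow> 'h \<Rightarrow> real) \<Rightarrow> ('m, 'e::euclidean_space) chart set \<Rightarrow>
     ('m, 'e) end_bundle \<Rightarrow> ('h \<Rightarrow> ('m, 'e) end_field) \<Rightarrow> 'm \<Rightarrow> ('h^3) set" where
  "Psi ip \<A> Q \<mu> p = (THE P. \<exists>c\<in>\<A>. p \<in> fst c \<and> (\<exists>I B. S2H_basis Q c (snd c p) I \<and>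
     moment_components ip \<mu> c (snd c p) I B \<and> P = ospan B))"

definition conformal ::
    "('h::euclidean_space \<Rightarrow> 'h \<Rightarrow> real) \<Rightarrow> ('m, 'e::euclidean_space) chart set \<Rightarrow>
     ('m, 'e) end_bundle \<Rightarrow> ('h \<Rightarrow> ('m, 'e) end_field) \<Rightarrow> bool" where
  "conformal ip \<A> Q \<mu> \<longleftrightarrow> (\<exists>\<rho> :: 'm \<Rightarrow> real. \<forall>p\<in>M0 ip \<A> Q \<mu>. \<forall>c\<in>\<A>. p \<in> fst c \<longrightarrow>
     (\<forall>I B. S2H_basis Q c (snd c p) I \<and> moment_components ip \<mu> c (snd c p) I B \<longrightarrow>
        (\<exists>v. orthonormal3 ip v \<and> span (range (($) v)) = taut (Psi ip \<A> Q \<mu> p) \<and>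
           (\<forall>i. B $ i = \<rho> p *\<^sub>R v $ i))))"

text \<open>
  A smooth vector bundle morphism \<open>F\<close> from the restriction of \<open>S\<^sup>2H\<close> to \<open>N\<close> to the tautological
  bundle, covering \<open>f\<close>.  The clauses say: \<open>f\<close> is a smooth map (it lifts locally to smooth maps
  to the space of frames); \<open>F\<close> maps fibres linearly to fibres; it does not depend on the chart; it
  takes smooth local sections to smooth functions.
\<close>

definition bundle_morphism ::
    "('m, 'e::euclidean_space) chart set \<Rightarrow> ('m, 'e) end_bundle \<Rightarrow> 'm set \<Rightarrow>
     ('m \<Rightarrow> ('h::euclidean_space^3) set) \<Rightarrow>
     (('m, 'e) chart \<Rightarrow> 'e \<Rightarrow> ('e \<Rightarrow> 'e) \<Rightarrow> 'h) \<Rightarrow> bool" where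
  "bundle_morphism \<A> Q N f F \<longleftrightarrow>
     (\<forall>c\<in>\<A>. \<forall>p\<in>fst c \<inter> N. \<exists>U v. open U \<and> snd c p \<in> U \<and> U \<subseteq> snd c ` (fst c \<inter> N) \<and>
        smooth_on U v \<and> (\<forall>y\<in>U. frame3 (v y) \<and> f (chart_inv c y) = ospan (v y))) \<and>
     (\<forall>c\<in>\<A>. \<forall>p\<in>fst c \<inter> N.
        (\<forall>S\<in>Q c (snd c p). F c (snd c p) S \<in> taut (f p)) \<and>
        (\<forall>S\<in>Q c (snd c p). \<forall>T\<in>Q c (snd c p). \<forall>a b :: real.
           F c (snd c p) (\<lambda>u. a *\<^sub>R S u + b *\<^sub>R T u) =
           a *\<^sub>R F c (snd c p) S + b *\<^sub>R F c (snd c p) T)) \<and>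
     (\<forall>c\<in>\<A>. \<forall>d\<in>\<A>. \<forall>p\<in>fst c \<inter> fst d \<inter> N. \<forall>S\<in>Q c (snd c p). \<forall>T\<in>Q d (snd d p).
        T \<circ> tangent_map c d id (snd c p) = tangent_map c d id (snd c p) \<circ> S \<longrightarrow>
        F d (snd d p) T = F c (snd c p) S) \<and>
     (\<forall>c\<in>\<A>. \<forall>U \<sigma>. open U \<and> U \<subseteq> snd c ` (fst c \<inter> N) \<and>
        (\<forall>y\<in>U. \<sigma> y \<in> Q c y) \<and> (\<forall>u. smooth_on U (\<lambda>y. \<sigma> y u)) \<longrightarrow>
        smooth_on U (\<lambda>y. F c y (\<sigma> y)))"

text \<open>Linear bijections between spaces of sections, with the pointwise operations.\<close>

definition linear_bij_sections ::
    "('c \<Rightarrow> 'e \<Rightarrow> 'e \<Rightarrow> 'e::real_vector) set \<Rightarrow> ('p \<Rightarrow> 'h::real_vector) set \<Rightarrow>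
     (('c \<Rightarrow> 'e \<Rightarrow> 'e \<Rightarrow> 'e) \<Rightarrow> 'p \<Rightarrow> 'h) \<Rightarrow> bool" where
  "linear_bij_sections K L F \<longleftrightarrow> bij_betw F K L \<and>
     (\<forall>\<sigma>\<in>K. \<forall>\<tau>\<in>K. \<forall>a b :: real.
        (\<lambda>c x u. a *\<^sub>R \<sigma> c x u + b *\<^sub>R \<tau> c x u) \<in> K \<and>
        F (\<lambda>c x u. a *\<^sub>R \<sigma> c x u + b *\<^sub>R \<tau> c x u) = (\<lambda>P. a *\<^sub>R F \<sigma> P + b *\<^sub>R F \<tau> P))"

end

theory Submission
  imports Defs
begin

text \<open>
  Both kernels are copies of the Lie algebra: the sections \<open>\<mu>\<^sub>A\<close> make up the kernel of the twistor
  operator under consideration, the sections \<open>s\<^sub>A\<close> make up the kernel of \<open>D\<close>, and the bijection is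
  \<open>\<mu>\<^sub>A \<mapsto> s\<^sub>A\<close>.  Three things have to be seen.

  \<^item> Every \<open>\<mu>\<^sub>A\<close> is a twistor section and \<open>A \<mapsto> \<mu>\<^sub>A\<close> is injective.  Let \<open>X\<close> be the Killing field of
    \<open>A\<close>.  By Kostant's formula (\<open>kostant\<close>) \<open>\<nabla>\<^sub>u\<nabla>X = - R(X, u)\<close>, so \<open>\<nabla>\<^sub>u\<mu>\<^sub>A\<close> is the \<open>S\<^sup>2H\<close>-part of the
    curvature, up to a constant.  On a quaternion-Kaehler manifold of dimension at least 8 the
    algebraic symmetries of the curvature force this part to be \<open>\<nu> \<Sum>\<^sub>i \<langle>X, I\<^sub>i u\<rangle> I\<^sub>i\<close>, where \<open>\<nu>\<close> is a
    nonzero constant times the scalar curvature (\<open>curvature_S2H\<close>).  Such a tensor is the image of \<open>X\<close> under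
    an embedding of \<open>E \<otimes> H\<close> into \<open>E \<otimes> H \<otimes> S\<^sup>2H\<close>; it is killed by symmetrization
    (\<open>tau_symmetrization\<close>), which is the twistor equation, and it vanishes only for \<open>X = 0\<close>,
    which gives injectivity.

  \<^item> The kernel of \<open>D\<close> consists of the \<open>s\<^sub>A\<close> only (\<open>ker_D_eq\<close>).  The equation \<open>D s = 0\<close> implies that
    \<open>\<langle>s(P), u\<rangle>\<close> is constant while the plane \<open>P\<close> moves among the planes that contain the vector \<open>u\<close>.
    As the Lie algebra has dimension at least 4, these planes form a connected set, and
    \<open>\<langle>s(P), u\<rangle>\<close> is a function of \<open>u\<close> alone.  It is linear on every 3-plane, hence linear, and so
    it is \<open>\<langle>A, u\<rangle>\<close> for some \<open>A\<close>.

  \<^item> If \<open>\<mu> = \<Sum>\<^sub>i I\<^sub>i \<otimes> B\<^sub>i\<close> with \<open>B\<^sub>i = \<lambda> v\<^sub>i\<close>, then the linear map \<open>I\<^sub>i \<mapsto> B\<^sub>i / \<lambda>\<^sup>2\<close> takes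
    \<open>\<mu>\<^sub>A = \<Sum>\<^sub>i \<langle>B\<^sub>i, A\<rangle> I\<^sub>i\<close> to \<open>\<Sum>\<^sub>i \<langle>v\<^sub>i, A\<rangle> v\<^sub>i = s\<^sub>A\<close>.  This is the lift (\<open>lift_moment\<close>).

  All of the geometry is computed in charts, with directional derivatives of functions on open
  sets of Euclidean spaces.
\<close>

section \<open>Calculus of smooth functions\<close>

lemma has_derivative_frechet:
  "f differentiable (at x) \<Longrightarrow> (f has_derivative frechet_derivative f (at x)) (at x)"
  by (simp add: frechet_derivative_works)

lemma frechet_derivative_eqI: "(f has_derivative f') (at x) \<Longrightarrow> frechet_derivative f (at x) = f'"
  using frechet_derivative_at by metis

lemma Ck_on_subset: "Ck_on k S f \<Longrightarrow> T \<subseteq> S \<Longrightarrow> Ck_on k T f"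
  by (induction k arbitrary: f) (auto intro: continuous_on_subset)

lemma Ck_on_cong:
  assumes "open S" "\<And>x. x \<in> S \<Longrightarrow> f x = g x"
  shows "Ck_on k S f \<longleftrightarrow> Ck_on k S g"
  using assms(2)
proof (induction k arbitrary: f g)
  case 0
  then show ?case by (auto intro: continuous_on_cong)
next
  case (Suc k)
  have d: "f differentiable at x \<longleftrightarrow> g differentiable at x" if "x \<in> S" for x
    using has_derivative_transform_within_open[OF _ \<open>open S\<close> that] Suc.prems
    unfolding differentiable_def by metis
  have e: "frechet_derivative f (at x) = frechet_derivative g (at x)"
    if "x \<in> S" "f differentiable at x" for x
    using frechet_derivative_transform_within_open[OF _ \<open>open S\<close> that(1)] that Suc.prems by metis
  show ?case
  proof
    assume f: "Ck_on (Suc k) S f"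
    then have "Ck_on k S (\<lambda>x. frechet_derivative f (at x) v)
        \<longleftrightarrow> Ck_on k S (\<lambda>x. frechet_derivative g (at x) v)" for v
      by (intro Suc.IH) (simp add: e)
    with f d show "Ck_on (Suc k) S g" by simp
  next
    assume g: "Ck_on (Suc k) S g"
    then have "Ck_on k S (\<lambda>x. frechet_derivative f (at x) v)
        \<longleftrightarrow> Ck_on k S (\<lambda>x. frechet_derivative g (at x) v)" for v
      using e d by (intro Suc.IH) simp
    with g d show "Ck_on (Suc k) S f" by simp
  qed
qed

lemma Ck_on_transform:
  "open S \<Longrightarrow> Ck_on k S g \<Longrightarrow> (\<And>x. x \<in> S \<Longrightarrow> f x = g x) \<Longrightarrow> Ck_on k S f"
  using Ck_on_cong[of S f g] by blast

lemma Ck_on_SucD: "Ck_on (Suc k) S f \<Longrightarrow> Ck_on k S f"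
proof (induction k arbitrary: f)
  case 0
  then show ?case
    by (auto intro: differentiable_imp_continuous_on simp: differentiable_on_def differentiable_at_withinI)
next
  case (Suc k)
  then show ?case by simp
qed

lemma smooth_on_subset: "smooth_on S f \<Longrightarrow> T \<subseteq> S \<Longrightarrow> smooth_on T f"
  by (simp add: smooth_on_def) (meson Ck_on_subset)

lemma smooth_on_cong:
  "open S \<Longrightarrow> (\<And>x. x \<in> S \<Longrightarrow> f x = g x) \<Longrightarrow> smooth_on S f \<longleftrightarrow> smooth_on S g"
  using Ck_on_cong by (metis smooth_on_def)

lemma smooth_on_transform:
  "open S \<Longrightarrow> smooth_on S g \<Longrightarrow> (\<And>x. x \<in> S \<Longrightarrow> f x = g x) \<Longrightarrow> smooth_on S f"
  using smooth_on_cong[of S f g] by blast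

lemma smooth_on_differentiable: "smooth_on S f \<Longrightarrow> x \<in> S \<Longrightarrow> f differentiable (at x)"
  unfolding smooth_on_def by (metis Ck_on.simps(2))

lemma smooth_on_has_derivative:
  "smooth_on S f \<Longrightarrow> x \<in> S \<Longrightarrow> (f has_derivative frechet_derivative f (at x)) (at x)"
  using smooth_on_differentiable has_derivative_frechet by blast

lemma smooth_on_linear_derivative:
  "smooth_on S f \<Longrightarrow> x \<in> S \<Longrightarrow> linear (frechet_derivative f (at x))"
  using smooth_on_differentiable linear_frechet_derivative by blast

lemma smooth_on_derivative: "smooth_on S f \<Longrightarrow> smooth_on S (\<lambda>x. frechet_derivative f (at x) v)"
  unfolding smooth_on_def by (metis Ck_on.simps(2))

lemma smooth_on_continuous: "smooth_on S f \<Longrightarrow> continuous_on S f"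
  unfolding smooth_on_def by (metis Ck_on.simps(1))

lemma Ck_on_const: "Ck_on k S (\<lambda>x. c)"
  by (induction k arbitrary: c) auto

lemma smooth_on_const [simp]: "smooth_on S (\<lambda>x. c)"
  by (simp add: smooth_on_def Ck_on_const)

lemma Ck_on_bounded_linear:
  assumes "bounded_linear h" "open S" "Ck_on k S f"
  shows "Ck_on k S (\<lambda>x. h (f x))"
  using assms(3)
proof (induction k arbitrary: f)
  case 0
  then show ?case using bounded_linear.continuous_on[OF assms(1)] by auto
next
  case (Suc k)
  have hd: "((\<lambda>x. h (f x)) has_derivative (\<lambda>v. h (frechet_derivative f (at x) v))) (at x)"
    if "x \<in> S" for x
    by (rule bounded_linear.has_derivative[OF assms(1)], rule has_derivative_frechet)
      (use Suc.prems that in auto)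
  then have eq: "frechet_derivative (\<lambda>x. h (f x)) (at x) = (\<lambda>v. h (frechet_derivative f (at x) v))"
    if "x \<in> S" for x
    using frechet_derivative_eqI that by blast
  have c: "Ck_on k S (\<lambda>x. h (frechet_derivative f (at x) v))" for v
    by (rule Suc.IH) (use Suc.prems in auto)
  have "Ck_on k S (\<lambda>x. frechet_derivative (\<lambda>x. h (f x)) (at x) v)" for v
    by (rule Ck_on_transform[OF \<open>open S\<close> c[of v]]) (simp add: eq)
  with hd show ?case by (auto simp: differentiable_def)
qed

lemma smooth_on_bounded_linear:
  "bounded_linear h \<Longrightarrow> open S \<Longrightarrow> smooth_on S f \<Longrightarrow> smooth_on S (\<lambda>x. h (f x))"
  by (simp add: smooth_on_def Ck_on_bounded_linear)

lemma Ck_on_add: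
  assumes "open S" "Ck_on k S f" "Ck_on k S g"
  shows "Ck_on k S (\<lambda>x. f x + g x)"
  using assms(2,3)
proof (induction k arbitrary: f g)
  case 0
  then show ?case by (auto intro: continuous_on_add)
next
  case (Suc k)
  have hd: "((\<lambda>x. f x + g x) has_derivative
      (\<lambda>v. frechet_derivative f (at x) v + frechet_derivative g (at x) v)) (at x)" if "x \<in> S" for x
    by (intro has_derivative_add has_derivative_frechet) (use Suc.prems that in auto)
  then have eq: "frechet_derivative (\<lambda>x. f x + g x) (at x) =
      (\<lambda>v. frechet_derivative f (at x) v + frechet_derivative g (at x) v)" if "x \<in> S" for x
    using frechet_derivative_eqI that by blast
  have c: "Ck_on k S (\<lambda>x. frechet_derivative f (at x) v + frechet_derivative g (at x) v)" for v
    by (rule Suc.IH) (use Suc.prems in auto)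
  have "Ck_on k S (\<lambda>x. frechet_derivative (\<lambda>x. f x + g x) (at x) v)" for v
    by (rule Ck_on_transform[OF \<open>open S\<close> c[of v]]) (simp add: eq)
  with hd show ?case by (auto simp: differentiable_def)
qed

lemma smooth_on_add:
  "open S \<Longrightarrow> smooth_on S f \<Longrightarrow> smooth_on S g \<Longrightarrow> smooth_on S (\<lambda>x. f x + g x)"
  by (simp add: smooth_on_def Ck_on_add)

lemma smooth_on_sum:
  assumes "open S" "\<And>i. i \<in> I \<Longrightarrow> smooth_on S (f i)"
  shows "smooth_on S (\<lambda>x. \<Sum>i\<in>I. f i x)"
  using assms(2)
proof (induction I rule: infinite_finite_induct)
  case (insert i I)
  then show ?case using smooth_on_add[OF \<open>open S\<close>, of "f i"] by simp
qed auto

lemma Ck_on_bilinear: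
  assumes "bounded_bilinear ml" "open S" "Ck_on k S f" "Ck_on k S g"
  shows "Ck_on k S (\<lambda>x. ml (f x) (g x))"
  using assms(3,4)
proof (induction k arbitrary: f g)
  case 0
  then show ?case using bounded_bilinear.continuous_on[OF assms(1)] by auto
next
  case (Suc k)
  let ?f' = "\<lambda>x. frechet_derivative f (at x)" and ?g' = "\<lambda>x. frechet_derivative g (at x)"
  have hd: "((\<lambda>x. ml (f x) (g x)) has_derivative
      (\<lambda>v. ml (f x) (?g' x v) + ml (?f' x v) (g x))) (at x)" if "x \<in> S" for x
    by (intro bounded_bilinear.FDERIV[OF assms(1)] has_derivative_frechet)
      (use Suc.prems that in auto)
  then have eq: "frechet_derivative (\<lambda>x. ml (f x) (g x)) (at x) =
      (\<lambda>v. ml (f x) (?g' x v) + ml (?f' x v) (g x))" if "x \<in> S" for x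
    using frechet_derivative_eqI that by blast
  have c: "Ck_on k S (\<lambda>x. ml (f x) (?g' x v) + ml (?f' x v) (g x))" for v
    using Suc.prems Ck_on_SucD[OF Suc.prems(1)] Ck_on_SucD[OF Suc.prems(2)]
    by (intro Ck_on_add Suc.IH \<open>open S\<close>) auto
  have "Ck_on k S (\<lambda>x. frechet_derivative (\<lambda>x. ml (f x) (g x)) (at x) v)" for v
    by (rule Ck_on_transform[OF \<open>open S\<close> c[of v]]) (simp add: eq)
  with hd show ?case by (auto simp: differentiable_def)
qed

lemma smooth_on_bilinear:
  "bounded_bilinear ml \<Longrightarrow> open S \<Longrightarrow> smooth_on S f \<Longrightarrow> smooth_on S g \<Longrightarrow>
    smooth_on S (\<lambda>x. ml (f x) (g x))"
  by (simp add: smooth_on_def Ck_on_bilinear)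

lemmas smooth_on_mult = smooth_on_bilinear[OF bounded_bilinear_mult]
lemmas smooth_on_scaleR = smooth_on_bilinear[OF bounded_bilinear_scaleR]
lemmas smooth_on_inner = smooth_on_bilinear[OF bounded_bilinear_inner]

lemma smooth_on_minus: "open S \<Longrightarrow> smooth_on S f \<Longrightarrow> smooth_on S (\<lambda>x. - f x)"
  using smooth_on_bounded_linear[OF bounded_linear_minus[OF bounded_linear_ident]] .

lemma smooth_on_diff:
  "open S \<Longrightarrow> smooth_on S f \<Longrightarrow> smooth_on S g \<Longrightarrow> smooth_on S (\<lambda>x. f x - g x)"
  using smooth_on_add[of S f "\<lambda>x. - g x"] smooth_on_minus[of S g] by simp

lemma Ck_on_inverse:
  fixes f :: "'a::real_normed_vector \<Rightarrow> real"
  assumes "open S" "Ck_on k S f" "\<And>x. x \<in> S \<Longrightarrow> f x \<noteq> 0"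
  shows "Ck_on k S (\<lambda>x. inverse (f x))"
  using assms(2)
proof (induction k)
  case 0
  then show ?case using assms(3) by (auto intro: continuous_on_inverse)
next
  case (Suc k)
  let ?f' = "\<lambda>x. frechet_derivative f (at x)"
  have hd: "((\<lambda>x. inverse (f x)) has_derivative
      (\<lambda>v. - (inverse (f x) * ?f' x v * inverse (f x)))) (at x)" if "x \<in> S" for x
    by (intro Deriv.has_derivative_inverse has_derivative_frechet)
      (use Suc.prems assms(3) that in auto)
  then have eq: "frechet_derivative (\<lambda>x. inverse (f x)) (at x) =
      (\<lambda>v. - (inverse (f x) * ?f' x v * inverse (f x)))" if "x \<in> S" for x
    using frechet_derivative_eqI that by blast
  have c: "Ck_on k S (\<lambda>x. - (inverse (f x) * ?f' x v * inverse (f x)))" for v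
    using Suc Ck_on_SucD[OF Suc.prems]
    by (intro Ck_on_bounded_linear[OF bounded_linear_minus[OF bounded_linear_ident]]
        Ck_on_bilinear[OF bounded_bilinear_mult] \<open>open S\<close>) auto
  have "Ck_on k S (\<lambda>x. frechet_derivative (\<lambda>x. inverse (f x)) (at x) v)" for v
    by (rule Ck_on_transform[OF \<open>open S\<close> c[of v]]) (simp add: eq)
  with hd show ?case by (auto simp: differentiable_def)
qed

lemma smooth_on_divide:
  fixes f g :: "'a::real_normed_vector \<Rightarrow> real"
  assumes "open S" "smooth_on S f" "smooth_on S g" "\<And>x. x \<in> S \<Longrightarrow> g x \<noteq> 0"
  shows "smooth_on S (\<lambda>x. f x / g x)"
proof -
  have "smooth_on S (\<lambda>x. inverse (g x))"
    using assms Ck_on_inverse by (metis smooth_on_def)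
  then show ?thesis using smooth_on_mult assms by (simp add: divide_inverse)
qed

text \<open>Affine substitutions suffice in the sequel: they restrict functions of two variables to
  slices.\<close>

lemma Ck_on_affine:
  assumes "bounded_linear L" "open S" "open T" "\<And>x. x \<in> T \<Longrightarrow> a + L x \<in> S" "Ck_on k S f"
  shows "Ck_on k T (\<lambda>x. f (a + L x))"
  using assms(5)
proof (induction k arbitrary: f)
  case 0
  have "continuous_on T (\<lambda>x. a + L x)"
    using bounded_linear.continuous_on[OF assms(1) continuous_on_id] by (intro continuous_intros) auto
  then show ?case using 0 continuous_on_compose2[of S f T "\<lambda>x. a + L x"] assms(4) by auto
next
  case (Suc k)
  have hd: "((\<lambda>x. f (a + L x)) has_derivative (\<lambda>v. frechet_derivative f (at (a + L x)) (L v))) (at x)"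
    if "x \<in> T" for x
  proof -
    have l: "((\<lambda>x. a + L x) has_derivative L) (at x)"
      using has_derivative_add[OF has_derivative_const bounded_linear_imp_has_derivative[OF assms(1)],
        of a "at x"] by simp
    show ?thesis
      by (rule has_derivative_compose[OF l, of f], rule has_derivative_frechet)
        (use Suc.prems assms(4) that in auto)
  qed
  then have eq: "frechet_derivative (\<lambda>x. f (a + L x)) (at x) =
      (\<lambda>v. frechet_derivative f (at (a + L x)) (L v))" if "x \<in> T" for x
    using frechet_derivative_eqI that by blast
  have c: "Ck_on k T (\<lambda>x. frechet_derivative f (at (a + L x)) (L v))" for v
    by (rule Suc.IH) (use Suc.prems in auto)
  have "Ck_on k T (\<lambda>x. frechet_derivative (\<lambda>x. f (a + L x)) (at x) v)" for v
    by (rule Ck_on_transform[OF \<open>open T\<close> c[of v]]) (simp add: eq)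
  with hd show ?case by (auto simp: differentiable_def)
qed

lemma smooth_on_affine:
  "bounded_linear L \<Longrightarrow> open S \<Longrightarrow> open T \<Longrightarrow> (\<And>x. x \<in> T \<Longrightarrow> a + L x \<in> S) \<Longrightarrow> smooth_on S f \<Longrightarrow>
    smooth_on T (\<lambda>x. f (a + L x))"
  unfolding smooth_on_def using Ck_on_affine by blast

lemma smooth_on_ident: "open S \<Longrightarrow> smooth_on S (\<lambda>x. x)"
proof -
  assume "open S"
  have "Ck_on k S (\<lambda>x. x)" for k
    by (cases k) (auto simp: Ck_on_const)
  then show ?thesis by (simp add: smooth_on_def)
qed

lemma smooth_on_componentwise:
  fixes f :: "'a::real_normed_vector \<Rightarrow> 'b::euclidean_space"
  assumes "open S" "\<And>b. b \<in> Basis \<Longrightarrow> smooth_on S (\<lambda>x. f x \<bullet> b)"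
  shows "smooth_on S f"
proof -
  have "smooth_on S (\<lambda>x. \<Sum>b\<in>Basis. (f x \<bullet> b) *\<^sub>R b)"
    using assms by (intro smooth_on_sum smooth_on_scaleR) auto
  then show ?thesis by (simp add: euclidean_representation)
qed

lemma smooth_on_vec_nth:
  assumes "open S" "\<And>i. smooth_on S (\<lambda>x. f x $ i)"
  shows "smooth_on S (f :: 'a::real_normed_vector \<Rightarrow> 'b::euclidean_space ^ 'n)"
proof (rule smooth_on_componentwise[OF assms(1)])
  fix b :: "'b^'n" assume "b \<in> Basis"
  then obtain i u where "b = axis i u" "u \<in> Basis" by (auto simp: Basis_vec_def)
  then show "smooth_on S (\<lambda>x. f x \<bullet> b)"
    using assms by (simp add: inner_axis) (intro smooth_on_inner, auto)
qed

text \<open>Schwarz' theorem.  Two applications of the mean value theorem show that the second difference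
  of a function over a square of side \<open>h\<close> is \<open>h\<^sup>2\<close> times a value of either mixed partial derivative
  in the square.  By continuity the two derivatives agree at the corner.\<close>

lemma mixed_partials_real:
  fixes f :: "real \<Rightarrow> real \<Rightarrow> real"
  assumes "r > 0"
    and fx: "\<And>s t. \<bar>s\<bar> < r \<Longrightarrow> \<bar>t\<bar> < r \<Longrightarrow> ((\<lambda>s. f s t) has_field_derivative fx s t) (at s)"
    and fxy: "\<And>s t. \<bar>s\<bar> < r \<Longrightarrow> \<bar>t\<bar> < r \<Longrightarrow> ((\<lambda>t. fx s t) has_field_derivative fxy s t) (at t)"
    and fy: "\<And>s t. \<bar>s\<bar> < r \<Longrightarrow> \<bar>t\<bar> < r \<Longrightarrow> ((\<lambda>t. f s t) has_field_derivative fy s t) (at t)"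
    and fyx: "\<And>s t. \<bar>s\<bar> < r \<Longrightarrow> \<bar>t\<bar> < r \<Longrightarrow> ((\<lambda>s. fy s t) has_field_derivative fyx s t) (at s)"
    and c1: "isCont (\<lambda>p. fxy (fst p) (snd p)) (0, 0)"
    and c2: "isCont (\<lambda>p. fyx (fst p) (snd p)) (0, 0)"
  shows "fxy 0 0 = fyx 0 0"
proof (rule ccontr)
  assume ne: "fxy 0 0 \<noteq> fyx 0 0"
  define e where "e = \<bar>fxy 0 0 - fyx 0 0\<bar> / 2"
  have "e > 0" using ne by (simp add: e_def)
  obtain d1 where d1: "d1 > 0" "\<And>p. dist p (0,0) < d1 \<Longrightarrow> dist (fxy (fst p) (snd p)) (fxy 0 0) < e"
    using c1 \<open>e > 0\<close> unfolding continuous_at_eps_delta by (metis fst_conv snd_conv)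
  obtain d2 where d2: "d2 > 0" "\<And>p. dist p (0,0) < d2 \<Longrightarrow> dist (fyx (fst p) (snd p)) (fyx 0 0) < e"
    using c2 \<open>e > 0\<close> unfolding continuous_at_eps_delta by (metis fst_conv snd_conv)
  define h where "h = min r (min d1 d2) / 4"
  have h: "h > 0" "h < r" "2 * h < d1" "2 * h < d2"
    using \<open>r > 0\<close> d1(1) d2(1) by (auto simp: h_def min_def)
  have near: "dist (s, t) (0, 0) \<le> 2 * h" if "0 < s" "s < h" "0 < t" "t < h" for s t :: real
    using that norm_Pair_le[of s t] by (simp add: dist_norm)
  let ?D = "f h h - f h 0 - f 0 h + f 0 0"
  obtain s where s: "0 < s" "s < h" "?D = h * (fx s h - fx s 0)"
  proof -
    have "\<exists>s>0. s < h \<and> (f h h - f h 0) - (f 0 h - f 0 0) = (h - 0) * (fx s h - fx s 0)"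
      by (rule MVT2[of 0 h "\<lambda>s. f s h - f s 0"]) (use h in \<open>auto intro!: DERIV_diff fx\<close>)
    then show ?thesis using that by auto
  qed
  obtain t where t: "0 < t" "t < h" "fx s h - fx s 0 = h * fxy s t"
  proof -
    have "\<exists>t>0. t < h \<and> fx s h - fx s 0 = (h - 0) * fxy s t"
      by (rule MVT2[of 0 h "\<lambda>t. fx s t"]) (use h s in \<open>auto intro!: fxy\<close>)
    then show ?thesis using that by auto
  qed
  obtain t' where t': "0 < t'" "t' < h" "?D = h * (fy h t' - fy 0 t')"
  proof -
    have "\<exists>t>0. t < h \<and> (f h h - f 0 h) - (f h 0 - f 0 0) = (h - 0) * (fy h t - fy 0 t)"
      by (rule MVT2[of 0 h "\<lambda>t. f h t - f 0 t"]) (use h in \<open>auto intro!: DERIV_diff fy\<close>)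
    then show ?thesis using that by (auto simp: algebra_simps)
  qed
  obtain s' where s': "0 < s'" "s' < h" "fy h t' - fy 0 t' = h * fyx s' t'"
  proof -
    have "\<exists>s>0. s < h \<and> fy h t' - fy 0 t' = (h - 0) * fyx s t'"
      by (rule MVT2[of 0 h "\<lambda>s. fy s t'"]) (use h t' in \<open>auto intro!: fyx\<close>)
    then show ?thesis using that by auto
  qed
  have "fxy s t = fyx s' t'" using s t s' t' h(1) by simp
  moreover have "dist (fxy s t) (fxy 0 0) < e" using d1(2)[of "(s, t)"] near s t h by fastforce
  moreover have "dist (fyx s' t') (fyx 0 0) < e" using d2(2)[of "(s', t')"] near s' t' h by fastforce
  ultimately show False unfolding e_def dist_real_def by (auto simp: abs_if split: if_splits)
qed

text \<open>The general case follows by restricting the components of \<open>f\<close> to the plane through \<open>x\<close>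
  spanned by \<open>u\<close> and \<open>v\<close>.\<close>

lemma mixed_partials:
  fixes f :: "'a::real_normed_vector \<Rightarrow> 'b::euclidean_space"
  assumes "open S" "smooth_on S f" "x \<in> S"
  shows "frechet_derivative (\<lambda>y. frechet_derivative f (at y) u) (at x) v =
         frechet_derivative (\<lambda>y. frechet_derivative f (at y) v) (at x) u"
proof (rule euclidean_eqI)
  fix b :: 'b assume "b \<in> Basis"
  define F where "F = (\<lambda>y. f y \<bullet> b)"
  let ?D = "\<lambda>g y. frechet_derivative g (at y)"
  have inner: "?D (\<lambda>y. g y \<bullet> b) y w = ?D g y w \<bullet> b" if "g differentiable at y" for g :: "'a \<Rightarrow> 'b" and y w
    using frechet_derivative_eqI[OF has_derivative_inner_left[OF has_derivative_frechet[OF that]]] by simp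
  have sF: "smooth_on S F"
    unfolding F_def using assms by (intro smooth_on_inner) auto
  have DF: "?D F y w = ?D f y w \<bullet> b" if "y \<in> S" for y w
    unfolding F_def using inner smooth_on_differentiable assms(2) that by blast
  have DDF: "?D (\<lambda>y. ?D F y w) x w' = ?D (\<lambda>y. ?D f y w) x w' \<bullet> b" for w w'
  proof -
    have d: "(\<lambda>y. ?D f y w) differentiable at x"
      using smooth_on_differentiable smooth_on_derivative assms(2,3) by blast
    have "?D (\<lambda>y. ?D F y w) x = ?D (\<lambda>y. ?D f y w \<bullet> b) x"
      using smooth_on_differentiable[OF smooth_on_derivative[OF sF] \<open>x \<in> S\<close>]
      by (rule frechet_derivative_transform_within_open[OF _ \<open>open S\<close> \<open>x \<in> S\<close>]) (simp add: DF)
    then show ?thesis using inner[OF d] by simp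
  qed
  obtain r0 where r0: "r0 > 0" "ball x r0 \<subseteq> S" using assms open_contains_ball by blast
  \<comment> \<open>With this \<open>r\<close> the whole parallelogram \<open>\<bar>s\<bar>, \<bar>t\<bar> < r\<close> is mapped into the ball of radius \<open>r0\<close>.\<close>
  define r where "r = r0 / (norm u + norm v + 1)"
  have npos: "norm u + norm v + 1 > 0" by (smt (verit) norm_ge_zero)
  have r: "r > 0" using r0 npos by (simp add: r_def)
  have inS: "x + s *\<^sub>R u + t *\<^sub>R v \<in> S" if "\<bar>s\<bar> < r" "\<bar>t\<bar> < r" for s t
  proof -
    have "norm (s *\<^sub>R u + t *\<^sub>R v) \<le> \<bar>s\<bar> * norm u + \<bar>t\<bar> * norm v"
      by (metis norm_scaleR norm_triangle_ineq)
    also have "\<dots> \<le> r * norm u + r * norm v"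
      using that by (intro add_mono mult_right_mono) auto
    also have "\<dots> < r * (norm u + norm v + 1)" using r by (simp add: algebra_simps)
    also have "\<dots> = r0" using npos by (simp add: r_def)
    finally have "norm (s *\<^sub>R u + t *\<^sub>R v) < r0" .
    moreover have "x + w \<in> ball x r0" if "norm w < r0" for w using that by (simp add: dist_norm)
    ultimately have "x + (s *\<^sub>R u + t *\<^sub>R v) \<in> ball x r0" by blast
    from subsetD[OF r0(2) this] show ?thesis by (simp only: add.assoc)
  qed
  have d1: "((\<lambda>s. g (x + s *\<^sub>R u + t *\<^sub>R v)) has_field_derivative
      ?D g (x + s *\<^sub>R u + t *\<^sub>R v) u) (at s)"
    and d2: "((\<lambda>t. g (x + s *\<^sub>R u + t *\<^sub>R v)) has_field_derivative
      ?D g (x + s *\<^sub>R u + t *\<^sub>R v) v) (at t)"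
    if "\<bar>s\<bar> < r" "\<bar>t\<bar> < r" "smooth_on S g" for s t and g :: "'a \<Rightarrow> real"
  proof -
    note gd = smooth_on_has_derivative[OF that(3) inS[OF that(1,2)]]
    note lin = smooth_on_linear_derivative[OF that(3) inS[OF that(1,2)]]
    have "((\<lambda>s. x + s *\<^sub>R u + t *\<^sub>R v) has_derivative (\<lambda>h. h *\<^sub>R u)) (at s)"
      by (auto intro!: derivative_eq_intros)
    from has_derivative_compose[OF this gd]
    show "((\<lambda>s. g (x + s *\<^sub>R u + t *\<^sub>R v)) has_field_derivative
      ?D g (x + s *\<^sub>R u + t *\<^sub>R v) u) (at s)"
      unfolding has_field_derivative_def by (simp add: linear_cmul[OF lin] mult_commute_abs)
    have "((\<lambda>t. x + s *\<^sub>R u + t *\<^sub>R v) has_derivative (\<lambda>h. h *\<^sub>R v)) (at t)"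
      by (auto intro!: derivative_eq_intros)
    from has_derivative_compose[OF this gd]
    show "((\<lambda>t. g (x + s *\<^sub>R u + t *\<^sub>R v)) has_field_derivative
      ?D g (x + s *\<^sub>R u + t *\<^sub>R v) v) (at t)"
      unfolding has_field_derivative_def by (simp add: linear_cmul[OF lin] mult_commute_abs)
  qed
  have cont: "isCont (\<lambda>p. ?D (\<lambda>y. ?D F y w) (x + fst p *\<^sub>R u + snd p *\<^sub>R v) w') (0, 0)" for w w'
  proof -
    have "isCont (\<lambda>y. ?D (\<lambda>y. ?D F y w) y w') x"
      using smooth_on_continuous[OF smooth_on_derivative[OF smooth_on_derivative[OF sF]]]
        \<open>open S\<close> \<open>x \<in> S\<close> by (simp add: continuous_on_eq_continuous_at)
    moreover have "isCont (\<lambda>p::real\<times>real. x + fst p *\<^sub>R u + snd p *\<^sub>R v) (0, 0)"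
      by (intro continuous_intros)
    ultimately show ?thesis
      using isCont_o2[of "(0::real,0::real)" "\<lambda>p. x + fst p *\<^sub>R u + snd p *\<^sub>R v"] by simp
  qed
  have "?D (\<lambda>y. ?D F y u) (x + 0 *\<^sub>R u + 0 *\<^sub>R v) v = ?D (\<lambda>y. ?D F y v) (x + 0 *\<^sub>R u + 0 *\<^sub>R v) u"
    by (rule mixed_partials_real[of r "\<lambda>s t. F (x + s *\<^sub>R u + t *\<^sub>R v)"
        "\<lambda>s t. ?D F (x + s *\<^sub>R u + t *\<^sub>R v) u" "\<lambda>s t. ?D (\<lambda>y. ?D F y u) (x + s *\<^sub>R u + t *\<^sub>R v) v"
        "\<lambda>s t. ?D F (x + s *\<^sub>R u + t *\<^sub>R v) v" "\<lambda>s t. ?D (\<lambda>y. ?D F y v) (x + s *\<^sub>R u + t *\<^sub>R v) u"])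
      (intro r d1 d2 sF smooth_on_derivative cont; assumption)+
  then show "?D (\<lambda>y. ?D f y u) x v \<bullet> b = ?D (\<lambda>y. ?D f y v) x u \<bullet> b"
    using DDF by simp
qed

section \<open>Traces and inner products\<close>

lemma linear_euclidean_expansion:
  fixes T :: "'a::euclidean_space \<Rightarrow> 'b::real_vector"
  assumes "linear T"
  shows "T v = (\<Sum>b\<in>Basis. (v \<bullet> b) *\<^sub>R T b)"
proof -
  have "T v = T (\<Sum>b\<in>Basis. (v \<bullet> b) *\<^sub>R b)" by (simp add: euclidean_representation)
  then show ?thesis by (simp add: linear_sum[OF assms] linear_cmul[OF assms])
qed

lemma endo_trace_commute:
  assumes S: "linear S" and T: "linear T"
  shows "endo_trace (S \<circ> T) = endo_trace (T \<circ> S)"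
proof -
  have "endo_trace (S \<circ> T) = (\<Sum>b\<in>Basis. \<Sum>c\<in>Basis. (T b \<bullet> c) * (S c \<bullet> b))"
    unfolding endo_trace_def comp_def
    by (subst linear_euclidean_expansion[OF S]) (simp add: inner_sum_left)
  also have "\<dots> = (\<Sum>c\<in>Basis. \<Sum>b\<in>Basis. (S c \<bullet> b) * (T b \<bullet> c))"
    by (subst sum.swap) (simp add: mult.commute)
  also have "\<dots> = endo_trace (T \<circ> S)"
    unfolding endo_trace_def comp_def
    by (subst (2) linear_euclidean_expansion[OF T]) (simp add: inner_sum_left)
  finally show ?thesis .
qed

lemma endo_trace_add: "endo_trace (\<lambda>u. S u + T u) = endo_trace S + endo_trace T"
  by (simp add: endo_trace_def inner_add_left sum.distrib)

lemma endo_trace_diff: "endo_trace (\<lambda>u. S u - T u) = endo_trace S - endo_trace T"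
  by (simp add: endo_trace_def inner_diff_left sum_subtractf)

lemma endo_trace_minus: "endo_trace (\<lambda>u. - S u) = - endo_trace S"
  by (simp add: endo_trace_def sum_negf)

lemma endo_trace_scaleR: "endo_trace (\<lambda>u. a *\<^sub>R S u) = a * endo_trace S"
  by (simp add: endo_trace_def sum_distrib_left)

lemma endo_trace_sum: "endo_trace (\<lambda>u. \<Sum>i\<in>I. S i u) = (\<Sum>i\<in>I. endo_trace (S i))"
  by (simp add: endo_trace_def inner_sum_left) (rule sum.swap)

lemma endo_trace_id: "endo_trace (\<lambda>u::'a::euclidean_space. u) = DIM('a)"
  by (simp add: endo_trace_def)

text \<open>This makes traces of endomorphism fields independent of charts.\<close>

lemma endo_trace_conj:
  assumes "linear S" "linear T" "linear t" "linear t'" "t' \<circ> t = id" "t \<circ> t' = id" "T \<circ> t = t \<circ> S"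
  shows "endo_trace T = endo_trace S"
proof -
  have "T = t \<circ> (S \<circ> t')" using assms(6,7) by (metis comp_assoc comp_id)
  then have "endo_trace T = endo_trace ((S \<circ> t') \<circ> t)"
    using endo_trace_commute assms(1-4) linear_compose by metis
  then show ?thesis using assms(5) by (simp add: comp_assoc)
qed

lemma bilinear_sum_left: "bilinear h \<Longrightarrow> h (\<Sum>i\<in>I. f i) v = (\<Sum>i\<in>I. h (f i) v)"
  unfolding bilinear_def using linear_sum by blast

lemma bilinear_sum_right: "bilinear h \<Longrightarrow> h v (\<Sum>i\<in>I. f i) = (\<Sum>i\<in>I. h v (f i))"
  unfolding bilinear_def using linear_sum by blast

locale inner_form =
  fixes q :: "'a::euclidean_space \<Rightarrow> 'a \<Rightarrow> real"
  assumes bil: "bilinear q"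
    and sym: "q u v = q v u"
    and pos: "u \<noteq> 0 \<Longrightarrow> q u u > 0"
begin

lemmas form_simps = bilinear_ladd[OF bil] bilinear_radd[OF bil] bilinear_lmul[OF bil]
  bilinear_rmul[OF bil] bilinear_lneg[OF bil] bilinear_rneg[OF bil] bilinear_lzero[OF bil]
  bilinear_rzero[OF bil] bilinear_lsub[OF bil] bilinear_rsub[OF bil]
  bilinear_sum_left[OF bil] bilinear_sum_right[OF bil]

lemma eq_0_iff: "q u u = 0 \<longleftrightarrow> u = 0"
  using pos[of u] form_simps by fastforce

lemma linear_left: "linear (\<lambda>u. q u v)" and linear_right: "linear (q u)"
  using bil by (auto simp: bilinear_def)

lemma form_eqI: "(\<And>w. q u w = q v w) \<Longrightarrow> u = v"
  using eq_0_iff[of "u - v"] by (simp add: form_simps)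

definition orthonormal_set :: "'a set \<Rightarrow> bool" where
  "orthonormal_set B \<longleftrightarrow> (\<forall>x\<in>B. \<forall>y\<in>B. q x y = (if x = y then 1 else 0))"

lemma orthonormal_set_independent:
  assumes "orthonormal_set B"
  shows "independent B"
  unfolding independent_explicit_module
proof (intro allI impI)
  fix t :: "'a set" and u :: "'a \<Rightarrow> real" and v
  assume t: "finite t" "t \<subseteq> B" "(\<Sum>v\<in>t. u v *\<^sub>R v) = 0" "v \<in> t"
  have qv: "q w v = (if w = v then 1 else 0)" if "w \<in> t" for w
    using assms t that unfolding orthonormal_set_def by (meson in_mono)
  have "0 = q (\<Sum>w\<in>t. u w *\<^sub>R w) v" by (simp add: t form_simps)
  also have "\<dots> = (\<Sum>w\<in>t. u w * (if w = v then 1 else 0))"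
    unfolding form_simps using qv by (intro sum.cong) auto
  also have "\<dots> = u v" using t by (simp add: if_distrib sum.delta cong: if_cong)
  finally show "u v = 0" by simp
qed

text \<open>An orthonormal set of maximal cardinality spans, for otherwise Gram-Schmidt would extend it.\<close>

lemma orthonormal_set_exists: "\<exists>B. orthonormal_set B \<and> finite B \<and> card B = DIM('a) \<and> span B = UNIV"
proof -
  let ?P = "\<lambda>k. \<exists>B. orthonormal_set B \<and> finite B \<and> card B = k"
  have bound: "finite B \<and> card B \<le> DIM('a)" if "orthonormal_set B" for B
    using independent_bound[OF orthonormal_set_independent[OF that]] .
  have "?P 0" by (auto simp: orthonormal_set_def)
  moreover have "\<forall>j. ?P j \<longrightarrow> j \<le> DIM('a)" using bound by blast
  ultimately have "\<exists>k. ?P k \<and> (\<forall>j. ?P j \<longrightarrow> j \<le> k)"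
    by (rule Nat.ex_has_greatest_nat[of ?P 0])
  then obtain k where k: "?P k" "\<And>j. ?P j \<Longrightarrow> j \<le> k" by blast
  then obtain B where B: "orthonormal_set B" "finite B" "card B = k" by blast
  have "span B = UNIV"
  proof (rule ccontr)
    assume "span B \<noteq> UNIV"
    then obtain x where x: "x \<notin> span B" by blast
    define y where "y = x - (\<Sum>b\<in>B. q x b *\<^sub>R b)"
    have "y \<noteq> 0"
      using x span_sum[of B "\<lambda>b. q x b *\<^sub>R b" B] by (auto simp: y_def span_base span_scale)
    then have y: "q y y > 0" by (rule pos)
    have yb: "q y b = 0" if "b \<in> B" for b
    proof -
      have "(\<Sum>c\<in>B. q x c * q c b) = (\<Sum>c\<in>B. q x c * (if c = b then 1 else 0))"
        using B(1) that by (intro sum.cong) (auto simp: orthonormal_set_def)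
      also have "\<dots> = q x b" using B(2) that by (simp add: if_distrib sum.delta cong: if_cong)
      finally show ?thesis by (simp add: y_def form_simps)
    qed
    define z where "z = (1 / sqrt (q y y)) *\<^sub>R y"
    have zb: "q z b = 0" "q b z = 0" if "b \<in> B" for b
      using yb[OF that] sym[of b y] by (simp_all add: z_def form_simps)
    have zz: "q z z = 1" using y by (simp add: z_def form_simps field_simps)
    have "z \<notin> B" using zb zz by fastforce
    moreover have "orthonormal_set (insert z B)"
      using B(1) zb zz by (auto simp: orthonormal_set_def)
    ultimately have "?P (Suc k)" using B by (metis card_insert_disjoint finite_insert)
    then show False using k(2) by fastforce
  qed
  moreover have "card B = DIM('a)"
    using basis_card_eq_dim[of B UNIV] orthonormal_set_independent[OF B(1)] \<open>span B = UNIV\<close> by simp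
  ultimately show ?thesis using B by blast
qed

lemma onb_exists:
  "\<exists>e::'a \<Rightarrow> 'a. (\<forall>b\<in>Basis. \<forall>c\<in>Basis. q (e b) (e c) = (if b = c then 1 else 0)) \<and>
     span (e ` Basis) = UNIV"
proof -
  obtain B where B: "orthonormal_set B" "finite B" "card B = DIM('a)" "span B = UNIV"
    using orthonormal_set_exists by blast
  obtain e where e: "bij_betw e (Basis :: 'a set) B"
    using finite_same_card_bij[OF finite_Basis B(2)] B(3) by auto
  have "q (e b) (e c) = (if b = c then 1 else 0)" if "b \<in> Basis" "c \<in> Basis" for b c
    using B(1) e that by (auto simp: orthonormal_set_def bij_betw_def inj_on_def)
  moreover have "e ` Basis = B" using e by (simp add: bij_betw_def)
  ultimately show ?thesis using B(4) by (intro exI[of _ e]) auto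
qed

definition onb :: "'a \<Rightarrow> 'a" where
  "onb = (SOME e. (\<forall>b\<in>Basis. \<forall>c\<in>Basis. q (e b) (e c) = (if b = c then 1 else 0)) \<and>
     span (e ` Basis) = UNIV)"

lemma onb_orthonormal: "b \<in> Basis \<Longrightarrow> c \<in> Basis \<Longrightarrow> q (onb b) (onb c) = (if b = c then 1 else 0)"
  and onb_span: "span (onb ` Basis) = UNIV"
  using someI_ex[OF onb_exists] unfolding onb_def by auto

lemma onb_expansion: "(\<Sum>b\<in>Basis. q v (onb b) *\<^sub>R onb b) = v"
proof -
  have "v \<in> span (onb ` Basis)" by (simp add: onb_span)
  then show ?thesis
  proof (induction rule: span_induct_alt)
    case (step c x y)
    then obtain a where a: "a \<in> Basis" "x = onb a" by blast
    have "(\<Sum>b\<in>Basis. q x (onb b) *\<^sub>R onb b) = (\<Sum>b\<in>Basis. if a = b then onb b else 0)"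
      using a by (intro sum.cong) (auto simp: onb_orthonormal)
    then have "(\<Sum>b\<in>Basis. q x (onb b) *\<^sub>R onb b) = x" using a by (simp add: sum.delta')
    then show ?case using step
      by (simp add: form_simps scaleR_add_left sum.distrib flip: scaleR_scaleR scaleR_sum_right)
  qed (simp add: form_simps)
qed

lemma parseval: "(\<Sum>b\<in>Basis. q u (onb b) * q v (onb b)) = q u v"
proof -
  have "q u v = q (\<Sum>b\<in>Basis. q u (onb b) *\<^sub>R onb b) v" by (simp only: onb_expansion)
  also have "\<dots> = (\<Sum>b\<in>Basis. q u (onb b) * q v (onb b))"
    by (simp add: form_simps sym[of v])
  finally show ?thesis by simp
qed

lemma linear_onb_expansion:
  assumes "linear f" shows "(\<Sum>b\<in>Basis. q v (onb b) *\<^sub>R f (onb b)) = f v"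
proof -
  have "f v = f (\<Sum>b\<in>Basis. q v (onb b) *\<^sub>R onb b)" by (simp only: onb_expansion)
  then show ?thesis by (simp add: linear_sum[OF assms] linear_cmul[OF assms])
qed

lemma riesz:
  assumes "linear f" shows "\<exists>!z. \<forall>w. q z w = f w"
proof -
  have "q (\<Sum>b\<in>Basis. f (onb b) *\<^sub>R onb b) w = f w" for w
    using linear_onb_expansion[OF assms, of w] by (simp add: form_simps sym[of _ w] mult.commute)
  then show ?thesis using form_eqI by metis
qed

text \<open>If \<open>L\<close> takes the standard basis to the orthonormal basis, then the trace of \<open>T\<close> is that of
  \<open>L\<inverse> T L\<close>.\<close>

lemma endo_trace_onb:
  assumes "linear T" shows "endo_trace T = (\<Sum>b\<in>Basis. q (T (onb b)) (onb b))"
proof -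
  let ?L = "\<lambda>u. \<Sum>b\<in>Basis. (u \<bullet> b) *\<^sub>R onb b" and ?M = "\<lambda>v. \<Sum>b\<in>Basis. q v (onb b) *\<^sub>R b"
  have L: "linear ?L"
    by (auto intro!: linearI simp: inner_add_left scaleR_add_left sum.distrib scaleR_sum_right)
  have M: "linear ?M"
    by (auto intro!: linearI simp: form_simps scaleR_add_left sum.distrib scaleR_sum_right)
  have LM: "?L (?M v) = v" for v
  proof -
    have "?M v \<bullet> b = q v (onb b)" if "b \<in> Basis" for b using that by simp
    then show ?thesis using onb_expansion[of v] by simp
  qed
  have Lb: "?L b = onb b" if "b \<in> Basis" for b
    using that by (simp add: inner_Basis if_distrib[of "\<lambda>x. x *\<^sub>R _"] sum.delta' cong: if_cong)
  have "T = ?L \<circ> (?M \<circ> T)" using LM by (simp add: fun_eq_iff)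
  then have "endo_trace T = endo_trace ((?M \<circ> T) \<circ> ?L)"
    using endo_trace_commute[OF L linear_compose[OF assms M]] by metis
  also have "\<dots> = (\<Sum>b\<in>Basis. q (T (onb b)) (onb b))"
    unfolding endo_trace_def by (intro sum.cong) (simp_all add: Lb)
  finally show ?thesis .
qed

text \<open>The images \<open>J e\<^sub>b\<close> form another orthonormal basis, and contractions of bilinear forms do not
  depend on the orthonormal basis.\<close>

lemma sum_onb_isometry:
  assumes \<beta>: "bilinear \<beta>" and J: "linear J" "\<And>u v. q (J u) (J v) = q u v" "\<And>u. J (J u) = - u"
  shows "(\<Sum>b\<in>Basis. \<beta> (J (onb b)) (J (onb b))) = (\<Sum>b\<in>Basis. \<beta> (onb b) (onb b) :: real)"
proof -
  have skew: "q (J u) v = - q u (J v)" for u v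
    using J(2)[of u "J v"] by (simp add: J(3) form_simps)
  have "(\<Sum>b\<in>Basis. \<beta> (J (onb b)) (J (onb b))) =
     (\<Sum>b\<in>Basis. \<Sum>c\<in>Basis. \<Sum>d\<in>Basis. q (J (onb b)) (onb c) * q (J (onb b)) (onb d) * \<beta> (onb c) (onb d))"
  proof (rule sum.cong[OF refl])
    fix b :: 'a assume "b \<in> Basis"
    have "\<beta> (J (onb b)) (J (onb b)) = \<beta> (\<Sum>c\<in>Basis. q (J (onb b)) (onb c) *\<^sub>R onb c)
       (\<Sum>c\<in>Basis. q (J (onb b)) (onb c) *\<^sub>R onb c)" by (simp only: onb_expansion)
    also have "\<dots> = (\<Sum>c\<in>Basis. \<Sum>d\<in>Basis. q (J (onb b)) (onb c) * q (J (onb b)) (onb d) * \<beta> (onb c) (onb d))"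
      by (simp add: bilinear_sum_left[OF \<beta>] bilinear_sum_right[OF \<beta>] bilinear_lmul[OF \<beta>]
          bilinear_rmul[OF \<beta>] sum_distrib_left) (subst sum.swap, simp add: mult_ac)
    finally show "\<beta> (J (onb b)) (J (onb b)) = \<dots>" .
  qed
  also have "\<dots> = (\<Sum>c\<in>Basis. \<Sum>d\<in>Basis. \<Sum>b\<in>Basis. q (J (onb b)) (onb c) * q (J (onb b)) (onb d) * \<beta> (onb c) (onb d))"
    by (subst sum.swap) (rule sum.cong[OF refl], rule sum.swap)
  also have "\<dots> = (\<Sum>c\<in>Basis. \<Sum>d\<in>Basis. q (onb c) (onb d) * \<beta> (onb c) (onb d))"
  proof (intro sum.cong refl)
    fix c d :: 'a
    have "(\<Sum>b\<in>Basis. q (J (onb b)) (onb c) * q (J (onb b)) (onb d)) =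
        (\<Sum>b\<in>Basis. q (J (onb c)) (onb b) * q (J (onb d)) (onb b))"
    proof (rule sum.cong[OF refl])
      fix b
      have "q (J (onb b)) w = - q (J w) (onb b)" for w
        using skew[of "onb b" w] sym[of "onb b" "J w"] by simp
      then show "q (J (onb b)) (onb c) * q (J (onb b)) (onb d) =
          q (J (onb c)) (onb b) * q (J (onb d)) (onb b)" by simp
    qed
    then have "(\<Sum>b\<in>Basis. q (J (onb b)) (onb c) * q (J (onb b)) (onb d)) = q (J (onb c)) (J (onb d))"
      by (simp only: parseval)
    then show "(\<Sum>b\<in>Basis. q (J (onb b)) (onb c) * q (J (onb b)) (onb d) * \<beta> (onb c) (onb d)) =
        q (onb c) (onb d) * \<beta> (onb c) (onb d)"
      by (simp add: J(2) flip: sum_distrib_right)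
  qed
  also have "\<dots> = (\<Sum>c\<in>Basis. \<Sum>d\<in>Basis. if c = d then \<beta> (onb c) (onb d) else 0)"
    by (intro sum.cong refl) (simp add: onb_orthonormal)
  also have "\<dots> = (\<Sum>b\<in>Basis. \<beta> (onb b) (onb b))"
    by (simp add: sum.delta' cong: sum.cong)
  finally show ?thesis .
qed

end

section \<open>Frames and oriented 3-planes\<close>

definition frame_comb :: "real^3 \<Rightarrow> 'h::real_vector^3 \<Rightarrow> 'h" where
  "frame_comb a v = (\<Sum>i\<in>UNIV. a $ i *\<^sub>R v $ i)"

definition frame_act :: "real^3^3 \<Rightarrow> 'h::real_vector^3 \<Rightarrow> 'h^3" where
  "frame_act a v = (\<chi> i. frame_comb (a $ i) v)"

lemma frame_act_nth [simp]: "frame_act a v $ i = frame_comb (a $ i) v"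
  by (simp add: frame_act_def)

lemma frame_comb_axis [simp]: "frame_comb (axis i 1) v = v $ i"
proof -
  have "frame_comb (axis i 1) v = (\<Sum>j\<in>UNIV. if i = j then v $ j else 0)"
    unfolding frame_comb_def by (intro sum.cong) (auto simp: axis_def)
  then show ?thesis by (simp add: sum.delta')
qed

lemma frame_comb_add: "frame_comb (a + b) v = frame_comb a v + frame_comb b v"
  by (simp add: frame_comb_def scaleR_add_left sum.distrib)

lemma frame_comb_diff: "frame_comb (a - b) v = frame_comb a v - frame_comb b v"
  by (simp add: frame_comb_def scaleR_diff_left sum_subtractf)

lemma frame_comb_scaleR: "frame_comb (c *\<^sub>R a) v = c *\<^sub>R frame_comb a v"
  by (simp add: frame_comb_def scaleR_sum_right)

lemma frame_comb_zero [simp]: "frame_comb 0 v = 0"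
  by (simp add: frame_comb_def)

lemma frame_comb_linear: "linear X \<Longrightarrow> X (frame_comb a v) = (\<Sum>i\<in>UNIV. a $ i *\<^sub>R X (v $ i))"
  by (simp add: frame_comb_def linear_sum linear_cmul)

lemma frame3_iff: "frame3 v \<longleftrightarrow> (\<forall>a. frame_comb a v = 0 \<longrightarrow> a = 0)"
  by (simp add: frame3_def frame_comb_def)

lemma span_frame: "span (range (($) v)) = range (\<lambda>a. frame_comb a v)"
proof
  have "subspace (range (\<lambda>a. frame_comb a v))"
    unfolding subspace_def
    by (auto simp flip: frame_comb_add frame_comb_scaleR intro: range_eqI[of _ _ 0])
  moreover have "range (($) v) \<subseteq> range (\<lambda>a. frame_comb a v)"
    using frame_comb_axis[of _ v] by (metis image_subsetI rangeI)
  ultimately show "span (range (($) v)) \<subseteq> range (\<lambda>a. frame_comb a v)"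
    by (rule span_minimal[rotated])
  show "range (\<lambda>a. frame_comb a v) \<subseteq> span (range (($) v))"
    unfolding frame_comb_def by (auto intro!: span_sum span_scale) (simp add: span_base)
qed

lemma frame_comb_act: "frame_comb c (frame_act a v) = frame_comb (c v* a) v"
proof -
  have "frame_comb c (frame_act a v) = (\<Sum>i\<in>UNIV. \<Sum>j\<in>UNIV. (c $ i * a $ i $ j) *\<^sub>R v $ j)"
    by (simp add: frame_comb_def[of c] scaleR_sum_right frame_comb_def[of "a $ _"])
  also have "\<dots> = (\<Sum>j\<in>UNIV. (\<Sum>i\<in>UNIV. c $ i * a $ i $ j) *\<^sub>R v $ j)"
    by (subst sum.swap) (simp add: scaleR_sum_left)
  finally show ?thesis by (simp add: frame_comb_def vector_matrix_mult_def mult.commute)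
qed

lemma frame_act_mult: "frame_act (a ** b) v = frame_act a (frame_act b v)"
proof -
  have "(a ** b) $ i = (a $ i) v* b" for i
    by (simp add: matrix_matrix_mult_def vector_matrix_mult_def vec_eq_iff mult.commute)
  then show ?thesis by (subst vec_eq_iff) (simp add: frame_comb_act)
qed

lemma frame_act_mat_1 [simp]: "frame_act (mat 1) v = v"
proof -
  have "mat 1 $ i = (axis i 1 :: real^3)" for i :: 3
    by (simp add: mat_def axis_def vec_eq_iff)
  then show ?thesis by (subst vec_eq_iff) simp
qed

lemma ospan_eq: "ospan v = {frame_act a v |a. det a > 0}"
  by (auto simp: ospan_def frame_comb_def vec_eq_iff)

lemma ospan_self: "v \<in> ospan v"
  unfolding ospan_eq by (rule CollectI, rule exI[of _ "mat 1"]) simp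

lemma matrix_inverse_det_pos:
  fixes a :: "real^3^3"
  assumes "det a > 0" obtains b where "det b > 0" "b ** a = mat 1" "a ** b = mat 1"
proof -
  obtain b where b: "a ** b = mat 1" "b ** a = mat 1"
    using assms invertible_det_nz[of a] unfolding invertible_def by auto
  have "det b * det a = 1" using b(2) det_mul[of b a] by simp
  then have "det b > 0" using assms by (metis zero_less_mult_pos2 zero_less_one)
  then show ?thesis using b that by blast
qed

lemma ospan_subset: "w \<in> ospan v \<Longrightarrow> ospan w \<subseteq> ospan v"
  unfolding ospan_eq
proof clarsimp
  fix a b :: "real^3^3" assume "0 < det a" "0 < det b"
  then show "\<exists>c. frame_act b (frame_act a v) = frame_act c v \<and> 0 < det c"
    by (intro exI[of _ "b ** a"]) (simp add: frame_act_mult det_mul)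
qed

lemma ospan_sym: "w \<in> ospan v \<Longrightarrow> v \<in> ospan w"
proof -
  assume "w \<in> ospan v"
  then obtain a where a: "det a > 0" "w = frame_act a v" by (auto simp: ospan_eq)
  then obtain b where "det b > 0" "b ** a = mat 1" using matrix_inverse_det_pos by metis
  then have "v = frame_act b w" by (simp add: a(2) flip: frame_act_mult)
  then show ?thesis using \<open>det b > 0\<close> by (auto simp: ospan_eq)
qed

lemma ospan_cong: "w \<in> ospan v \<Longrightarrow> ospan w = ospan v"
  using ospan_subset ospan_sym by blast

lemma frame3_ospan:
  assumes "frame3 v" "w \<in> ospan v" shows "frame3 w"
  unfolding frame3_iff
proof (intro allI impI)
  fix c :: "real^3"
  obtain a where a: "det a > 0" "w = frame_act a v" using assms(2) by (auto simp: ospan_eq)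
  obtain b where b: "a ** b = mat 1" using matrix_inverse_det_pos[OF a(1)] by metis
  assume "frame_comb c w = 0"
  then have "c v* a = 0" using assms(1) by (simp add: a(2) frame_comb_act frame3_iff)
  then have "c v* (a ** b) = 0" by (metis vector_matrix_mul_assoc vector_matrix_mult_0)
  then show "c = 0" by (simp add: b)
qed

lemma taut_ospan: "taut (ospan v) = range (\<lambda>a. frame_comb a v)"
proof
  show "taut (ospan v) \<subseteq> range (\<lambda>a. frame_comb a v)"
    by (auto simp: taut_def span_frame ospan_eq frame_comb_act)
  show "range (\<lambda>a. frame_comb a v) \<subseteq> taut (ospan v)"
    using ospan_self[of v] by (auto simp: taut_def span_frame)
qed

lemma taut_ospan_span: "taut (ospan v) = span (range (($) v))"
  by (simp add: taut_ospan span_frame)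

lemma Gr3_cases:
  assumes "P \<in> Gr3" obtains v where "frame3 v" "P = ospan v"
  using assms by (auto simp: Gr3_def)

lemma Gr3_ospan: "P \<in> Gr3 \<Longrightarrow> v \<in> P \<Longrightarrow> frame3 v \<and> P = ospan v"
  by (metis Gr3_cases frame3_ospan ospan_cong)

lemma ospan_Gr3: "frame3 v \<Longrightarrow> ospan v \<in> Gr3"
  by (simp add: Gr3_def)

lemma subspace_taut: "P \<in> Gr3 \<Longrightarrow> subspace (taut P)"
  by (metis Gr3_cases taut_ospan_span subspace_span)

lemma nth_in_taut: "v $ i \<in> taut (ospan v)"
  by (simp add: taut_ospan_span span_base)

text \<open>Linear maps commute with the action of matrices on frames, so the graph of \<open>X\<close> over an oriented
  plane may be computed from a single frame.\<close>

lemma graph_plane_ospan: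
  assumes "linear X"
  shows "graph_plane (ospan v) X = ospan (\<chi> i. v $ i + X (v $ i))"
proof -
  have "(\<chi> i. frame_act a v $ i + X (frame_act a v $ i)) = frame_act a (\<chi> i. v $ i + X (v $ i))" for a
    by (simp add: vec_eq_iff frame_comb_linear[OF assms])
      (simp add: frame_comb_def scaleR_add_right sum.distrib)
  then show ?thesis
    unfolding graph_plane_def ospan_eq by (auto simp: image_def)
qed

text \<open>A matrix of determinant 1 may have any prescribed nonzero first row.\<close>

lemma first_vector_of_frame:
  assumes "x \<in> taut (ospan v)" "x \<noteq> 0"
  obtains w where "w \<in> ospan v" "w $ 1 = x"
proof -
  obtain c where c: "x = frame_comb c v" using assms(1) by (auto simp: taut_ospan)
  have "c \<noteq> 0" using c assms(2) by auto
  then have "c $ 1 \<noteq> 0 \<or> c $ 2 \<noteq> 0 \<or> c $ 3 \<noteq> 0"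
    by (auto simp: vec_eq_iff forall_3)
  then have "\<exists>r s. det (vector [c, r, s] :: real^3^3) > 0"
  proof (elim disjE)
    assume "c $ 1 \<noteq> 0"
    then show ?thesis
      by (intro exI[of _ "vector [0, 1, 0]"] exI[of _ "vector [0, 0, 1 / c $ 1]"]) (simp add: det_3)
  next
    assume "c $ 2 \<noteq> 0"
    then show ?thesis
      by (intro exI[of _ "vector [0, 0, 1]"] exI[of _ "vector [1 / c $ 2, 0, 0]"]) (simp add: det_3)
  next
    assume "c $ 3 \<noteq> 0"
    then show ?thesis
      by (intro exI[of _ "vector [1 / c $ 3, 0, 0]"] exI[of _ "vector [0, 1, 0]"]) (simp add: det_3)
  qed
  then obtain r s where "det (vector [c, r, s] :: real^3^3) > 0" by blast
  then show ?thesis using that[of "frame_act (vector [c, r, s]) v"] c by (auto simp: ospan_eq)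
qed

text \<open>Used to test linearity of functions that are linear on each 3-plane.\<close>

lemma frame_through_pair:
  fixes x y :: "'h::euclidean_space"
  assumes "DIM('h) \<ge> 3"
  obtains v where "frame3 v" "x \<in> taut (ospan v)" "y \<in> taut (ospan v)"
proof -
  obtain B0 where B0: "B0 \<subseteq> {x, y}" "independent B0" "{x, y} \<subseteq> span B0"
    using maximal_independent_subset[of "{x, y}"] by metis
  obtain B where B: "B0 \<subseteq> B" "independent B" "UNIV \<subseteq> span B"
    using maximal_independent_subset_extend[of B0 UNIV] B0(2) by auto
  have "finite B" "card B = DIM('h)"
    using B independent_bound basis_card_eq_dim[of B UNIV] by auto
  moreover have "card B0 \<le> 3"
  proof -
    have "card B0 \<le> card {x, y}" using card_mono[OF _ B0(1)] by blast
    also have "\<dots> \<le> 3" by (simp add: card_insert_if)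
    finally show ?thesis .
  qed
  ultimately obtain C where C: "B0 \<subseteq> C" "C \<subseteq> B" "card C = 3"
    using exists_subset_between[of B0 3 B] assms B(1) by auto
  have "finite C" using C(2) \<open>finite B\<close> finite_subset by blast
  have "independent C" using C(2) B(2) independent_mono by blast
  obtain e where e: "bij_betw e (UNIV :: 3 set) C"
    using finite_same_card_bij[of "UNIV :: 3 set" C] \<open>finite C\<close> C(3) by auto
  define v where "v = (\<chi> i. e i)"
  have rng: "range (($) v) = C" using e by (simp add: v_def bij_betw_def image_def)
  have "frame3 v"
    unfolding frame3_iff
  proof (intro allI impI)
    fix a assume a: "frame_comb a v = 0"
    let ?c = "\<lambda>z. a $ (inv_into UNIV e z)"
    have inj: "inj e" using e by (simp add: bij_betw_def)
    have "(\<Sum>z\<in>C. ?c z *\<^sub>R z) = (\<Sum>i\<in>UNIV. ?c (e i) *\<^sub>R e i)"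
      using sum.reindex_bij_betw[OF e, of "\<lambda>z. ?c z *\<^sub>R z"] by simp
    also have "\<dots> = 0" using a inj by (simp add: frame_comb_def v_def)
    finally have "?c z = 0" if "z \<in> C" for z
      using independentD[OF \<open>independent C\<close> \<open>finite C\<close> subset_refl, of ?c] that by simp
    then have "a $ i = 0" for i
      using bij_betwE[OF e] inj by (metis inv_f_f UNIV_I)
    then show "a = 0" by (simp add: vec_eq_iff)
  qed
  moreover have "{x, y} \<subseteq> span C" using B0(3) span_mono[OF C(1)] by blast
  ultimately show ?thesis using that by (simp add: taut_ospan_span rng)
qed

section \<open>The projected constant sections\<close>

context inner_form
begin

lemma bounded_bilinear_form: "bounded_bilinear q"
  using bil bilinear_conv_bounded_bilinear by blast

lemmas smooth_on_form = smooth_on_bilinear[OF bounded_bilinear_form]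

definition gram :: "'a^3 \<Rightarrow> real^3^3" where
  "gram v = (\<chi> i j. q (v $ i) (v $ j))"

lemma gram_mult: "(gram v *v c) $ i = q (v $ i) (frame_comb c v)"
  by (simp add: gram_def matrix_vector_mult_def frame_comb_def form_simps mult.commute)

text \<open>Since the inner product is definite, a linear relation between the vectors is the same as an
  element of the kernel of the Gram matrix.\<close>

lemma frame3_gram: "frame3 v \<longleftrightarrow> det (gram v) \<noteq> 0"
proof -
  have "gram v *v c = 0 \<longleftrightarrow> frame_comb c v = 0" for c
  proof
    assume "gram v *v c = 0"
    then have "q (v $ i) (frame_comb c v) = 0" for i using gram_mult[of v c i] by simp
    then have "q (frame_comb c v) (frame_comb c v) = 0"
      by (simp add: frame_comb_def[of c] form_simps(11) form_simps(3))
    then show "frame_comb c v = 0" by (simp add: eq_0_iff)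
  qed (simp add: vec_eq_iff gram_mult form_simps)
  then have "frame3 v \<longleftrightarrow> (\<forall>c. gram v *v c = 0 \<longrightarrow> c = 0)" by (simp add: frame3_iff)
  also have "\<dots> \<longleftrightarrow> invertible (gram v)"
    by (simp add: invertible_left_inverse matrix_left_invertible_ker)
  finally show ?thesis by (simp add: invertible_det_nz)
qed

lemma open_frames: "open {v :: 'a^3. frame3 v}"
proof -
  have "continuous_on UNIV (\<lambda>v. det (gram v))"
    unfolding det_3 gram_def
    by (simp, intro continuous_intros bounded_bilinear.continuous_on[OF bounded_bilinear_form])
  then have "open {v. det (gram v) \<noteq> 0}" by (intro open_Collect_neq) auto
  then show ?thesis by (simp add: frame3_gram)
qed

lemma dual_vector:
  assumes "frame3 v"
  obtains u where "u \<in> taut (ospan v)" "q u (v $ i) = 1" "\<And>j. j \<noteq> i \<Longrightarrow> q u (v $ j) = 0"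
proof -
  obtain b where b: "gram v ** b = mat 1"
    using assms frame3_gram invertible_det_nz[of "gram v"] by (auto simp: invertible_def)
  define c where "c = b *v axis i 1"
  have "gram v *v c = axis i 1" by (simp add: c_def matrix_vector_mul_assoc b)
  then have "q (frame_comb c v) (v $ j) = axis i 1 $ j" for j
    using gram_mult[of v c j] by (simp add: sym)
  then show ?thesis using that[of "frame_comb c v"] by (simp add: taut_ospan axis_def)
qed

lemma proj_tautI:
  assumes P: "P \<in> Gr3" and u: "u \<in> taut P" "\<And>z. z \<in> taut P \<Longrightarrow> q (A - u) z = 0"
  shows "proj_taut q P A = u"
  unfolding proj_taut_def
proof (rule the_equality)
  show "u \<in> taut P \<and> A - u \<in> perp q P" using u by (simp add: perp_def)
  fix u' assume u': "u' \<in> taut P \<and> A - u' \<in> perp q P"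
  have d: "u' - u \<in> taut P" using u' u(1) subspace_diff[OF subspace_taut[OF P]] by blast
  have "q (u' - u) (u' - u) = q (A - u) (u' - u) - q (A - u') (u' - u)"
    by (simp add: form_simps)
  also have "\<dots> = 0" using u(2)[OF d] u' d by (simp add: perp_def)
  finally show "u' = u" by (simp add: eq_0_iff)
qed

text \<open>Gram-Schmidt orthogonalization without normalization.  It is a rational expression in the inner
  products of the frame, so it shows that the projection to the plane is smooth in the frame.\<close>

definition gs1 :: "'a^3 \<Rightarrow> 'a" where "gs1 v = v $ 1"
definition gs2 :: "'a^3 \<Rightarrow> 'a" where
  "gs2 v = v $ 2 - (q (v $ 2) (gs1 v) / q (gs1 v) (gs1 v)) *\<^sub>R gs1 v"
definition gs3 :: "'a^3 \<Rightarrow> 'a" where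
  "gs3 v = v $ 3 - (q (v $ 3) (gs1 v) / q (gs1 v) (gs1 v)) *\<^sub>R gs1 v
     - (q (v $ 3) (gs2 v) / q (gs2 v) (gs2 v)) *\<^sub>R gs2 v"

definition gs_proj :: "'a^3 \<Rightarrow> 'a \<Rightarrow> 'a" where
  "gs_proj v A = (q A (gs1 v) / q (gs1 v) (gs1 v)) *\<^sub>R gs1 v +
     (q A (gs2 v) / q (gs2 v) (gs2 v)) *\<^sub>R gs2 v + (q A (gs3 v) / q (gs3 v) (gs3 v)) *\<^sub>R gs3 v"

lemma frame_comb_3: "frame_comb (vector [a, b, c]) v = a *\<^sub>R v $ 1 + b *\<^sub>R v $ 2 + c *\<^sub>R v $ 3"
  by (simp add: frame_comb_def sum_3)

lemma gs_lower_triangular: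
  obtains a b c where "gs2 v = a *\<^sub>R v $ 1 + v $ 2" "gs3 v = b *\<^sub>R v $ 1 + c *\<^sub>R v $ 2 + v $ 3"
proof -
  obtain a where a: "gs2 v = a *\<^sub>R v $ 1 + v $ 2"
    unfolding gs2_def gs1_def by (metis add.commute diff_conv_add_uminus scaleR_minus_left)
  let ?x = "q (v $ 3) (gs1 v) / q (gs1 v) (gs1 v)" and ?y = "q (v $ 3) (gs2 v) / q (gs2 v) (gs2 v)"
  have "gs3 v = (- ?x - ?y * a) *\<^sub>R v $ 1 + (- ?y) *\<^sub>R v $ 2 + v $ 3"
    unfolding gs3_def gs1_def a by (simp add: algebra_simps)
  with a show ?thesis using that by blast
qed

lemma gs_nonzero:
  assumes "frame3 v"
  shows "q (gs1 v) (gs1 v) > 0" "q (gs2 v) (gs2 v) > 0" "q (gs3 v) (gs3 v) > 0"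
proof -
  obtain a b c where abc: "gs2 v = a *\<^sub>R v $ 1 + v $ 2" "gs3 v = b *\<^sub>R v $ 1 + c *\<^sub>R v $ 2 + v $ 3"
    using gs_lower_triangular .
  have nz: "frame_comb (vector [x, y, z]) v \<noteq> 0" if "x \<noteq> 0 \<or> y \<noteq> 0 \<or> z \<noteq> 0" for x y z
    using assms that unfolding frame3_iff by (auto simp: vec_eq_iff forall_3)
  show "q (gs1 v) (gs1 v) > 0" "q (gs2 v) (gs2 v) > 0" "q (gs3 v) (gs3 v) > 0"
    using nz[of 1 0 0] nz[of a 1 0] nz[of b c 1] abc pos by (auto simp: frame_comb_3 gs1_def)
qed

lemma gs_orthogonal:
  assumes "frame3 v"
  shows "q (gs2 v) (gs1 v) = 0" "q (gs3 v) (gs1 v) = 0" "q (gs3 v) (gs2 v) = 0"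
proof -
  note nz = gs_nonzero[OF assms]
  show 21: "q (gs2 v) (gs1 v) = 0" using nz(1) by (simp add: gs2_def form_simps)
  then show "q (gs3 v) (gs1 v) = 0" "q (gs3 v) (gs2 v) = 0"
    using nz sym[of "gs1 v" "gs2 v"] by (simp_all add: gs3_def[of v] form_simps)
qed

lemma gs_proj_eq:
  assumes v: "frame3 v" shows "proj_taut q (ospan v) A = gs_proj v A"
proof (rule proj_tautI[OF ospan_Gr3[OF v]])
  obtain a b c where abc: "gs2 v = a *\<^sub>R v $ 1 + v $ 2" "gs3 v = b *\<^sub>R v $ 1 + c *\<^sub>R v $ 2 + v $ 3"
    using gs_lower_triangular .
  note sub = subspace_taut[OF ospan_Gr3[OF v]]
  have t: "gs1 v \<in> taut (ospan v)" "gs2 v \<in> taut (ospan v)" "gs3 v \<in> taut (ospan v)"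
    unfolding abc gs1_def by (intro subspace_add[OF sub] subspace_scale[OF sub] nth_in_taut)+
  then show "gs_proj v A \<in> taut (ospan v)"
    unfolding gs_proj_def by (intro subspace_add[OF sub] subspace_scale[OF sub])
  note nz = gs_nonzero[OF v] and orth = gs_orthogonal[OF v]
  have orth': "q (gs1 v) (gs2 v) = 0" "q (gs1 v) (gs3 v) = 0" "q (gs2 v) (gs3 v) = 0"
    using orth sym by metis+
  have g: "q (A - gs_proj v A) (gs1 v) = 0" "q (A - gs_proj v A) (gs2 v) = 0"
    "q (A - gs_proj v A) (gs3 v) = 0"
    using nz by (simp_all add: gs_proj_def form_simps orth orth')
  have "v $ 1 = gs1 v" "v $ 2 = gs2 v - a *\<^sub>R gs1 v"
    "v $ 3 = gs3 v - c *\<^sub>R (gs2 v - a *\<^sub>R gs1 v) - b *\<^sub>R gs1 v"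
    using abc by (simp_all add: gs1_def)
  then have "q (A - gs_proj v A) (v $ i) = 0" for i
    using g exhaust_3[of i] by (auto simp: form_simps(9,10,4,2,6))
  then show "q (A - gs_proj v A) z = 0" if "z \<in> taut (ospan v)" for z
    using that unfolding taut_ospan by (auto simp: frame_comb_def form_simps(12) form_simps(4))
qed

lemma proj_taut_in: "P \<in> Gr3 \<Longrightarrow> proj_taut q P A \<in> taut P"
  and proj_taut_form: "P \<in> Gr3 \<Longrightarrow> z \<in> taut P \<Longrightarrow> q (proj_taut q P A) z = q A z"
proof -
  have *: "proj_taut q P A \<in> taut P \<and> (\<forall>z\<in>taut P. q (A - proj_taut q P A) z = 0)" if P: "P \<in> Gr3"
  proof -
    obtain v where v: "frame3 v" "P = ospan v" using P Gr3_cases by blast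
    have "\<exists>u. u \<in> taut P \<and> A - u \<in> perp q P"
    proof -
      obtain a where a: "gram v *v a = (\<chi> i. q (v $ i) A)"
        using v(1) frame3_gram invertible_det_nz[of "gram v"]
        by (metis invertible_def matrix_vector_mul_assoc matrix_vector_mul_lid)
      have "q (v $ i) (frame_comb a v) = q (v $ i) A" for i
        using gram_mult[of v a i] by (simp add: a)
      then have "q (A - frame_comb a v) (v $ i) = 0" for i
        by (metis (no_types) eq_iff_diff_eq_0 form_simps(10) sym)
      then have "A - frame_comb a v \<in> perp q P"
        unfolding perp_def v(2) taut_ospan by (auto simp: frame_comb_def form_simps(12) form_simps(4))
      then show ?thesis using v(2) by (auto simp: taut_ospan)
    qed
    then obtain u where u: "u \<in> taut P" "A - u \<in> perp q P" by blast
    then have "proj_taut q P A = u" by (intro proj_tautI[OF P]) (auto simp: perp_def)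
    with u show ?thesis by (simp add: perp_def)
  qed
  show "P \<in> Gr3 \<Longrightarrow> proj_taut q P A \<in> taut P" using * by blast
  show "P \<in> Gr3 \<Longrightarrow> z \<in> taut P \<Longrightarrow> q (proj_taut q P A) z = q A z"
    using * by (metis eq_iff_diff_eq_0 form_simps(9))
qed

lemma smooth_proj_taut: "smooth_on {v. frame3 v} (\<lambda>v. proj_taut q (ospan v) A)"
proof -
  let ?S = "{v :: 'a^3. frame3 v}"
  note op = open_frames
  have nth: "smooth_on ?S (\<lambda>v. v $ i)" for i
    using smooth_on_bounded_linear[OF bounded_linear_vec_nth op smooth_on_ident[OF op]] .
  note intros = smooth_on_add smooth_on_diff smooth_on_scaleR smooth_on_divide smooth_on_form op nth
  have 1: "smooth_on ?S gs1" unfolding gs1_def by (rule nth)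
  have 2: "smooth_on ?S gs2"
    unfolding gs2_def by (intro intros 1) (use gs_nonzero in \<open>fastforce\<close>)
  have 3: "smooth_on ?S gs3"
    unfolding gs3_def by (intro intros 1 2) (use gs_nonzero in \<open>fastforce\<close>)+
  have "smooth_on ?S (\<lambda>v. gs_proj v A)"
    unfolding gs_proj_def
    by (intro intros 1 2 3 smooth_on_const) (use gs_nonzero in \<open>fastforce\<close>)+
  then show ?thesis by (subst smooth_on_cong[OF op]) (auto simp: gs_proj_eq)
qed

lemma taut_section_const_proj: "taut_section (const_proj q A)"
proof -
  have "smooth_on {v. frame3 v} (\<lambda>v. const_proj q A (ospan v))"
    by (subst smooth_on_cong[OF open_frames, of _ "\<lambda>v. proj_taut q (ospan v) A"])
      (auto simp: const_proj_def ospan_Gr3 smooth_proj_taut)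
  then show ?thesis by (auto simp: taut_section_def const_proj_def proj_taut_in)
qed

lemma const_proj_linear: "const_proj q (a *\<^sub>R A + b *\<^sub>R B) P = a *\<^sub>R const_proj q A P + b *\<^sub>R const_proj q B P"
proof (cases "P \<in> Gr3")
  case True
  note sub = subspace_taut[OF True]
  have "proj_taut q P (a *\<^sub>R A + b *\<^sub>R B) = a *\<^sub>R proj_taut q P A + b *\<^sub>R proj_taut q P B"
    by (rule proj_tautI[OF True])
      (auto intro!: subspace_add[OF sub] subspace_scale[OF sub] proj_taut_in True
        simp: form_simps proj_taut_form[OF True])
  with True show ?thesis by (simp add: const_proj_def)
qed (simp add: const_proj_def)

lemma const_proj_inj:
  assumes "DIM('a) \<ge> 3" "const_proj q A = const_proj q B"
  shows "A = B"
proof (rule form_eqI)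
  fix x :: 'a
  obtain v where v: "frame3 v" "x \<in> taut (ospan v)" using frame_through_pair[OF assms(1), of x x] by metis
  have "proj_taut q (ospan v) A = proj_taut q (ospan v) B"
    using fun_cong[OF assms(2), of "ospan v"] ospan_Gr3[OF v(1)] by (simp add: const_proj_def)
  then show "q A x = q B x" using proj_taut_form[OF ospan_Gr3[OF v(1)] v(2)] by metis
qed

text \<open>Normalized Gram-Schmidt preserves the orientation, because the change of basis is triangular
  with positive diagonal.\<close>

lemma oriented_orthonormal_exists:
  assumes "P \<in> Gr3" obtains e where "e \<in> P" "orthonormal3 q e"
proof -
  obtain v where v: "frame3 v" "P = ospan v" using assms Gr3_cases by blast
  obtain a b c where abc: "gs2 v = a *\<^sub>R v $ 1 + v $ 2" "gs3 v = b *\<^sub>R v $ 1 + c *\<^sub>R v $ 2 + v $ 3"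
    using gs_lower_triangular .
  define n where "n = (\<lambda>x. 1 / sqrt (q x x))"
  let ?m = "vector [vector [n (gs1 v), 0, 0], vector [n (gs2 v) * a, n (gs2 v), 0],
      vector [n (gs3 v) * b, n (gs3 v) * c, n (gs3 v)]] :: real^3^3"
  note nz = gs_nonzero[OF v(1)] and orth = gs_orthogonal[OF v(1)]
  have orth': "q (gs1 v) (gs2 v) = 0" "q (gs1 v) (gs3 v) = 0" "q (gs2 v) (gs3 v) = 0"
    using orth sym by metis+
  have n: "n (gs1 v) > 0" "n (gs2 v) > 0" "n (gs3 v) > 0" using nz by (simp_all add: n_def)
  have "det ?m > 0" using n by (simp add: det_3)
  then have m: "frame_act ?m v \<in> P" using v(2) by (auto simp: ospan_eq)
  have e: "frame_act ?m v $ 1 = n (gs1 v) *\<^sub>R gs1 v" "frame_act ?m v $ 2 = n (gs2 v) *\<^sub>R gs2 v"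
    "frame_act ?m v $ 3 = n (gs3 v) *\<^sub>R gs3 v"
    by (simp_all add: frame_comb_3 gs1_def abc algebra_simps)
  have sq: "n x * (n x * q x x) = 1" if "q x x > 0" for x using that by (simp add: n_def)
  have "orthonormal3 q (frame_act ?m v)"
    unfolding orthonormal3_def forall_3 e
    by (simp add: form_simps orth orth' sq[OF nz(1)] sq[OF nz(2)] sq[OF nz(3)])
  with m show ?thesis using that by blast
qed

end

section \<open>The kernel of the operator on the Grassmannian\<close>

context inner_form
begin

lemma form_nonneg: "0 \<le> q u u"
  using pos[of u] by (cases "u = 0") (simp_all add: form_simps less_imp_le)

lemma linear_rank_one: "linear (\<lambda>z. t *\<^sub>R (q u z *\<^sub>R w))"
  by (rule linearI) (simp_all add: form_simps scaleR_add_left scaleR_add_right)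

lemma graph_plane_rank_one:
  "graph_plane (ospan v) (\<lambda>z. t *\<^sub>R (q u z *\<^sub>R w)) = ospan (\<chi> i. v $ i + t *\<^sub>R (q u (v $ i) *\<^sub>R w))"
  by (rule graph_plane_ospan[OF linear_rank_one])

lemma graph_frame:
  assumes v: "frame3 v" and w: "w \<in> perp q (ospan v)"
  shows "frame3 (\<chi> i. v $ i + t *\<^sub>R (q u (v $ i) *\<^sub>R w))" (is "frame3 ?v")
  unfolding frame3_iff
proof (intro allI impI)
  fix a assume a: "frame_comb a ?v = 0"
  let ?z = "frame_comb a v"
  have e: "frame_comb a ?v = ?z + (\<Sum>i\<in>UNIV. a $ i * (t * q u (v $ i))) *\<^sub>R w"
    by (simp add: frame_comb_def scaleR_add_right sum.distrib scaleR_sum_left)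
  have "?z \<in> taut (ospan v)" by (simp add: taut_ospan)
  then have "q w ?z = 0" using w by (simp add: perp_def)
  then have "q (frame_comb a ?v) ?z = q ?z ?z" unfolding e by (simp add: form_simps)
  then have "?z = 0" using a by (simp add: form_simps eq_0_iff)
  then show "a = 0" using v by (simp add: frame3_iff)
qed

text \<open>Along the curve of planes \<open>{y + t \<langle>u, y\<rangle> w | y \<in> P}\<close> the projection of \<open>A\<close> can be computed exactly:
  it is \<open>z + t \<langle>u, z\<rangle> w\<close> with \<open>z = a + t (\<langle>A, w\<rangle> - t \<langle>w, w\<rangle> \<zeta>) u\<close>, where \<open>a\<close> is the projection
  to \<open>P\<close> and \<open>\<zeta> = \<langle>u, z\<rangle>\<close>.  Its derivative at \<open>t = 0\<close> is \<open>\<langle>A, w\<rangle> u + \<langle>u, a\<rangle> w\<close>.\<close>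

lemma nabla_const_proj:
  assumes P: "P \<in> Gr3" and w: "w \<in> perp q P" and u: "u \<in> taut P"
  shows "nabla_taut q (const_proj q A) P (\<lambda>z. q u z *\<^sub>R w) = q A w *\<^sub>R u"
proof -
  obtain v where v: "frame3 v" "P = ospan v" using P Gr3_cases by blast
  note sub = subspace_taut[OF P]
  let ?P = "\<lambda>t::real. graph_plane P (\<lambda>z. t *\<^sub>R (q u z *\<^sub>R w))"
  define a where "a = proj_taut q P A"
  have a: "a \<in> taut P" "\<And>z. z \<in> taut P \<Longrightarrow> q a z = q A z"
    using P by (auto simp: a_def proj_taut_in proj_taut_form)
  define k r c where "k = q u u" and "r = q w w" and "c = q A w"
  have k: "k \<ge> 0" "r \<ge> 0" by (simp_all add: k_def r_def form_nonneg)
  have den: "1 + t * t * r * k > 0" for t :: real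
    using k mult_nonneg_nonneg[OF mult_nonneg_nonneg[OF zero_le_square[of t] k(2)] k(1)] by linarith
  define \<zeta> where "\<zeta> t = (q u a + t * k * c) / (1 + t * t * r * k)" for t
  define z where "z t = a + (t * (c - t * r * \<zeta> t)) *\<^sub>R u" for t
  have z: "z t \<in> taut P" for t
    unfolding z_def using a(1) u by (intro subspace_add[OF sub] subspace_scale[OF sub])
  have uz: "q u (z t) = \<zeta> t" for t
  proof -
    have "\<zeta> t * (1 + t * t * r * k) = q u a + t * k * c" using den[of t] by (simp add: \<zeta>_def)
    then show ?thesis by (simp add: z_def form_simps flip: k_def) (simp add: algebra_simps)
  qed
  have w0: "q w y = 0" "q y w = 0" if "y \<in> taut P" for y
    using w that sym[of y w] by (auto simp: perp_def)
  have curve: "const_proj q A (?P t) = z t + (t * \<zeta> t) *\<^sub>R w" for t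
  proof -
    let ?v = "\<chi> i. v $ i + t *\<^sub>R (q u (v $ i) *\<^sub>R w)"
    have Pt: "?P t = ospan ?v" using v(2) by (simp only: graph_plane_rank_one)
    have fr: "frame3 ?v" using graph_frame v w by blast
    have taut: "taut (?P t) = (\<lambda>y. y + (t * q u y) *\<^sub>R w) ` taut P"
    proof -
      have fc: "frame_comb b ?v = frame_comb b v + (t * q u (frame_comb b v)) *\<^sub>R w" for b
        by (simp add: frame_comb_def scaleR_add_right sum.distrib form_simps sum_distrib_left
            scaleR_sum_left mult_ac)
      have "taut (?P t) = range (\<lambda>b. frame_comb b ?v)" by (simp only: Pt taut_ospan)
      moreover have "taut P = range (\<lambda>b. frame_comb b v)" by (simp only: v(2) taut_ospan)
      ultimately show ?thesis by (simp only: image_image fc)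
    qed
    have GP: "?P t \<in> Gr3" using fr by (simp only: Pt ospan_Gr3)
    have "proj_taut q (?P t) A = z t + (t * \<zeta> t) *\<^sub>R w"
    proof (rule proj_tautI)
      show "?P t \<in> Gr3" by (rule GP)
      show "z t + (t * \<zeta> t) *\<^sub>R w \<in> taut (?P t)" unfolding taut
        by (rule image_eqI[of _ _ "z t"]) (simp_all add: uz z)
      fix y' assume "y' \<in> taut (?P t)"
      then obtain y where y: "y \<in> taut P" "y' = y + (t * q u y) *\<^sub>R w" unfolding taut by blast
      have "q (A - (z t + (t * \<zeta> t) *\<^sub>R w)) y' = q (A - z t) y + t * q u y * (c - t * r * \<zeta> t)"
        using w0(1)[OF y(1)] w0(2)[OF z[of t]]
        by (simp add: y(2) form_simps algebra_simps flip: c_def r_def)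
      also have "q (A - z t) y = - (t * (c - t * r * \<zeta> t)) * q u y"
        using a(2)[OF y(1)] by (simp add: z_def form_simps)
      finally show "q (A - (z t + (t * \<zeta> t) *\<^sub>R w)) y' = 0" by simp
    qed
    then show ?thesis by (simp only: const_proj_def GP if_True)
  qed
  have "\<exists>d. (\<zeta> has_real_derivative d) (at 0)"
    unfolding \<zeta>_def using den by (intro exI) (rule derivative_eq_intros refl | force)+
  then obtain d where d: "(\<zeta> has_real_derivative d) (at 0)" by blast
  have \<zeta>0: "\<zeta> 0 = q u a" by (simp add: \<zeta>_def)
  have sc: "((\<lambda>t. f t *\<^sub>R y) has_vector_derivative d *\<^sub>R y) (at 0)"
    if "(f has_real_derivative d) (at 0)" for f :: "real \<Rightarrow> real" and d and y :: 'a
    using has_vector_derivative_scaleR[OF that has_vector_derivative_const[of y]] by simp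
  have "((\<lambda>t. t * (c - t * r * \<zeta> t)) has_real_derivative c) (at 0)"
    by (rule derivative_eq_intros d refl | simp)+
  moreover have "((\<lambda>t. t * \<zeta> t) has_real_derivative q u a) (at 0)"
    by (rule derivative_eq_intros d refl | simp add: \<zeta>0)+
  ultimately have "((\<lambda>t. z t + (t * \<zeta> t) *\<^sub>R w) has_vector_derivative c *\<^sub>R u + q u a *\<^sub>R w) (at 0)"
    unfolding z_def
    using has_vector_derivative_add[OF has_vector_derivative_add[OF has_vector_derivative_const sc] sc]
    by force
  then have "vector_derivative (\<lambda>t. const_proj q A (?P t)) (at 0) = c *\<^sub>R u + q u a *\<^sub>R w"
    unfolding curve by (rule vector_derivative_at)
  moreover have "proj_taut q P (c *\<^sub>R u + q u a *\<^sub>R w) = c *\<^sub>R u"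
    by (rule proj_tautI[OF P]) (simp_all add: subspace_scale[OF sub u] form_simps w0)
  ultimately show ?thesis by (simp add: nabla_taut_def c_def)
qed

text \<open>As a trilinear form \<open>\<nabla>s\<^sub>A\<close> is \<open>(w, u, u') \<mapsto> \<langle>A, w\<rangle> \<langle>u, u'\<rangle>\<close>, which is pure trace.\<close>

lemma const_proj_in_ker_D: "const_proj q A \<in> ker_D q"
proof -
  have "D_op q (const_proj q A) P w u u' = 0"
    if P: "P \<in> Gr3" and w: "w \<in> perp q P" and u: "u \<in> taut P" for P w u u'
  proof -
    let ?T = "nabla_taut_form q (const_proj q A) P w"
    have T: "?T x y = q A w * q x y" if "x \<in> taut P" for x y
      using nabla_const_proj[OF P w that] by (simp add: nabla_taut_form_def form_simps)
    have tr: "(\<Sum>i\<in>UNIV. ?T (e $ i) (e $ i)) = 3 * q A w" if "e \<in> P" "orthonormal3 q e" for e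
    proof -
      have "P = ospan e" using P that(1) Gr3_ospan by blast
      then have "?T (e $ i) (e $ i) = q A w" for i
        using T[of "e $ i"] nth_in_taut[of e i] that(2) by (simp add: orthonormal3_def)
      then show ?thesis by simp
    qed
    obtain e where e: "e \<in> P" "orthonormal3 q e" using oriented_orthonormal_exists[OF P] .
    have "form_trace q P ?T = 3 * q A w"
      unfolding form_trace_def by (rule the_equality) (use tr e in \<open>fastforce\<close>)+
    then show ?thesis using T[OF u] by (simp add: D_op_def)
  qed
  then show ?thesis by (simp add: ker_D_def taut_section_const_proj)
qed

text \<open>
  A section \<open>s\<close> in the kernel satisfies \<open>\<langle>\<nabla>\<^bsub>w\<otimes>u\<^esub> s, u'\<rangle> = 0\<close> for orthogonal \<open>u, u'\<close>
  in the plane.  Moving the plane in the direction \<open>w \<otimes> u\<close> keeps \<open>u'\<close> in it, so \<open>\<langle>s(P), u'\<rangle>\<close>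
  does not change while the plane moves with \<open>u'\<close> in it.  In terms of frames: \<open>\<langle>s, v\<^sub>j\<rangle>\<close> has no
  derivative in the direction of the other frame vectors.
\<close>

lemma ker_D_derivative:
  assumes s: "s \<in> ker_D q" and v: "frame3 v" and ij: "i \<noteq> j"
  shows "q (frechet_derivative (\<lambda>v. s (ospan v)) (at v) (axis i w)) (v $ j) = 0"
proof -
  let ?h = "\<lambda>v. s (ospan v)"
  let ?d = "frechet_derivative ?h (at v)"
  note P = ospan_Gr3[OF v]
  have sm: "smooth_on {v. frame3 v} ?h" using s by (simp add: ker_D_def taut_section_def)
  have hd: "(?h has_derivative ?d) (at v)" using smooth_on_has_derivative[OF sm] v by simp
  have lin: "linear ?d" using smooth_on_linear_derivative[OF sm] v by simp
  have vd: "((\<lambda>t. ?h (v + t *\<^sub>R x)) has_vector_derivative ?d x) (at 0)" for x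
  proof -
    have "((\<lambda>t. v + t *\<^sub>R x) has_derivative (\<lambda>t. t *\<^sub>R x)) (at 0)"
      by (auto intro!: derivative_eq_intros)
    then have "((\<lambda>t. ?h (v + t *\<^sub>R x)) has_derivative (\<lambda>t. ?d (t *\<^sub>R x))) (at 0)"
      by (rule has_derivative_compose) (simp add: hd)
    then show ?thesis by (simp add: has_vector_derivative_def linear_cmul[OF lin])
  qed
  define wT where "wT = proj_taut q (ospan v) w"
  have wT: "wT \<in> taut (ospan v)" by (simp add: wT_def proj_taut_in P)
  have wN: "w - wT \<in> perp q (ospan v)"
    using proj_taut_form[OF P] by (simp add: wT_def perp_def form_simps)
  \<comment> \<open>Adding a vector of the plane to \<open>v\<^sub>i\<close> does not change the plane.\<close>
  have "?d (axis i wT) = 0"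
  proof -
    obtain c where c: "wT = frame_comb c v" using wT by (auto simp: taut_ospan)
    let ?m = "\<lambda>t. mat 1 + t *\<^sub>R axis i c :: real^3^3"
    have act: "frame_act (?m t) v = v + t *\<^sub>R axis i wT" for t
    proof -
      have "frame_comb (mat 1 $ k) v = v $ k" for k using frame_act_mat_1[of v] by (metis frame_act_nth)
      then show ?thesis
        by (subst vec_eq_iff) (simp add: frame_comb_add frame_comb_scaleR c axis_def)
    qed
    have "isCont (\<lambda>t. det (?m t)) 0" unfolding det_3 by (intro continuous_intros)
    then have "((\<lambda>t. det (?m t)) \<longlongrightarrow> det (?m 0)) (nhds 0)"
      using tendsto_at_iff_tendsto_nhds[of "\<lambda>t. det (?m t)" 0] by (simp only: isCont_def)
    then have "\<forall>\<^sub>F t in nhds 0. det (?m t) > 0" by (rule order_tendstoD(1)) simp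
    then have "\<forall>\<^sub>F t in nhds 0. ?h v = ?h (v + t *\<^sub>R axis i wT)"
    proof (rule eventually_mono)
      fix t assume "det (?m t) > 0"
      then have "v + t *\<^sub>R axis i wT \<in> ospan v" unfolding ospan_eq act[symmetric] by blast
      then show "?h v = ?h (v + t *\<^sub>R axis i wT)" using ospan_cong by metis
    qed
    then have "\<forall>\<^sub>F t in at 0. ?h v = ?h (v + t *\<^sub>R axis i wT)"
      unfolding eventually_nhds_conv_at by blast
    then have "((\<lambda>t. ?h (v + t *\<^sub>R axis i wT)) has_derivative (\<lambda>_. 0)) (at 0)"
      by (rule has_derivative_transform_eventually[OF has_derivative_const]) simp_all
    then have "((\<lambda>t. ?h (v + t *\<^sub>R axis i wT)) has_vector_derivative 0) (at 0)"
      by (simp add: has_vector_derivative_def)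
    then show ?thesis using vd[of "axis i wT"] vector_derivative_unique_at by blast
  qed
  moreover have "q (?d (axis i (w - wT))) (v $ j) = 0"
  proof -
    \<comment> \<open>Changing only \<open>v\<^sub>i\<close> means to move the plane in the direction \<open>w \<otimes> u\<close> with \<open>u\<close> dual to \<open>v\<^sub>i\<close>.\<close>
    obtain u where u: "u \<in> taut (ospan v)" "q u (v $ i) = 1" "\<And>k. k \<noteq> i \<Longrightarrow> q u (v $ k) = 0"
      using dual_vector[OF v, of i] by metis
    have "(\<chi> k. v $ k + t *\<^sub>R (q u (v $ k) *\<^sub>R (w - wT))) = v + t *\<^sub>R axis i (w - wT)" for t
      using u(2,3) by (auto simp: vec_eq_iff axis_def)
    then have "graph_plane (ospan v) (\<lambda>z. t *\<^sub>R (q u z *\<^sub>R (w - wT))) = ospan (v + t *\<^sub>R axis i (w - wT))" for t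
      by (simp only: graph_plane_rank_one)
    then have nab: "nabla_taut q s (ospan v) (\<lambda>z. q u z *\<^sub>R (w - wT)) =
        proj_taut q (ospan v) (?d (axis i (w - wT)))"
      using vector_derivative_at[OF vd] by (simp add: nabla_taut_def)
    have "D_op q s (ospan v) (w - wT) u (v $ j) = 0"
    proof -
      have "\<forall>P\<in>Gr3. \<forall>w\<in>perp q P. \<forall>u\<in>taut P. \<forall>u'\<in>taut P. D_op q s P w u u' = 0"
        using s by (simp add: ker_D_def)
      from this[rule_format, OF P wN u(1) nth_in_taut] show ?thesis .
    qed
    then show ?thesis
      using u(3)[of j] ij proj_taut_form[OF P nth_in_taut]
      by (simp add: D_op_def nabla_taut_form_def nab)
  qed
  moreover have "axis i w = axis i wT + axis i (w - wT)" by (simp add: axis_def vec_eq_iff)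
  ultimately show ?thesis by (simp add: linear_add[OF lin] form_simps)
qed

definition frame_upd :: "'a^3 \<Rightarrow> 3 \<Rightarrow> 'a \<Rightarrow> 'a^3" where
  "frame_upd v i w = (\<chi> k. if k = i then w else v $ k)"

text \<open>For \<open>t \<noteq> 0\<close> the moved vector has a component along \<open>w\<close>, which lies outside the plane, and for
  \<open>t = 0\<close> it is \<open>v\<^sub>i\<close>.  So \<open>w\<close> may replace \<open>v\<^sub>i\<close> along a segment of frames.\<close>

lemma frame_upd_segment:
  assumes v: "frame3 v" and w: "w \<notin> taut (ospan v)"
  shows "frame3 (v + t *\<^sub>R axis i (w - v $ i))"
  unfolding frame3_iff
proof (intro allI impI)
  let ?v = "v + t *\<^sub>R axis i (w - v $ i)"
  fix a assume a: "frame_comb a ?v = 0"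
  have "frame_comb a ?v = frame_comb a v + (\<Sum>k\<in>UNIV. a $ k *\<^sub>R (t *\<^sub>R (axis i (w - v $ i) $ k)))"
    by (simp add: frame_comb_def scaleR_add_right sum.distrib)
  also have "(\<Sum>k\<in>UNIV. a $ k *\<^sub>R (t *\<^sub>R (axis i (w - v $ i) $ k))) =
      (\<Sum>k\<in>UNIV. if i = k then (a $ i * t) *\<^sub>R (w - v $ i) else 0)"
    by (intro sum.cong) (auto simp: axis_def)
  finally have e: "frame_comb a v + (a $ i * t) *\<^sub>R (w - v $ i) = 0" using a by (simp add: sum.delta')
  have "a $ i * t = 0"
  proof (rule ccontr)
    assume n: "a $ i * t \<noteq> 0"
    have "(a $ i * t) *\<^sub>R w = frame_comb ((a $ i * t) *\<^sub>R axis i 1 - a) v"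
      using e by (simp add: frame_comb_diff frame_comb_scaleR algebra_simps)
    then have "w = frame_comb ((1 / (a $ i * t)) *\<^sub>R ((a $ i * t) *\<^sub>R axis i 1 - a)) v"
      using n by (simp only: frame_comb_scaleR flip: \<open>_ = frame_comb _ v\<close>) simp
    then show False using w by (auto simp: taut_ospan)
  qed
  then have "frame_comb a v = 0" using e by (simp only: scaleR_zero_left add_0_right)
  then show "a = 0" using v by (simp add: frame3_iff)
qed

lemma ker_D_move:
  assumes s: "s \<in> ker_D q" and v: "frame3 v" and w: "w \<notin> taut (ospan v)" and ij: "i \<noteq> j"
  shows "frame3 (frame_upd v i w)"
    and "q (s (ospan (frame_upd v i w))) (v $ j) = q (s (ospan v)) (v $ j)"
proof -
  let ?x = "axis i (w - v $ i)"
  let ?h = "\<lambda>v. s (ospan v)"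
  have upd: "frame_upd v i w = v + 1 *\<^sub>R ?x"
    by (auto simp: frame_upd_def vec_eq_iff axis_def)
  show "frame3 (frame_upd v i w)" unfolding upd by (rule frame_upd_segment[OF v w])
  have sm: "smooth_on {v. frame3 v} ?h" using s by (simp add: ker_D_def taut_section_def)
  let ?f = "\<lambda>t. q (?h (v + t *\<^sub>R ?x)) (v $ j)"
  have "(?f has_derivative (\<lambda>h. 0)) (at t within UNIV)" for t
  proof -
    let ?vt = "v + t *\<^sub>R ?x"
    let ?d = "frechet_derivative ?h (at ?vt)"
    note fr = frame_upd_segment[OF v w, of t i]
    have hd: "(?h has_derivative ?d) (at ?vt)" using smooth_on_has_derivative[OF sm] fr by simp
    have lin: "linear ?d" using smooth_on_linear_derivative[OF sm] fr by simp
    have "((\<lambda>t. v + t *\<^sub>R ?x) has_derivative (\<lambda>t. t *\<^sub>R ?x)) (at t)"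
      by (auto intro!: derivative_eq_intros)
    from has_derivative_compose[OF this hd]
    have "(?f has_derivative (\<lambda>h. q (?d (h *\<^sub>R ?x)) (v $ j))) (at t)"
      using bounded_linear.has_derivative[OF bounded_bilinear.bounded_linear_left[OF bounded_bilinear_form]]
      by blast
    moreover have vj: "?vt $ j = v $ j" using ij by (simp add: axis_def)
    have "q (?d ?x) (v $ j) = 0"
      using ker_D_derivative[OF s fr ij, of "w - v $ i"] unfolding vj .
    then have "q (?d (h *\<^sub>R ?x)) (v $ j) = 0" for h
      by (simp add: linear_cmul[OF lin] form_simps)
    ultimately show ?thesis by simp
  qed
  then have "\<exists>c. \<forall>t\<in>UNIV. ?f t = c" by (intro has_derivative_zero_constant convex_UNIV)
  then obtain c where c: "\<And>t. ?f t = c" by blast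
  have "?f 1 = ?f 0" by (simp only: c)
  then show "q (s (ospan (frame_upd v i w))) (v $ j) = q (s (ospan v)) (v $ j)"
    unfolding upd by simp
qed

lemma outside_two_planes:
  assumes "DIM('a) > 3" "P \<in> Gr3" "P' \<in> Gr3"
  obtains z :: 'a where "z \<notin> taut P" "z \<notin> taut P'"
proof -
  have proper: "taut P \<noteq> UNIV" if "P \<in> Gr3" for P :: "('a^3) set"
  proof -
    obtain v where v: "P = ospan v" using \<open>P \<in> Gr3\<close> Gr3_cases by blast
    have "card (range (($) v)) \<le> card (UNIV :: 3 set)" by (rule card_image_le) simp
    then have "card (range (($) v)) \<le> 3" by simp
    then have "dim (taut P) \<le> 3"
      unfolding v taut_ospan_span dim_span
      using dim_le_card'[of "range (($) v)"] by simp
    then show ?thesis using assms(1) by (metis dim_UNIV not_less)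
  qed
  obtain x y where x: "x \<notin> taut P" and y: "y \<notin> taut P'" using proper assms(2,3) by blast
  note sP = subspace_taut[OF assms(2)] and sP' = subspace_taut[OF assms(3)]
  show ?thesis
  proof (cases "x \<in> taut P' \<and> y \<in> taut P")
    case True
    have "x + y \<notin> taut P" using x True subspace_diff[OF sP, of "x + y" y] by auto
    moreover have "x + y \<notin> taut P'" using y True subspace_diff[OF sP', of "x + y" x] by auto
    ultimately show ?thesis using that by blast
  qed (use x y that in blast)
qed

text \<open>Any two planes through a vector are joined by moves that replace one of the two other frame
  vectors by a vector outside the current plane.\<close>

lemma ker_D_depends_on_vector:
  assumes D: "DIM('a) > 3" and s: "s \<in> ker_D q"
    and P: "P \<in> Gr3" "x \<in> taut P" and P': "P' \<in> Gr3" "x \<in> taut P'"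
  shows "q (s P) x = q (s P') x"
proof (cases "x = 0")
  case False
  obtain v where v: "frame3 v" "P = ospan v" "v $ 1 = x"
    by (metis Gr3_cases P False first_vector_of_frame frame3_ospan ospan_cong)
  obtain v' where v': "frame3 v'" "P' = ospan v'" "v' $ 1 = x"
    by (metis Gr3_cases P' False first_vector_of_frame frame3_ospan ospan_cong)
  obtain z where z: "z \<notin> taut P" "z \<notin> taut P'" using outside_two_planes[OF D P(1) P'(1)] .
  let ?v3 = "frame_upd v 3 z" and ?v3' = "frame_upd v' 3 z"
  have fr: "frame3 ?v3" "q (s (ospan ?v3)) x = q (s P) x"
    using ker_D_move[OF s v(1), of z 3 1] z(1) v by auto
  have fr': "frame3 ?v3'" "q (s (ospan ?v3')) x = q (s P') x"
    using ker_D_move[OF s v'(1), of z 3 1] z(2) v' by auto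
  \<comment> \<open>The second vector is changed to the same \<open>y\<close> in both frames, which makes them equal.\<close>
  obtain y where y: "y \<notin> taut (ospan ?v3)" "y \<notin> taut (ospan ?v3')"
    using outside_two_planes[OF D ospan_Gr3[OF fr(1)] ospan_Gr3[OF fr'(1)]] .
  have "?v3 $ 1 = x" "?v3' $ 1 = x" by (simp_all add: frame_upd_def v(3) v'(3))
  then have "q (s (ospan (frame_upd ?v3 2 y))) x = q (s P) x"
    "q (s (ospan (frame_upd ?v3' 2 y))) x = q (s P') x"
    using ker_D_move(2)[OF s fr(1) y(1), of 2 1] ker_D_move(2)[OF s fr'(1) y(2), of 2 1] fr(2) fr'(2)
    by auto
  moreover have "frame_upd ?v3 2 y = frame_upd ?v3' 2 y"
    by (simp add: frame_upd_def vec_eq_iff forall_3 v(3) v'(3))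
  ultimately show ?thesis by simp
qed (simp add: form_simps)

text \<open>So \<open>\<langle>s(P), x\<rangle>\<close> is a function \<open>f\<close> of \<open>x\<close> alone.  It is linear, since any two vectors lie in a
  common plane, and the vector \<open>A\<close> that represents it satisfies \<open>s = s\<^sub>A\<close>.\<close>

theorem ker_D_eq:
  assumes D: "DIM('a) > 3" shows "ker_D q = range (const_proj q)"
proof
  show "range (const_proj q) \<subseteq> ker_D q" using const_proj_in_ker_D by blast
  show "ker_D q \<subseteq> range (const_proj q)"
  proof
    fix s assume s: "s \<in> ker_D q"
    have pair: "\<exists>P\<in>Gr3. x \<in> taut P \<and> y \<in> taut P" for x y :: 'a
      using frame_through_pair[of x y] D ospan_Gr3 by (metis less_imp_le)
    define f where "f x = q (s (SOME P. P \<in> Gr3 \<and> x \<in> taut P)) x" for x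
    have f: "f x = q (s P) x" if "P \<in> Gr3" "x \<in> taut P" for P x
    proof -
      have "\<exists>P. P \<in> Gr3 \<and> x \<in> taut P" using that by blast
      from someI_ex[OF this] show ?thesis
        unfolding f_def using ker_D_depends_on_vector[OF D s _ _ that] by blast
    qed
    have "linear f"
    proof (rule linearI)
      fix x y :: 'a and c :: real
      obtain P where P: "P \<in> Gr3" "x \<in> taut P" "y \<in> taut P" using pair[of x y] by blast
      note sub = subspace_taut[OF P(1)]
      show "f (x + y) = f x + f y"
        using f[OF P(1)] P subspace_add[OF sub P(2,3)] by (simp add: form_simps)
      show "f (c *\<^sub>R x) = c *\<^sub>R f x"
        using f[OF P(1)] P subspace_scale[OF sub P(2)] by (simp add: form_simps)
    qed
    then obtain A where A: "\<And>x. q A x = f x" using riesz by blast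
    have sec: "taut_section s" using s by (simp add: ker_D_def)
    have "s P = const_proj q A P" for P
    proof (cases "P \<in> Gr3")
      case True
      then have "proj_taut q P A = s P"
        using sec f[OF True] by (intro proj_tautI) (auto simp: taut_section_def form_simps A)
      with True show ?thesis by (simp add: const_proj_def)
    next
      case False
      then show ?thesis using sec by (simp add: const_proj_def taut_section_def)
    qed
    then show "s \<in> range (const_proj q)" by blast
  qed
qed

end

section \<open>Families of linear and bilinear maps\<close>

abbreviation pd :: "('a::real_normed_vector \<Rightarrow> 'b::real_normed_vector) \<Rightarrow> 'a \<Rightarrow> 'a \<Rightarrow> 'b" where
  "pd f x u \<equiv> frechet_derivative f (at x) u"

lemma pd_cong:
  "open U \<Longrightarrow> x \<in> U \<Longrightarrow> f differentiable (at x) \<Longrightarrow> (\<And>y. y \<in> U \<Longrightarrow> f y = h y) \<Longrightarrow> pd f x u = pd h x u"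
  using frechet_derivative_transform_within_open by metis

lemma pd_add:
  "f differentiable (at x) \<Longrightarrow> h differentiable (at x) \<Longrightarrow> pd (\<lambda>y. f y + h y) x u = pd f x u + pd h x u"
  using frechet_derivative_eqI[OF has_derivative_add[OF has_derivative_frechet has_derivative_frechet]]
  by metis

lemma pd_diff:
  "f differentiable (at x) \<Longrightarrow> h differentiable (at x) \<Longrightarrow> pd (\<lambda>y. f y - h y) x u = pd f x u - pd h x u"
  using frechet_derivative_eqI[OF has_derivative_diff[OF has_derivative_frechet has_derivative_frechet]]
  by metis

lemma pd_bounded_linear:
  "bounded_linear h \<Longrightarrow> f differentiable (at x) \<Longrightarrow> pd (\<lambda>y. h (f y)) x u = h (pd f x u)"
  using frechet_derivative_eqI[OF bounded_linear.has_derivative[OF _ has_derivative_frechet]]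
  by metis

lemma pd_sum:
  assumes "\<And>i. i \<in> I \<Longrightarrow> f i differentiable (at x)"
  shows "pd (\<lambda>y. \<Sum>i\<in>I. f i y) x u = (\<Sum>i\<in>I. pd (f i) x u)"
proof -
  have "((\<lambda>y. \<Sum>i\<in>I. f i y) has_derivative (\<lambda>u. \<Sum>i\<in>I. pd (f i) x u)) (at x)"
    by (intro has_derivative_sum has_derivative_frechet assms)
  then show ?thesis using frechet_derivative_eqI by metis
qed

lemma pd_bilinear:
  assumes "bounded_bilinear ml" "f differentiable (at x)" "h differentiable (at x)"
  shows "pd (\<lambda>y. ml (f y) (h y)) x u = ml (f x) (pd h x u) + ml (pd f x u) (h x)"
  using frechet_derivative_eqI[OF bounded_bilinear.FDERIV[OF assms(1) has_derivative_frechet[OF assms(2)]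
        has_derivative_frechet[OF assms(3)]]] by metis

lemma pd_linear_parameter:
  assumes "open U" "x \<in> U" "\<And>y. y \<in> U \<Longrightarrow> linear (T y)" "\<And>v. (\<lambda>y. T y v) differentiable (at x)"
  shows "linear (\<lambda>v. pd (\<lambda>y. T y v) x u)"
proof (rule linearI)
  fix v w and r :: real
  have "pd (\<lambda>y. T y (v + w)) x u = pd (\<lambda>y. T y v + T y w) x u"
    by (rule pd_cong[OF assms(1,2,4)]) (use assms(3) linear_add in blast)
  then show "pd (\<lambda>y. T y (v + w)) x u = pd (\<lambda>y. T y v) x u + pd (\<lambda>y. T y w) x u"
    by (simp add: pd_add assms(4))
  have "pd (\<lambda>y. T y (r *\<^sub>R v)) x u = pd (\<lambda>y. r *\<^sub>R T y v) x u"
    by (rule pd_cong[OF assms(1,2,4)]) (use assms(3) linear_cmul in blast)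
  then show "pd (\<lambda>y. T y (r *\<^sub>R v)) x u = r *\<^sub>R pd (\<lambda>y. T y v) x u"
    using pd_bounded_linear[OF bounded_linear_scaleR_right assms(4)] by metis
qed

text \<open>The product rule for \<open>T\<^sub>y(X\<^sub>y)\<close>, where only the functions \<open>y \<mapsto> T\<^sub>y(v)\<close> with constant \<open>v\<close> are
  known to be differentiable.  Endomorphism fields and metrics are given in this form.\<close>

lemma has_derivative_linear_family:
  fixes T :: "'a::real_normed_vector \<Rightarrow> 'e::euclidean_space \<Rightarrow> 'b::real_normed_vector"
  assumes "open U" "x \<in> U" "\<And>y. y \<in> U \<Longrightarrow> linear (T y)" "\<And>v. (\<lambda>y. T y v) differentiable (at x)"
    and X: "X differentiable (at x)"
  shows "((\<lambda>y. T y (X y)) has_derivative (\<lambda>u. pd (\<lambda>y. T y (X x)) x u + T x (pd X x u))) (at x)"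
proof -
  have "((\<lambda>y. \<Sum>b\<in>Basis. (X y \<bullet> b) *\<^sub>R T y b) has_derivative
      (\<lambda>u. \<Sum>b\<in>Basis. (X x \<bullet> b) *\<^sub>R pd (\<lambda>y. T y b) x u + (pd X x u \<bullet> b) *\<^sub>R T x b)) (at x)"
    by (intro has_derivative_sum has_derivative_scaleR has_derivative_inner_left
        has_derivative_frechet assms)
  moreover have "(\<Sum>b\<in>Basis. (X x \<bullet> b) *\<^sub>R pd (\<lambda>y. T y b) x u) = pd (\<lambda>y. T y (X x)) x u" for u
    using linear_euclidean_expansion[OF pd_linear_parameter[OF assms(1-4)], of "X x"]
    by metis
  moreover have "(\<Sum>b\<in>Basis. (pd X x u \<bullet> b) *\<^sub>R T x b) = T x (pd X x u)" for u
    using linear_euclidean_expansion[OF assms(3)[OF assms(2)]] by metis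
  ultimately have "((\<lambda>y. \<Sum>b\<in>Basis. (X y \<bullet> b) *\<^sub>R T y b) has_derivative
      (\<lambda>u. pd (\<lambda>y. T y (X x)) x u + T x (pd X x u))) (at x)"
    by (simp add: sum.distrib)
  then show ?thesis
    by (rule has_derivative_transform_within_open[OF _ assms(1,2)])
      (use linear_euclidean_expansion[OF assms(3)] in metis)
qed

lemmas pd_linear_family = has_derivative_linear_family[THEN frechet_derivative_eqI, THEN fun_cong]

lemma smooth_on_linear_family:
  fixes T :: "'a::real_normed_vector \<Rightarrow> 'e::euclidean_space \<Rightarrow> 'b::real_normed_vector"
  assumes "open U" "\<And>y. y \<in> U \<Longrightarrow> linear (T y)" "\<And>v. smooth_on U (\<lambda>y. T y v)" "smooth_on U X"
  shows "smooth_on U (\<lambda>y. T y (X y))"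
proof -
  have "smooth_on U (\<lambda>y. \<Sum>b\<in>Basis. (X y \<bullet> b) *\<^sub>R T y b)"
    using assms by (intro smooth_on_sum smooth_on_scaleR smooth_on_inner) auto
  then show ?thesis
    by (rule smooth_on_transform[OF assms(1)]) (rule linear_euclidean_expansion[OF assms(2)])
qed

lemma smooth_on_bilinear_family:
  fixes B :: "'a::real_normed_vector \<Rightarrow> 'e::euclidean_space \<Rightarrow> 'e \<Rightarrow> real"
  assumes "open U" "\<And>y. y \<in> U \<Longrightarrow> bilinear (B y)" "\<And>v w. smooth_on U (\<lambda>y. B y v w)"
    "smooth_on U X" "smooth_on U Y"
  shows "smooth_on U (\<lambda>y. B y (X y) (Y y))"
proof (rule smooth_on_linear_family[OF assms(1), of "\<lambda>y v. B y v (Y y)" X])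
  show "linear (\<lambda>v. B y v (Y y))" if "y \<in> U" for y
    using assms(2)[OF that] by (simp add: bilinear_def)
  show "smooth_on U (\<lambda>y. B y v (Y y))" for v
    using assms(2) by (intro smooth_on_linear_family[OF assms(1) _ assms(3) assms(5)]) (simp add: bilinear_def)
qed (rule assms)

lemma pd_bilinear_family:
  fixes B :: "'a::real_normed_vector \<Rightarrow> 'e::euclidean_space \<Rightarrow> 'e \<Rightarrow> real"
  assumes "open U" "x \<in> U" "\<And>y. y \<in> U \<Longrightarrow> bilinear (B y)"
    and dB: "\<And>v w. (\<lambda>y. B y v w) differentiable (at x)"
    and XY: "X differentiable (at x)" "Y differentiable (at x)"
  shows "pd (\<lambda>y. B y (X y) (Y y)) x u =
     pd (\<lambda>y. B y (X x) (Y x)) x u + B x (pd X x u) (Y x) + B x (X x) (pd Y x u)"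
proof -
  have lin: "linear (B y v)" "linear (\<lambda>v. B y v w)" if "y \<in> U" for y v w
    using assms(3)[OF that] by (simp_all add: bilinear_def)
  have hd: "((\<lambda>y. B y v (Y y)) has_derivative (\<lambda>u. pd (\<lambda>y. B y v (Y x)) x u + B x v (pd Y x u))) (at x)" for v
    by (rule has_derivative_linear_family[OF assms(1,2) lin(1) dB XY(2)])
  have d: "(\<lambda>y. B y v (Y y)) differentiable (at x)" for v
    by (rule differentiableI[OF hd])
  have e: "pd (\<lambda>y. B y v (Y y)) x u = pd (\<lambda>y. B y v (Y x)) x u + B x v (pd Y x u)" for v
    by (rule frechet_derivative_eqI[OF hd, THEN fun_cong])
  show ?thesis
    using e[of "X x"] pd_linear_family[of U x "\<lambda>y v. B y v (Y y)" X u, OF assms(1,2) lin(2) d XY(1)] by simp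
qed

text \<open>Gram-Schmidt with parameters, as an induction over the vectors of the standard basis.\<close>

lemma smooth_orthogonal_family:
  fixes q :: "'a::real_normed_vector \<Rightarrow> 'e::euclidean_space \<Rightarrow> 'e \<Rightarrow> real"
  assumes "open U" and q: "\<And>x. x \<in> U \<Longrightarrow> inner_form (q x)" and sm: "\<And>v w. smooth_on U (\<lambda>x. q x v w)"
    and B: "finite B" "B \<subseteq> Basis"
  shows "\<exists>f :: 'e \<Rightarrow> 'a \<Rightarrow> 'e. (\<forall>b\<in>B. smooth_on U (f b)) \<and>
     (\<forall>x\<in>U. (\<forall>b\<in>B. f b x \<noteq> 0) \<and> (\<forall>b\<in>B. \<forall>c\<in>B. b \<noteq> c \<longrightarrow> q x (f b x) (f c x) = 0) \<and>
        span ((\<lambda>b. f b x) ` B) = span B)"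
  using B
proof (induction B rule: finite_induct)
  case empty
  then show ?case by simp
next
  case (insert b B)
  then have "B \<subseteq> Basis" by blast
  from insert.IH[OF this] obtain f where f: "\<forall>b\<in>B. smooth_on U (f b)"
    "\<forall>x\<in>U. (\<forall>b\<in>B. f b x \<noteq> 0) \<and> (\<forall>b\<in>B. \<forall>c\<in>B. b \<noteq> c \<longrightarrow> q x (f b x) (f c x) = 0) \<and>
        span ((\<lambda>b. f b x) ` B) = span B" by (elim exE conjE)
  then have f: "\<And>c. c \<in> B \<Longrightarrow> smooth_on U (f c)"
    "\<And>x c. x \<in> U \<Longrightarrow> c \<in> B \<Longrightarrow> f c x \<noteq> 0"
    "\<And>x c d. x \<in> U \<Longrightarrow> c \<in> B \<Longrightarrow> d \<in> B \<Longrightarrow> c \<noteq> d \<Longrightarrow> q x (f c x) (f d x) = 0"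
    "\<And>x. x \<in> U \<Longrightarrow> span ((\<lambda>b. f b x) ` B) = span B"
    by auto
  define h where "h x = b - (\<Sum>c\<in>B. (q x b (f c x) / q x (f c x) (f c x)) *\<^sub>R f c x)" for x
  have bilq: "bilinear (q x)" if "x \<in> U" for x using inner_form.bil[OF q[OF that]] .
  have nz: "q x (f c x) (f c x) \<noteq> 0" if "x \<in> U" "c \<in> B" for x c
    using inner_form.pos[OF q[OF that(1)] f(2)[OF that]] by simp
  have hsm: "smooth_on U h"
    unfolding h_def
    by (intro smooth_on_diff smooth_on_sum smooth_on_scaleR smooth_on_divide assms(1) f(1) nz smooth_on_const
        smooth_on_bilinear_family[OF assms(1) bilq sm]; assumption?)
  have horth: "q x (h x) (f d x) = 0" if "x \<in> U" "d \<in> B" for x d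
  proof -
    note fs = inner_form.form_simps[OF q[OF that(1)]]
    have "(\<Sum>c\<in>B. q x b (f c x) / q x (f c x) (f c x) * q x (f c x) (f d x)) =
        (\<Sum>c\<in>B. if c = d then q x b (f d x) else 0)"
      using nz f(3) that by (intro sum.cong) auto
    then show ?thesis using insert.hyps that by (simp add: h_def fs sum.delta)
  qed
  have hspan: "h x - b \<in> span B" if "x \<in> U" for x
  proof -
    have "f c x \<in> span B" if "c \<in> B" for c
      using f(4)[OF \<open>x \<in> U\<close>] span_base[of "f c x" "(\<lambda>b. f b x) ` B"] that by auto
    then show ?thesis
      unfolding h_def by (simp add: span_neg span_sum span_scale)
  qed
  have hnz: "h x \<noteq> 0" if "x \<in> U" for x
  proof
    assume "h x = 0"
    then have "b \<in> span B" using hspan[OF that] span_neg by fastforce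
    moreover have "independent (insert b B)"
      using independent_mono[OF independent_Basis] insert.prems by blast
    ultimately show False using insert.hyps by (simp add: independent_insert)
  qed
  have hspans: "span (insert (h x) ((\<lambda>b. f b x) ` B)) = span (insert b B)" if "x \<in> U" for x
  proof -
    have "span (insert (h x) ((\<lambda>b. f b x) ` B)) = span (insert (h x) B)"
      unfolding span_insert using f(4)[OF that] by simp
    also have "\<dots> = span (insert b B)"
      using eq_span_insert_eq[of "h x" b B] hspan[OF that] by simp
    finally show ?thesis .
  qed
  show ?case
  proof (intro exI[of _ "f(b := h)"] conjI ballI impI)
    fix x assume x: "x \<in> U"
    have "(\<lambda>d. (f(b := h)) d x) ` insert b B = insert (h x) ((\<lambda>b. f b x) ` B)"
      using insert.hyps by (auto simp: image_def)
    then show "span ((\<lambda>d. (f(b := h)) d x) ` insert b B) = span (insert b B)" using hspans[OF x] by simp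
    fix d assume d: "d \<in> insert b B"
    show "(f(b := h)) d x \<noteq> 0" using hnz[OF x] f(2)[OF x] d by auto
    have horth': "q x (f d x) (h x) = 0" if "d \<in> B" for d
      using horth[OF x that] inner_form.sym[OF q[OF x], of "f d x" "h x"] by simp
    fix d' assume "d' \<in> insert b B" "d \<noteq> d'"
    then show "q x ((f(b := h)) d x) ((f(b := h)) d' x) = 0"
      using d horth[OF x] horth' f(3)[OF x] by auto
  next
    fix d assume "d \<in> insert b B"
    then show "smooth_on U ((f(b := h)) d)" using f(1) hsm by auto
  qed
qed

text \<open>In a basis that is orthogonal with respect to \<open>q\<^sub>x\<close> and smooth in \<open>x\<close>, the vector that represents
  \<open>\<phi>\<^sub>x\<close> has the smooth coefficients \<open>\<phi>\<^sub>x(f\<^sub>c) / q\<^sub>x(f\<^sub>c, f\<^sub>c)\<close>.  The Koszul formula is an equation of this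
  kind, so the Christoffel symbols are smooth.\<close>

lemma smooth_riesz:
  fixes q :: "'a::real_normed_vector \<Rightarrow> 'e::euclidean_space \<Rightarrow> 'e \<Rightarrow> real"
  assumes "open U" and q: "\<And>x. x \<in> U \<Longrightarrow> inner_form (q x)" and sm: "\<And>v w. smooth_on U (\<lambda>x. q x v w)"
    and \<phi>: "\<And>x. x \<in> U \<Longrightarrow> linear (\<phi> x)" "\<And>v. smooth_on U (\<lambda>x. \<phi> x v)"
    and z: "\<And>x w. x \<in> U \<Longrightarrow> q x (z x) w = \<phi> x w"
  shows "smooth_on U z"
proof -
  obtain f :: "'e \<Rightarrow> 'a \<Rightarrow> 'e" where f: "\<And>c. c \<in> Basis \<Longrightarrow> smooth_on U (f c)"
    "\<And>x c. x \<in> U \<Longrightarrow> c \<in> Basis \<Longrightarrow> f c x \<noteq> 0"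
    "\<And>x c d. x \<in> U \<Longrightarrow> c \<in> Basis \<Longrightarrow> d \<in> Basis \<Longrightarrow> c \<noteq> d \<Longrightarrow> q x (f c x) (f d x) = 0"
    "\<And>x. x \<in> U \<Longrightarrow> span ((\<lambda>b. f b x) ` Basis) = span (Basis :: 'e set)"
    using smooth_orthogonal_family[OF assms(1-3) finite_Basis order_refl] by metis
  define y where "y x = (\<Sum>c\<in>Basis. (\<phi> x (f c x) / q x (f c x) (f c x)) *\<^sub>R f c x)" for x
  have bilq: "bilinear (q x)" if "x \<in> U" for x using inner_form.bil[OF q[OF that]] .
  have nz: "q x (f c x) (f c x) \<noteq> 0" if "x \<in> U" "c \<in> Basis" for x c
    using inner_form.pos[OF q[OF that(1)] f(2)[OF that]] by simp
  have "smooth_on U y"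
    unfolding y_def
    by (intro smooth_on_sum smooth_on_scaleR smooth_on_divide assms(1) f(1) nz
        smooth_on_bilinear_family[OF assms(1) bilq sm] smooth_on_linear_family[OF assms(1) \<phi>]; assumption?)
  moreover have "y x = z x" if x: "x \<in> U" for x
  proof -
    note fs = inner_form.form_simps[OF q[OF x]]
    have yf: "q x (y x) (f d x) = \<phi> x (f d x)" if "d \<in> Basis" for d
    proof -
      have "(\<Sum>c\<in>Basis. \<phi> x (f c x) / q x (f c x) (f c x) * q x (f c x) (f d x)) =
          (\<Sum>c\<in>Basis. if c = d then \<phi> x (f d x) else 0)"
        using nz f(3) x that by (intro sum.cong) auto
      then show ?thesis using that by (simp add: y_def fs sum.delta)
    qed
    have "q x (y x) w = \<phi> x w" for w
    proof -
      have "w \<in> span ((\<lambda>b. f b x) ` Basis)" using f(4)[OF x] by simp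
      then show ?thesis
        by (induction rule: span_induct_alt)
          (auto simp: fs yf linear_0[OF \<phi>(1)[OF x]] linear_add[OF \<phi>(1)[OF x]] linear_cmul[OF \<phi>(1)[OF x]])
    qed
    then show ?thesis using z[OF x] inner_form.form_eqI[OF q[OF x]] by metis
  qed
  ultimately show ?thesis using smooth_on_transform[OF assms(1), of y z] by simp
qed

section \<open>The Levi-Civita connection in a chart\<close>

locale chart_metric =
  fixes g :: "('m, 'e::euclidean_space) metric" and c :: "('m, 'e) chart" and U :: "'e set"
  assumes open_U: "open U"
    and form: "x \<in> U \<Longrightarrow> inner_form (g c x)"
    and smooth_g: "smooth_on U (\<lambda>x. g c x u v)"
begin

abbreviation \<Gamma> :: "'e \<Rightarrow> 'e \<Rightarrow> 'e \<Rightarrow> 'e" where "\<Gamma> \<equiv> christoffel g c"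

lemmas fs = inner_form.form_simps[OF form]
lemmas g_sym = inner_form.sym[OF form]
lemmas g_bil = inner_form.bil[OF form]

lemma diff_g: "x \<in> U \<Longrightarrow> (\<lambda>y. g c y u v) differentiable (at x)"
  using smooth_on_differentiable smooth_g by blast

lemma linear_pd_g:
  assumes "x \<in> U"
  shows "linear (\<lambda>w. pd (\<lambda>y. g c y v w) x u)" "linear (\<lambda>w. pd (\<lambda>y. g c y w v) x u)"
    "linear (\<lambda>w. pd (\<lambda>y. g c y v u) x w)"
  using pd_linear_parameter[OF open_U assms inner_form.linear_right[OF form] diff_g[OF assms]]
    pd_linear_parameter[OF open_U assms, of "\<lambda>y w. g c y w v" u] inner_form.linear_left[OF form]
    linear_frechet_derivative[OF diff_g[OF assms]] diff_g[OF assms]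
  by blast+

lemma linear_koszul:
  assumes x: "x \<in> U"
  shows "linear (\<lambda>w. (pd (\<lambda>y. g c y v w) x u + pd (\<lambda>y. g c y u w) x v - pd (\<lambda>y. g c y u v) x w) / 2)"
  by (rule linearI) (simp_all add: linear_add[OF linear_pd_g(1)[OF x]] linear_add[OF linear_pd_g(3)[OF x]]
    linear_cmul[OF linear_pd_g(1)[OF x]] linear_cmul[OF linear_pd_g(3)[OF x]] algebra_simps
    add_divide_distrib diff_divide_distrib)

lemma christoffel_form:
  assumes x: "x \<in> U"
  shows "g c x (\<Gamma> x u v) w =
    (pd (\<lambda>y. g c y v w) x u + pd (\<lambda>y. g c y u w) x v - pd (\<lambda>y. g c y u v) x w) / 2"
proof -
  let ?f = "\<lambda>w. (pd (\<lambda>y. g c y v w) x u + pd (\<lambda>y. g c y u w) x v - pd (\<lambda>y. g c y u v) x w) / 2"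
  note linear_koszul[OF x, of v u]
  from theI'[OF inner_form.riesz[OF form[OF x] this]] show ?thesis
    unfolding christoffel_def by blast
qed

lemma pd_g_sym: "x \<in> U \<Longrightarrow> pd (\<lambda>y. g c y u v) x w = pd (\<lambda>y. g c y v u) x w"
  by (rule pd_cong[OF open_U _ diff_g]) (auto intro: g_sym)

lemma christoffel_sym:
  assumes x: "x \<in> U" shows "\<Gamma> x u v = \<Gamma> x v u"
  by (rule inner_form.form_eqI[OF form[OF x]])
    (use pd_g_sym[OF x, of u v] in \<open>simp add: christoffel_form[OF x] add.commute\<close>)

lemma linear_christoffel:
  assumes x: "x \<in> U"
  shows "linear (\<Gamma> x u)" "linear (\<lambda>u. \<Gamma> x u v)"
proof -
  show *: "linear (\<Gamma> x u)" for u
  proof (rule linearI)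
    fix v w and r :: real
    show "\<Gamma> x u (v + w) = \<Gamma> x u v + \<Gamma> x u w"
      by (rule inner_form.form_eqI[OF form[OF x]])
        (simp add: christoffel_form[OF x] fs[OF x] linear_add[OF linear_pd_g(1)[OF x]]
          linear_add[OF linear_pd_g(2)[OF x]] linear_add[OF linear_pd_g(3)[OF x]] field_simps)
    show "\<Gamma> x u (r *\<^sub>R v) = r *\<^sub>R \<Gamma> x u v"
      by (rule inner_form.form_eqI[OF form[OF x]])
        (simp add: christoffel_form[OF x] fs[OF x] linear_cmul[OF linear_pd_g(1)[OF x]]
          linear_cmul[OF linear_pd_g(2)[OF x]] linear_cmul[OF linear_pd_g(3)[OF x]] field_simps)
  qed
  have "(\<lambda>u. \<Gamma> x u v) = \<Gamma> x v" using christoffel_sym[OF x] by blast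
  then show "linear (\<lambda>u. \<Gamma> x u v)" using * by simp
qed

lemma smooth_christoffel: "smooth_on U (\<lambda>x. \<Gamma> x u v)"
proof (rule smooth_riesz[OF open_U form smooth_g])
  let ?f = "\<lambda>x w. (pd (\<lambda>y. g c y v w) x u + pd (\<lambda>y. g c y u w) x v - pd (\<lambda>y. g c y u v) x w) / 2"
  show "linear (?f x)" if "x \<in> U" for x
    by (rule linear_koszul[OF that])
  show "smooth_on U (\<lambda>x. ?f x w)" for w
    by (intro smooth_on_divide smooth_on_add smooth_on_diff smooth_on_derivative open_U smooth_g
        smooth_on_const) simp
  show "g c x (\<Gamma> x u v) w = ?f x w" if "x \<in> U" for x w by (rule christoffel_form[OF that])
qed

lemma metric_compatible:
  assumes x: "x \<in> U"
  shows "pd (\<lambda>y. g c y v w) x u = g c x (\<Gamma> x u v) w + g c x v (\<Gamma> x u w)"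
proof -
  have "g c x v (\<Gamma> x u w) = g c x (\<Gamma> x u w) v" by (rule g_sym[OF x])
  then show ?thesis
    unfolding christoffel_form[OF x] using pd_g_sym[OF x, of v w u] by (simp add: field_simps)
qed

lemma pd_g_fields:
  assumes "x \<in> U" "X differentiable (at x)" "Y differentiable (at x)"
  shows "pd (\<lambda>y. g c y (X y) (Y y)) x u =
    g c x (pd X x u + \<Gamma> x u (X x)) (Y x) + g c x (X x) (pd Y x u + \<Gamma> x u (Y x))"
  by (subst pd_bilinear_family[OF open_U assms(1) g_bil diff_g[OF assms(1)] assms(2,3)])
    (simp_all add: metric_compatible assms fs)

lemma diff_christoffel: "x \<in> U \<Longrightarrow> (\<lambda>y. \<Gamma> y u v) differentiable (at x)"
  using smooth_on_differentiable smooth_christoffel by blast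

lemma pd_christoffel_field:
  assumes "x \<in> U" "X differentiable (at x)"
  shows "pd (\<lambda>y. \<Gamma> y v (X y)) x u = pd (\<lambda>y. \<Gamma> y v (X x)) x u + \<Gamma> x v (pd X x u)"
  by (rule pd_linear_family[OF open_U assms(1) linear_christoffel(1) diff_christoffel[OF assms(1)] assms(2)])

section \<open>Symmetries of the curvature\<close>

abbreviation R :: "'e \<Rightarrow> 'e \<Rightarrow> 'e \<Rightarrow> 'e \<Rightarrow> 'e" where "R \<equiv> curvature g c"

lemma linear_pd_christoffel:
  assumes x: "x \<in> U"
  shows "linear (\<lambda>w. pd (\<lambda>y. \<Gamma> y v w) x u)" "linear (\<lambda>v. pd (\<lambda>y. \<Gamma> y v w) x u)"
    "linear (\<lambda>u. pd (\<lambda>y. \<Gamma> y v w) x u)"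
proof -
  show "linear (\<lambda>w. pd (\<lambda>y. \<Gamma> y v w) x u)"
    by (rule pd_linear_parameter[OF open_U x linear_christoffel(1) diff_christoffel[OF x]])
  show "linear (\<lambda>v. pd (\<lambda>y. \<Gamma> y v w) x u)"
    by (rule pd_linear_parameter[OF open_U x linear_christoffel(2) diff_christoffel[OF x]])
  show "linear (\<lambda>u. pd (\<lambda>y. \<Gamma> y v w) x u)"
    by (rule linear_frechet_derivative[OF diff_christoffel[OF x]])
qed

lemmas \<Gamma>_simps = linear_add[OF linear_christoffel(1)] linear_add[OF linear_christoffel(2)]
  linear_cmul[OF linear_christoffel(1)] linear_cmul[OF linear_christoffel(2)]
  linear_diff[OF linear_christoffel(1)] linear_diff[OF linear_christoffel(2)]
  linear_neg[OF linear_christoffel(1)]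

lemma linear_curvature:
  assumes x: "x \<in> U"
  shows "linear (R x u v)" "linear (\<lambda>v. R x u v w)" "linear (\<lambda>u. R x u v w)"
  unfolding curvature_def
  by (auto intro!: linearI simp: \<Gamma>_simps[OF x] linear_add[OF linear_pd_christoffel(1)[OF x]]
      linear_add[OF linear_pd_christoffel(2)[OF x]] linear_add[OF linear_pd_christoffel(3)[OF x]]
      linear_cmul[OF linear_pd_christoffel(1)[OF x]] linear_cmul[OF linear_pd_christoffel(2)[OF x]]
      linear_cmul[OF linear_pd_christoffel(3)[OF x]] algebra_simps)

lemma curvature_skew: "R x u v w = - R x v u w"
  by (simp add: curvature_def)

lemma pd_christoffel_sym: "x \<in> U \<Longrightarrow> pd (\<lambda>y. \<Gamma> y u v) x w = pd (\<lambda>y. \<Gamma> y v u) x w"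
  by (rule pd_cong[OF open_U _ diff_christoffel]) (auto intro: christoffel_sym)

lemma first_bianchi: "x \<in> U \<Longrightarrow> R x u v w + R x v w u + R x w u v = 0"
  unfolding curvature_def
  using christoffel_sym[of x u v] christoffel_sym[of x v w] christoffel_sym[of x w u]
    pd_christoffel_sym[of x u v w] pd_christoffel_sym[of x v w u] pd_christoffel_sym[of x w u v]
  by (simp add: algebra_simps)

text \<open>Expand both sides of \<open>\<partial>\<^sub>u \<partial>\<^sub>v \<langle>w, z\<rangle> = \<partial>\<^sub>v \<partial>\<^sub>u \<langle>w, z\<rangle>\<close> by means of metric compatibility.\<close>

lemma curvature_metric_skew:
  assumes x: "x \<in> U"
  shows "g c x (R x u v w) z = - g c x (R x u v z) w"
proof -
  have second: "pd (\<lambda>y. pd (\<lambda>y. g c y w z) y v) x u =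
      g c x (pd (\<lambda>y. \<Gamma> y v w) x u + \<Gamma> x u (\<Gamma> x v w)) z + g c x (\<Gamma> x v w) (\<Gamma> x u z) +
      g c x (\<Gamma> x u w) (\<Gamma> x v z) + g c x w (pd (\<lambda>y. \<Gamma> y v z) x u + \<Gamma> x u (\<Gamma> x v z))" for u v
  proof -
    have "pd (\<lambda>y. pd (\<lambda>y. g c y w z) y v) x u = pd (\<lambda>y. g c y (\<Gamma> y v w) z + g c y w (\<Gamma> y v z)) x u"
      using smooth_on_differentiable[OF smooth_on_derivative[OF smooth_g] x]
      by (rule pd_cong[OF open_U x]) (rule metric_compatible)
    also have "\<dots> = pd (\<lambda>y. g c y (\<Gamma> y v w) z) x u + pd (\<lambda>y. g c y w (\<Gamma> y v z)) x u"
      by (intro pd_add smooth_on_differentiable[OF _ x]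
          smooth_on_bilinear_family[OF open_U g_bil smooth_g] smooth_christoffel smooth_on_const)
    also have "pd (\<lambda>y. g c y (\<Gamma> y v w) z) x u =
        g c x (pd (\<lambda>y. \<Gamma> y v w) x u + \<Gamma> x u (\<Gamma> x v w)) z + g c x (\<Gamma> x v w) (\<Gamma> x u z)"
      using pd_g_fields[OF x diff_christoffel[OF x] differentiable_const, of v w z u] by simp
    also have "pd (\<lambda>y. g c y w (\<Gamma> y v z)) x u =
        g c x (\<Gamma> x u w) (\<Gamma> x v z) + g c x w (pd (\<lambda>y. \<Gamma> y v z) x u + \<Gamma> x u (\<Gamma> x v z))"
      using pd_g_fields[OF x differentiable_const diff_christoffel[OF x], of w v z u] by simp
    finally show ?thesis by simp
  qed
  have "pd (\<lambda>y. pd (\<lambda>y. g c y w z) y v) x u = pd (\<lambda>y. pd (\<lambda>y. g c y w z) y u) x v"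
    by (rule mixed_partials[OF open_U smooth_g x])
  then show ?thesis
    unfolding second using g_sym[OF x, of w] by (simp add: curvature_def fs[OF x])
qed

text \<open>A linear consequence of the two skew symmetries and of the Bianchi identity for each of the four
  triples of arguments.\<close>

lemma curvature_pair_sym:
  assumes x: "x \<in> U"
  shows "g c x (R x u v w) z = g c x (R x w z u) v"
proof -
  let ?R = "\<lambda>u v w z. g c x (R x u v w) z"
  have s1: "?R u v w z = - ?R v u w z" for u v w z
    using curvature_skew[of x u v w] by (simp add: fs[OF x])
  have s2: "?R u v w z = - ?R u v z w" for u v w z by (rule curvature_metric_skew[OF x])
  have b: "?R u v w z + ?R v w u z + ?R w u v z = 0" for u v w z
    using first_bianchi[OF x, of u v w] by (simp add: fs[OF x] flip: fs(1)[OF x])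
  show ?thesis
    using b[of u v w z] b[of v w z u] b[of w z u v] b[of z u v w]
      s1[of v w z u] s1[of w z u v] s1[of z u v w] s1[of v z w u] s1[of u w v z]
      s2[of u v w z] s2[of v w u z] s2[of w u v z] s2[of v w z u] s2[of w z v u] s2[of z v w u]
      s2[of w z u v] s2[of z u w v] s2[of u w z v] s2[of z u v w] s2[of u v z w] s2[of v z u w]
      s1[of u v z w] s1[of w u v z] s1[of w u z v] s1[of z v w u] s1[of z v u w] s1[of z u w v]
      s1[of v w u z] s1[of w z v u]
    by linarith
qed

section \<open>Covariant derivatives of endomorphisms\<close>

definition smooth_endo :: "'e set \<Rightarrow> ('e \<Rightarrow> 'e \<Rightarrow> 'e) \<Rightarrow> bool" where
  "smooth_endo W S \<longleftrightarrow> open W \<and> W \<subseteq> U \<and> (\<forall>y\<in>W. linear (S y)) \<and> (\<forall>v. smooth_on W (\<lambda>y. S y v))"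

abbreviation cov :: "('e \<Rightarrow> 'e \<Rightarrow> 'e) \<Rightarrow> 'e \<Rightarrow> 'e \<Rightarrow> 'e \<Rightarrow> 'e" where "cov \<equiv> nabla_end g c"

lemma smooth_endo_diff:
  "smooth_endo W S \<Longrightarrow> x \<in> W \<Longrightarrow> (\<lambda>y. S y v) differentiable (at x)"
  unfolding smooth_endo_def using smooth_on_differentiable by blast

lemma pd_endo_field:
  assumes "smooth_endo W S" "x \<in> W" "X differentiable (at x)"
  shows "pd (\<lambda>y. S y (X y)) x u = pd (\<lambda>y. S y (X x)) x u + S x (pd X x u)"
  using assms smooth_endo_diff[OF assms(1,2)] unfolding smooth_endo_def
  by (intro pd_linear_family[of W x S X]) auto

lemma smooth_endo_field: "smooth_endo W S \<Longrightarrow> smooth_on W X \<Longrightarrow> smooth_on W (\<lambda>y. S y (X y))"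
  unfolding smooth_endo_def by (rule smooth_on_linear_family[of W S X]) auto

lemma smooth_endo_nabla:
  assumes S: "smooth_endo W S" shows "smooth_endo W (\<lambda>y. cov S y u)"
  unfolding smooth_endo_def
proof (intro conjI ballI allI)
  show W: "open W" "W \<subseteq> U" using S by (simp_all add: smooth_endo_def)
  show "linear (cov S y u)" if "y \<in> W" for y
  proof -
    have yU: "y \<in> U" using W that by blast
    have linS: "linear (S y)" if "y \<in> W" for y using S that by (simp add: smooth_endo_def)
    have lin: "linear (S y)" "linear (\<lambda>v. pd (\<lambda>y. S y v) y u)"
      using linS[OF that] pd_linear_parameter[OF W(1) that linS smooth_endo_diff[OF S that]] .
    show ?thesis
      unfolding nabla_end_def
      by (intro linearI) (simp_all add: linear_add[OF lin(1)] linear_add[OF lin(2)] linear_cmul[OF lin(1)]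
          linear_cmul[OF lin(2)] \<Gamma>_simps[OF yU] algebra_simps)
  qed
  show "smooth_on W (\<lambda>y. cov S y u v)" for v
  proof -
    have Sv: "smooth_on W (\<lambda>y. S y v)" for v using S by (simp add: smooth_endo_def)
    have \<Gamma>W: "smooth_on W (\<lambda>y. \<Gamma> y u v)" for u v using smooth_on_subset[OF smooth_christoffel W(2)] .
    show ?thesis
      unfolding nabla_end_def
      using linear_christoffel(1) W(2)
      by (intro smooth_on_add smooth_on_diff smooth_on_derivative W(1) Sv smooth_endo_field[OF S] \<Gamma>W
          smooth_on_linear_family[OF W(1) _ \<Gamma>W Sv]) auto
  qed
qed

text \<open>The induced connection on endomorphisms differentiates products, so its curvature is the
  commutator with \<open>R\<close>.  The coordinate fields \<open>u\<close> and \<open>v\<close> are constant and commute, so no bracket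
  term occurs.\<close>

lemma ricci_identity_endo:
  assumes S: "smooth_endo W S" and x: "x \<in> W"
  shows "cov (\<lambda>y. cov S y v) x u w - cov (\<lambda>y. cov S y u) x v w = R x u v (S x w) - S x (R x u v w)"
proof -
  have W: "open W" "W \<subseteq> U" and Sv: "\<And>v. smooth_on W (\<lambda>y. S y v)"
    and lin: "linear (S x)" using S x by (simp_all add: smooth_endo_def)
  have xU: "x \<in> U" using W x by blast
  note dS = smooth_endo_diff[OF S x]
  have dd: "(\<lambda>y. pd (\<lambda>y. S y w) y v) differentiable (at x)" for w v
    using smooth_on_differentiable[OF smooth_on_derivative[OF Sv] x] .
  have dG: "(\<lambda>y. \<Gamma> y v (S y w)) differentiable (at x)" for v w
    by (rule smooth_on_differentiable[OF smooth_on_linear_family[OF W(1) linear_christoffel(1)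
          smooth_on_subset[OF smooth_christoffel W(2)] Sv] x]) (rule subsetD[OF W(2)])
  have dSG: "(\<lambda>y. S y (\<Gamma> y v w)) differentiable (at x)" for v w
    by (rule smooth_on_differentiable[OF smooth_endo_field[OF S smooth_on_subset[OF smooth_christoffel W(2)]] x])
  have exp: "pd (\<lambda>y. cov S y v w) x u =
      pd (\<lambda>y. pd (\<lambda>y. S y w) y v) x u + (pd (\<lambda>y. \<Gamma> y v (S x w)) x u + \<Gamma> x v (pd (\<lambda>y. S y w) x u))
      - (pd (\<lambda>y. S y (\<Gamma> x v w)) x u + S x (pd (\<lambda>y. \<Gamma> y v w) x u))" for u v
    unfolding nabla_end_def
    by (simp only: pd_diff[OF differentiable_add[OF dd dG] dSG] pd_add[OF dd dG]
        pd_christoffel_field[OF xU dS] pd_endo_field[OF S x diff_christoffel[OF xU]])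
  have mixed: "pd (\<lambda>y. pd (\<lambda>y. S y w) y v) x u = pd (\<lambda>y. pd (\<lambda>y. S y w) y u) x v" for u v
    by (rule mixed_partials[OF W(1) Sv x])
  show ?thesis
    unfolding nabla_end_def[of g c "\<lambda>y. cov S y _"] exp
    unfolding nabla_end_def curvature_def
    by (simp add: mixed[of u v] christoffel_sym[OF xU, of u v] \<Gamma>_simps[OF xU] linear_add[OF lin]
        linear_diff[OF lin] algebra_simps)
qed

lemma smooth_endo_nabla_vec:
  assumes "open W" "W \<subseteq> U" "smooth_on W X"
  shows "smooth_endo W (nabla_vec g c X)"
  unfolding smooth_endo_def
proof (intro conjI ballI allI assms)
  show "linear (nabla_vec g c X y)" if "y \<in> W" for y
  proof -
    note l = smooth_on_linear_derivative[OF assms(3) that] linear_christoffel(2)[OF subsetD[OF assms(2) that], of "X y"]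
    show ?thesis
      unfolding nabla_vec_def
      by (intro linearI) (simp_all add: linear_add[OF l(1)] linear_add[OF l(2)] linear_cmul[OF l(1)]
          linear_cmul[OF l(2)] algebra_simps)
  qed
  show "smooth_on W (\<lambda>y. nabla_vec g c X y v)" for v
    unfolding nabla_vec_def using linear_christoffel(1) assms(2)
    by (intro smooth_on_add smooth_on_derivative assms
        smooth_on_linear_family[OF assms(1) _ smooth_on_subset[OF smooth_christoffel assms(2)]]) auto
qed

text \<open>The terms with the derivative of \<open>X\<close> in the direction of \<open>\<Gamma>(u, v)\<close> cancel, because there is no
  torsion.\<close>

lemma ricci_identity_vec:
  assumes W: "open W" "W \<subseteq> U" and X: "smooth_on W X" and x: "x \<in> W"
  shows "cov (nabla_vec g c X) x u v - cov (nabla_vec g c X) x v u = R x u v (X x)"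
proof -
  have xU: "x \<in> U" using W x by blast
  have dX: "X differentiable (at x)" using smooth_on_differentiable[OF X x] .
  have dd: "(\<lambda>y. pd X y v) differentiable (at x)" for v
    using smooth_on_differentiable[OF smooth_on_derivative[OF X] x] .
  have dG: "(\<lambda>y. \<Gamma> y v (X y)) differentiable (at x)" for v
    by (rule smooth_on_differentiable[OF smooth_on_linear_family[OF W(1) linear_christoffel(1)
          smooth_on_subset[OF smooth_christoffel W(2)] X] x]) (rule subsetD[OF W(2)])
  have exp: "pd (\<lambda>y. nabla_vec g c X y v) x u =
      pd (\<lambda>y. pd X y v) x u + (pd (\<lambda>y. \<Gamma> y v (X x)) x u + \<Gamma> x v (pd X x u))" for u v
    unfolding nabla_vec_def by (simp only: pd_add[OF dd dG] pd_christoffel_field[OF xU dX])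
  have mixed: "pd (\<lambda>y. pd X y v) x u = pd (\<lambda>y. pd X y u) x v" for u v
    by (rule mixed_partials[OF W(1) X x])
  show ?thesis
    unfolding nabla_end_def exp unfolding nabla_vec_def curvature_def
    by (simp add: mixed[of u v] christoffel_sym[OF xU, of u v] \<Gamma>_simps[OF xU] algebra_simps)
qed

text \<open>Skew endomorphisms form a parallel subbundle, because the metric is parallel.\<close>

lemma nabla_skew:
  assumes S: "smooth_endo W S" and x: "x \<in> W"
    and skew: "\<And>y v w. y \<in> W \<Longrightarrow> g c y (S y v) w = - g c y v (S y w)"
  shows "g c x (cov S x u v) w = - g c x v (cov S x u w)"
proof -
  have W: "open W" "W \<subseteq> U" using S by (simp_all add: smooth_endo_def)
  have xU: "x \<in> U" using W x by blast
  note dS = smooth_endo_diff[OF S x]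
  have 1: "pd (\<lambda>y. g c y (S y v) w) x u =
      g c x (pd (\<lambda>y. S y v) x u + \<Gamma> x u (S x v)) w + g c x (S x v) (\<Gamma> x u w)" for v w
    using pd_g_fields[OF xU dS differentiable_const, of v w u] by simp
  have sm: "smooth_on W (\<lambda>y. g c y (S y v) w)" for v w
    using S W(2) by (intro smooth_on_bilinear_family[OF W(1) g_bil smooth_on_subset[OF smooth_g W(2)]])
      (auto simp: smooth_endo_def)
  have "pd (\<lambda>y. g c y (S y v) w) x u = pd (\<lambda>y. - g c y (S y w) v) x u"
    using smooth_on_differentiable[OF sm x] 
    by (rule pd_cong[OF W(1) x]) (use skew g_sym W(2) in \<open>metis subsetD\<close>)
  also have "\<dots> = - pd (\<lambda>y. g c y (S y w) v) x u"
    using pd_bounded_linear[OF bounded_linear_minus[OF bounded_linear_ident] smooth_on_differentiable[OF sm x]] .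
  finally have "g c x (pd (\<lambda>y. S y v) x u + \<Gamma> x u (S x v)) w + g c x (S x v) (\<Gamma> x u w) =
      - (g c x (pd (\<lambda>y. S y w) x u + \<Gamma> x u (S x w)) v + g c x (S x w) (\<Gamma> x u v))"
    unfolding 1 .
  moreover have "g c x (S x v) (\<Gamma> x u w) = - g c x (S x (\<Gamma> x u w)) v"
    "g c x (S x w) (\<Gamma> x u v) = - g c x (S x (\<Gamma> x u v)) w"
    using skew[OF x] g_sym[OF xU] by metis+
  ultimately have "g c x (cov S x u v) w = - g c x (cov S x u w) v"
    by (simp add: nabla_end_def fs[OF xU])
  then show ?thesis using g_sym[OF xU] by metis
qed

text \<open>Kostant's formula for the second covariant derivative of a Killing field \<open>X\<close>.  The trilinear
  form \<open>\<langle>\<nabla>\<^sup>2\<^bsub>u,v\<^esub>X, w\<rangle>\<close> is skew in \<open>v, w\<close>, and its skew part in \<open>u, v\<close> is given by the Ricci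
  identity; as for the Christoffel symbols, these two properties determine it.\<close>

lemma kostant:
  assumes W: "open W" "W \<subseteq> U" and X: "smooth_on W X" and x: "x \<in> W"
    and killing: "\<And>y v w. y \<in> W \<Longrightarrow> g c y (nabla_vec g c X y v) w = - g c y v (nabla_vec g c X y w)"
  shows "cov (nabla_vec g c X) x u v = - R x (X x) u v"
proof -
  have xU: "x \<in> U" using W x by blast
  let ?K = "\<lambda>u v w. g c x (cov (nabla_vec g c X) x u v) w"
  let ?R = "\<lambda>u v w z. g c x (R x u v w) z"
  have skew: "?K u v w = - ?K u w v" for u v w
    using nabla_skew[OF smooth_endo_nabla_vec[OF W X] x killing] g_sym[OF xU] by metis
  have ric: "?K u v w - ?K v u w = ?R u v (X x) w" for u v w
    using ricci_identity_vec[OF W X x, of u v] by (simp flip: fs(9)[OF xU])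
  have pair: "?R u v (X x) w = ?R (X x) w u v" for u v w by (rule curvature_pair_sym[OF xU])
  have s2: "?R (X x) u v w = - ?R (X x) u w v" for u v w by (rule curvature_metric_skew[OF xU])
  have bianchi: "?R (X x) w u v + ?R (X x) u v w + ?R (X x) v w u = 0" for w
  proof -
    have "?R w u (X x) v + ?R u (X x) w v + ?R (X x) w u v = 0"
      using first_bianchi[OF xU, of w u "X x"] by (simp add: fs[OF xU] flip: fs(1)[OF xU])
    moreover have "?R u (X x) w v = - ?R (X x) u w v"
      using curvature_skew[of x u "X x" w] by (simp add: fs[OF xU])
    ultimately show ?thesis using pair[of w u v] s2[of u v w] s2[of v w u] by linarith
  qed
  have "?K u v w = - ?R (X x) u v w" for w
    using ric[of u v w] ric[of v w u] ric[of w u v] skew[of u v w] skew[of v u w] skew[of v w u]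
      skew[of w u v] skew[of u w v] skew[of w v u] pair[of u v w] pair[of v w u] pair[of w u v]
      s2[of u v w] s2[of v u w] s2[of w u v] bianchi[of w] by linarith
  then show ?thesis by (intro inner_form.form_eqI[OF form[OF xU]]) (simp add: fs[OF xU])
qed

text \<open>The Christoffel symbols enter only through the trace of a commutator, which vanishes.\<close>

lemma pd_endo_trace:
  assumes S: "smooth_endo W S" and J: "smooth_endo W J" and x: "x \<in> W"
  shows "pd (\<lambda>y. endo_trace (S y \<circ> J y)) x u =
    endo_trace (cov S x u \<circ> J x) + endo_trace (S x \<circ> cov J x u)"
proof -
  have xU: "x \<in> U" using S x by (auto simp: smooth_endo_def)
  have lin: "linear (S x)" "linear (J x)" using S J x by (simp_all add: smooth_endo_def)
  note dJ = smooth_endo_diff[OF J x]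
  have dSJ: "(\<lambda>y. S y (J y b)) differentiable (at x)" for b
    using smooth_endo_field[OF S] J x smooth_on_differentiable by (metis smooth_endo_def)
  have "pd (\<lambda>y. endo_trace (S y \<circ> J y)) x u = (\<Sum>b\<in>Basis. pd (\<lambda>y. S y (J y b) \<bullet> b) x u)"
    unfolding endo_trace_def comp_def
    by (rule pd_sum) (intro differentiable_inner dSJ differentiable_const)
  also have "\<dots> = (\<Sum>b\<in>Basis. (pd (\<lambda>y. S y (J x b)) x u + S x (pd (\<lambda>y. J y b) x u)) \<bullet> b)"
    using pd_bounded_linear[OF bounded_linear_inner_left dSJ] pd_endo_field[OF S x dJ]
    by (intro sum.cong refl) metis
  also have "\<dots> = endo_trace (\<lambda>b. cov S x u (J x b)) + endo_trace (\<lambda>b. S x (cov J x u b))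
      - (endo_trace (\<Gamma> x u \<circ> (S x \<circ> J x)) - endo_trace ((S x \<circ> J x) \<circ> \<Gamma> x u))"
    by (simp add: nabla_end_def linear_add[OF lin(1)] linear_diff[OF lin(1)] flip: endo_trace_add endo_trace_diff)
      (simp add: endo_trace_def algebra_simps)
  also have "endo_trace (\<Gamma> x u \<circ> (S x \<circ> J x)) = endo_trace ((S x \<circ> J x) \<circ> \<Gamma> x u)"
    by (rule endo_trace_commute[OF linear_christoffel(1)[OF xU] linear_compose[OF lin(2,1)]])
  finally show ?thesis by (simp add: comp_def)
qed

end

section \<open>Quaternion triples\<close>

definition qcomb :: "real^3 \<Rightarrow> (3 \<Rightarrow> 'e::real_vector \<Rightarrow> 'e) \<Rightarrow> 'e \<Rightarrow> 'e" where
  "qcomb a I u = (\<Sum>i\<in>UNIV. a $ i *\<^sub>R I i u)"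

text \<open>This is the form in which the fibre of \<open>S\<^sup>2H\<close> is given by a local frame.\<close>

definition quat_span :: "(3 \<Rightarrow> 'e::real_vector \<Rightarrow> 'e) \<Rightarrow> ('e \<Rightarrow> 'e) set" where
  "quat_span I = {S. \<exists>a :: real^3. S = (\<lambda>u. \<Sum>i\<in>UNIV. a $ i *\<^sub>R I i u)}"

lemma quat_span_eq: "quat_span I = range (\<lambda>a. qcomb a I)"
  by (auto simp: quat_span_def qcomb_def fun_eq_iff)

lemma qcomb_axis: "qcomb (axis i 1) I = I i"
proof
  fix u
  have "qcomb (axis i 1) I u = (\<Sum>j\<in>UNIV. if i = j then I j u else 0)"
    unfolding qcomb_def by (intro sum.cong) (auto simp: axis_def)
  then show "qcomb (axis i 1) I u = I i u" by (simp add: sum.delta')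
qed

lemma quat_span_base: "I i \<in> quat_span I"
  unfolding quat_span_eq using qcomb_axis[of i I] by (metis rangeI)

lemma quat_span_zero: "(\<lambda>u. 0) \<in> quat_span I"
  unfolding quat_span_eq by (rule range_eqI[of _ _ 0]) (simp add: qcomb_def fun_eq_iff)

lemma quat_span_combination:
  assumes "S \<in> quat_span I" "T \<in> quat_span I"
  shows "(\<lambda>u. a *\<^sub>R S u + b *\<^sub>R T u) \<in> quat_span I"
proof -
  obtain s t where st: "S = qcomb s I" "T = qcomb t I" using assms by (auto simp: quat_span_eq)
  have "(\<lambda>u. a *\<^sub>R S u + b *\<^sub>R T u) = qcomb (a *\<^sub>R s + b *\<^sub>R t) I"
    by (simp add: fun_eq_iff st qcomb_def sum.distrib scaleR_sum_right scaleR_add_left)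
  then show ?thesis by (auto simp: quat_span_eq)
qed

lemma quat_span_sum:
  assumes "\<And>k. k \<in> K \<Longrightarrow> S k \<in> quat_span I"
  shows "(\<lambda>u. \<Sum>k\<in>K. c k *\<^sub>R S k u) \<in> quat_span I"
  using assms
proof (induction K rule: infinite_finite_induct)
  case (insert k K)
  then have "(\<lambda>u. \<Sum>k\<in>K. c k *\<^sub>R S k u) \<in> quat_span I" "S k \<in> quat_span I" by auto
  from quat_span_combination[OF this(2,1), of "c k" 1] show ?case using insert.hyps by simp
qed (simp_all add: quat_span_zero)

lemma index3_shift:
  fixes i :: 3
  shows "i + 1 + 1 = i + 2" "i + 1 + 2 = i" "i + 2 + 1 = i" "i + 2 + 2 = i + 1"
  using exhaust_3[of i] by auto

context
  fixes I :: "3 \<Rightarrow> 'e::euclidean_space \<Rightarrow> 'e"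
  assumes I: "quaternion_triple I"
begin

lemma quat_linear: "linear (I i)"
  using I by (simp add: quaternion_triple_def)

lemma quat_sq: "I i (I i u) = - u"
  using I by (simp add: quaternion_triple_def)

lemma quat_mult:
  "I i (I (i + 1) u) = I (i + 2) u" "I (i + 1) (I i u) = - I (i + 2) u"
  "I (i + 1) (I (i + 2) u) = I i u" "I (i + 2) (I (i + 1) u) = - I i u"
  "I (i + 2) (I i u) = I (i + 1) u" "I i (I (i + 2) u) = - I (i + 1) u"
proof -
  have *: "I i (I (i + 1) u) = I (i + 2) u" "I (i + 1) (I i u) = - I (i + 2) u" for i u
    using I by (auto simp: quaternion_triple_def)
  show "I i (I (i + 1) u) = I (i + 2) u" "I (i + 1) (I i u) = - I (i + 2) u" by (fact *)+
  show "I (i + 1) (I (i + 2) u) = I i u" "I (i + 2) (I (i + 1) u) = - I i u"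
    using *[of "i + 1" u] by (simp_all only: index3_shift)
  show "I (i + 2) (I i u) = I (i + 1) u" "I i (I (i + 2) u) = - I (i + 1) u"
    using *[of "i + 2" u] by (simp_all only: index3_shift)
qed

lemma quat_mult_numerals:
  "I 1 (I 2 u) = I 3 u" "I 2 (I 1 u) = - I 3 u" "I 2 (I 3 u) = I 1 u" "I 3 (I 2 u) = - I 1 u"
  "I 3 (I 1 u) = I 2 u" "I 1 (I 3 u) = - I 2 u"
  using quat_mult[of 1 u] by simp_all

text \<open>\<open>I\<^sub>i\<close> and \<open>- I\<^sub>i\<close> are the products of the other two endomorphisms in the two orders, which have the
  same trace.\<close>

lemma quat_trace: "endo_trace (I i) = 0"
proof -
  have "I i = I (i + 1) \<circ> I (i + 2)" "(\<lambda>u. - I i u) = I (i + 2) \<circ> I (i + 1)"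
    using quat_mult[of i] by (auto simp: fun_eq_iff)
  then have "endo_trace (I i) = endo_trace (\<lambda>u. - I i u)"
    using endo_trace_commute[OF quat_linear quat_linear] by metis
  then show ?thesis by (simp add: endo_trace_minus)
qed

lemma quat_trace_mult: "endo_trace (I i \<circ> I j) = (if i = j then - real DIM('e) else 0)"
proof -
  have "I i \<circ> I i = (\<lambda>u. - u)" "I i \<circ> I (i + 1) = I (i + 2)" "I i \<circ> I (i + 2) = (\<lambda>u. - I (i + 1) u)"
    using quat_mult[of i] quat_sq by (auto simp: fun_eq_iff)
  note mult = this
  consider "j = i" | "j = i + 1" | "j = i + 2" using exhaust_3[of i] exhaust_3[of j] by auto
  then show ?thesis
  proof cases
    case 1
    then show ?thesis using endo_trace_minus[of "\<lambda>u::'e. u"] mult(1) by (simp add: endo_trace_id)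
  next
    case 2
    then have "i \<noteq> j" using exhaust_3[of i] by auto
    with 2 show ?thesis using mult(2) by (simp add: quat_trace)
  next
    case 3
    then have "i \<noteq> j" using exhaust_3[of i] by auto
    with 3 show ?thesis using mult(3) endo_trace_minus[of "I (i + 1)"] by (simp add: quat_trace)
  qed
qed

lemma linear_qcomb: "linear (qcomb a I)"
  by (rule linearI) (simp_all add: qcomb_def linear_add[OF quat_linear] linear_cmul[OF quat_linear]
      scaleR_add_right sum.distrib scaleR_sum_right mult.commute)

lemma trace_qcomb: "endo_trace (qcomb a I \<circ> qcomb b I) = - DIM('e) * (a \<bullet> b)"
proof -
  have "qcomb a I \<circ> qcomb b I = (\<lambda>u. \<Sum>i\<in>UNIV. \<Sum>j\<in>UNIV. (a $ i * b $ j) *\<^sub>R (I i \<circ> I j) u)"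
    by (simp add: fun_eq_iff qcomb_def linear_sum[OF quat_linear] linear_cmul[OF quat_linear]
        scaleR_sum_right)
  then have "endo_trace (qcomb a I \<circ> qcomb b I) =
      (\<Sum>i\<in>UNIV. \<Sum>j\<in>UNIV. (a $ i * b $ j) * endo_trace (I i \<circ> I j))"
    by (simp only: endo_trace_sum endo_trace_scaleR)
  also have "\<dots> = (\<Sum>i\<in>UNIV. \<Sum>j\<in>UNIV. if i = j then - real DIM('e) * (a $ i * b $ j) else 0)"
    by (intro sum.cong refl) (simp add: quat_trace_mult)
  also have "\<dots> = - DIM('e) * (a \<bullet> b)"
    by (simp add: sum.delta' inner_vec_def sum_distrib_left sum_negf)
  finally show ?thesis .
qed

lemma qcomb_coefficient: "a $ i = - endo_trace (qcomb a I \<circ> I i) / DIM('e)"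
  using trace_qcomb[of a "axis i 1"] by (simp add: qcomb_axis inner_axis)

lemma qcomb_inject: "qcomb a I = qcomb b I \<longleftrightarrow> a = b"
proof
  assume eq: "qcomb a I = qcomb b I"
  have "a $ i = b $ i" for i
    using qcomb_coefficient[of a i] qcomb_coefficient[of b i] by (simp only: eq)
  then show "a = b" by (simp add: vec_eq_iff)
qed simp

lemma quat_span_eqI:
  assumes "S \<in> quat_span I" "T \<in> quat_span I" "\<And>i. endo_trace (S \<circ> I i) = endo_trace (T \<circ> I i)"
  shows "S = T"
proof -
  obtain s t where st: "S = qcomb s I" "T = qcomb t I" using assms(1,2) by (auto simp: quat_span_eq)
  have "s $ i = t $ i" for i
    using assms(3)[of i] qcomb_coefficient[of s i] qcomb_coefficient[of t i]
    by (simp only: st)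
  then have "s = t" by (simp add: vec_eq_iff)
  then show ?thesis by (simp add: st)
qed

lemma qcomb_mult:
  "qcomb a I (qcomb b I u) = - (a \<bullet> b) *\<^sub>R u + qcomb (vector
     [a $ 2 * b $ 3 - a $ 3 * b $ 2, a $ 3 * b $ 1 - a $ 1 * b $ 3, a $ 1 * b $ 2 - a $ 2 * b $ 1]) I u"
  by (simp add: qcomb_def sum_3 linear_add[OF quat_linear] linear_cmul[OF quat_linear] quat_sq
      quat_mult_numerals inner_vec_def algebra_simps)

end

context
  fixes I J :: "3 \<Rightarrow> 'e::euclidean_space \<Rightarrow> 'e"
  assumes I: "quaternion_triple I" and J: "quaternion_triple J" and JI: "\<And>i. J i \<in> quat_span I"
begin

text \<open>Two quaternion triples with the same span differ by a rotation: the trace form shows that the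
  rows of the transition matrix are orthonormal, and by \<open>J\<^sub>1 J\<^sub>2 = J\<^sub>3\<close> the third row is the cross
  product of the first two.\<close>

lemma quat_rotation:
  obtains a :: "real^3^3" where "\<And>i. J i = qcomb (a $ i) I" "a ** transpose a = mat 1" "det a = 1"
proof -
  have "\<forall>i. \<exists>a. J i = qcomb a I" using JI by (auto simp: quat_span_eq)
  then obtain f where f: "\<And>i. J i = qcomb (f i) I" by metis
  define a :: "real^3^3" where "a = (\<chi> i. f i)"
  have Ja: "J i = qcomb (a $ i) I" for i using f by (simp add: a_def)
  have tr: "endo_trace (J i \<circ> J j) = (if i = j then - real DIM('e) else 0)" for i j
    by (rule quat_trace_mult[OF J])
  have J12: "J 1 (J 2 u) = J 3 u" for u by (rule quat_mult_numerals[OF J])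
  have orth: "a $ i \<bullet> a $ j = (if i = j then 1 else 0)" for i j
    using trace_qcomb[OF I, of "a $ i" "a $ j"] tr[of i j] by (auto simp flip: Ja split: if_splits)
  have "a ** transpose a = mat 1"
    using orth by (simp add: vec_eq_iff matrix_matrix_mult_def transpose_def mat_def inner_vec_def)
  moreover have "det a = 1"
  proof -
    let ?c = "vector [a $ 1 $ 2 * a $ 2 $ 3 - a $ 1 $ 3 * a $ 2 $ 2,
        a $ 1 $ 3 * a $ 2 $ 1 - a $ 1 $ 1 * a $ 2 $ 3, a $ 1 $ 1 * a $ 2 $ 2 - a $ 1 $ 2 * a $ 2 $ 1] :: real^3"
    have "qcomb (a $ 3) I u = qcomb ?c I u" for u
      using qcomb_mult[OF I, of "a $ 1" "a $ 2" u] J12[of u] orth[of 1 2] by (simp flip: Ja)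
    then have "a $ 3 = ?c" using qcomb_inject[OF I] by blast
    then have "1 = a $ 3 \<bullet> ?c" using orth[of 3 3] by simp
    then show ?thesis by (simp add: det_3 inner_vec_def sum_3 algebra_simps)
  qed
  ultimately show ?thesis using that Ja by blast
qed

lemma quat_span_basis_change:
  shows "quat_span J = quat_span I"
proof -
  obtain a :: "real^3^3" where a: "\<And>i. J i = qcomb (a $ i) I" "a ** transpose a = mat 1" "det a = 1"
    using quat_rotation by metis
  have J_comb: "qcomb b J = qcomb (b v* a) I" for b
  proof
    fix u
    have "qcomb b J u = (\<Sum>i\<in>UNIV. \<Sum>j\<in>UNIV. (b $ i * a $ i $ j) *\<^sub>R I j u)"
      by (simp add: qcomb_def[of b] a(1) scaleR_sum_right) (simp add: qcomb_def scaleR_sum_right)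
    also have "\<dots> = (\<Sum>j\<in>UNIV. (\<Sum>i\<in>UNIV. b $ i * a $ i $ j) *\<^sub>R I j u)"
      by (subst sum.swap) (simp add: scaleR_sum_left)
    finally show "qcomb b J u = qcomb (b v* a) I u"
      by (simp add: qcomb_def vector_matrix_mult_def mult.commute)
  qed
  have "transpose a ** a = mat 1" using a(2) matrix_left_right_inverse by blast
  then have "qcomb b I = qcomb (b v* transpose a) J" for b
    by (simp only: J_comb vector_matrix_mul_assoc vector_matrix_mul_rid)
  then show ?thesis unfolding quat_span_eq using J_comb by (metis (no_types, lifting) image_cong rangeE rangeI subsetI subset_antisym)
qed

end

section \<open>The curvature of a quaternion-Kaehler manifold at a point\<close>

text \<open>The last but one assumption is what remains at a point of the assumption that the Levi-Civita
  connection preserves the quaternionic structure.\<close>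

locale qk_curvature = inner_form q
  for q :: "'e::euclidean_space \<Rightarrow> 'e \<Rightarrow> real" +
  fixes I :: "3 \<Rightarrow> 'e \<Rightarrow> 'e" and R :: "'e \<Rightarrow> 'e \<Rightarrow> 'e \<Rightarrow> 'e" and n :: nat
  assumes triple: "quaternion_triple I"
    and isometry: "q (I i u) (I i v) = q u v"
    and lin1: "linear (\<lambda>u. R u v w)" and lin2: "linear (\<lambda>v. R u v w)" and lin3: "linear (R u v)"
    and skew: "R u v w = - R v u w"
    and bianchi: "R u v w + R v w u + R w u v = 0"
    and metric_skew: "q (R u v w) z = - q (R u v z) w"
    and pair_sym: "q (R u v w) z = q (R w z u) v"
    and preserves: "(\<lambda>w. R u v (I i w) - I i (R u v w)) \<in> quat_span I"
    and dim: "DIM('e) = 4 * n" "2 \<le> n"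
begin

lemmas I_linear = quat_linear[OF triple] and I_sq = quat_sq[OF triple] and I_mult = quat_mult[OF triple]

lemma I_skew: "q (I i u) v = - q u (I i v)"
  using isometry[of i u "I i v"] by (simp add: I_sq form_simps)

definition Ric :: "'e \<Rightarrow> 'e \<Rightarrow> real" where "Ric v w = endo_trace (\<lambda>u. R u v w)"

text \<open>\<open>\<Sum>\<^sub>i r\<^sub>i(u, v) I\<^sub>i\<close> is the \<open>S\<^sup>2H\<close>-component of \<open>R(u, v)\<close>.\<close>

definition r :: "3 \<Rightarrow> 'e \<Rightarrow> 'e \<Rightarrow> real" where "r i u v = - endo_trace (R u v \<circ> I i) / DIM('e)"

lemma linear_r: "linear (r i u)"
  unfolding r_def comp_def
  by (rule linearI)
    (simp_all add: linear_add[OF lin2] linear_cmul[OF lin2] endo_trace_add endo_trace_scaleR add_divide_distrib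
      diff_divide_distrib)

lemma r_skew: "r i u v = - r i v u"
proof -
  have "R u v \<circ> I i = (\<lambda>w. - (R v u \<circ> I i) w)" using skew[of u v] by (simp add: fun_eq_iff)
  then show ?thesis by (simp only: r_def endo_trace_minus minus_divide_left)
qed

text \<open>The coefficients of \<open>[R(u, v), I\<^sub>i]\<close> are found by taking traces.\<close>

lemma commutator:
  "R u v (I i w) - I i (R u v w) = (2 * r (i + 2) u v) *\<^sub>R I (i + 1) w - (2 * r (i + 1) u v) *\<^sub>R I (i + 2) w"
proof -
  let ?S = "\<lambda>w. R u v (I i w) - I i (R u v w)"
  let ?T = "\<lambda>w. (2 * r (i + 2) u v) *\<^sub>R I (i + 1) w + (- (2 * r (i + 1) u v)) *\<^sub>R I (i + 2) w"
  have "?S = ?T"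
  proof (rule quat_span_eqI[OF triple preserves])
    show "?T \<in> quat_span I" by (intro quat_span_combination quat_span_base)
    fix j
    have S: "endo_trace (?S \<circ> I j) = endo_trace (R u v \<circ> (\<lambda>w. I i (I j w) - I j (I i w)))"
    proof -
      have "endo_trace (?S \<circ> I j) = endo_trace (R u v \<circ> I i \<circ> I j) - endo_trace (I i \<circ> (R u v \<circ> I j))"
        by (simp add: comp_def flip: endo_trace_diff)
      also have "endo_trace (I i \<circ> (R u v \<circ> I j)) = endo_trace (R u v \<circ> I j \<circ> I i)"
        by (rule endo_trace_commute[OF I_linear linear_compose[OF I_linear lin3]])
      finally show ?thesis
        by (simp add: comp_def linear_diff[OF lin3] flip: endo_trace_diff)
    qed
    have T: "endo_trace (?T \<circ> I j) = 2 * r (i + 2) u v * endo_trace (I (i + 1) \<circ> I j)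
        - 2 * r (i + 1) u v * endo_trace (I (i + 2) \<circ> I j)"
      by (simp add: comp_def endo_trace_diff endo_trace_scaleR)
    have tr: "endo_trace (R u v \<circ> (\<lambda>w. c *\<^sub>R I k w)) = - c * (DIM('e) * r k u v)" for c k
      by (simp add: r_def comp_def linear_cmul[OF lin3] endo_trace_scaleR)
    note ix = index3_shift[of i]
    have ne: "i \<noteq> i + 1" "i \<noteq> i + 2" "i + 1 \<noteq> i + 2" using exhaust_3[of i] by auto
    consider "j = i" | "j = i + 1" | "j = i + 2" using exhaust_3[of i] exhaust_3[of j] by auto
    then show "endo_trace (?S \<circ> I j) = endo_trace (?T \<circ> I j)"
    proof cases
      case 1
      then show ?thesis
        unfolding S T quat_trace_mult[OF triple] using ne linear_0[OF lin3]
        by (simp add: endo_trace_def comp_def)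
    next
      case 2
      then have "(\<lambda>w. I i (I j w) - I j (I i w)) = (\<lambda>w. 2 *\<^sub>R I (i + 2) w)"
        using I_mult[of i] by (simp add: scaleR_2)
      then show ?thesis
        unfolding S T quat_trace_mult[OF triple] using ne 2 tr[of 2 "i + 2"] by simp
    next
      case 3
      then have "(\<lambda>w. I i (I j w) - I j (I i w)) = (\<lambda>w. (- 2) *\<^sub>R I (i + 1) w)"
        using I_mult[of i] by (simp add: fun_eq_iff scaleR_2 scaleR_minus_left[of 2])
      then show ?thesis
        unfolding S T quat_trace_mult[OF triple] using ne 3 tr[of "- 2" "i + 1"] by simp
    qed
  qed
  from fun_cong[OF this, of w] show ?thesis by simp
qed

lemma Ric_contraction: "(\<Sum>b\<in>Basis. q (R u (onb b) (onb b)) w) = Ric u w"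
proof -
  have "Ric w u = (\<Sum>b\<in>Basis. q (R (onb b) w u) (onb b))"
    unfolding Ric_def by (rule endo_trace_onb[OF lin1])
  moreover have "Ric u w = (\<Sum>b\<in>Basis. q (R (onb b) u w) (onb b))"
    unfolding Ric_def by (rule endo_trace_onb[OF lin1])
  moreover have "q (R (onb b) u w) (onb b) = q (R u (onb b) (onb b)) w" for b
    using skew[of "onb b" u w] metric_skew[of u "onb b" w "onb b"] by (simp add: form_simps)
  ultimately show ?thesis by simp
qed

lemma Ric_sym: "Ric u w = Ric w u"
proof -
  have "Ric w u = (\<Sum>b\<in>Basis. q (R (onb b) w u) (onb b))"
    unfolding Ric_def by (rule endo_trace_onb[OF lin1])
  also have "\<dots> = (\<Sum>b\<in>Basis. q (R u (onb b) (onb b)) w)"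
    by (intro sum.cong refl) (rule pair_sym)
  finally show ?thesis by (simp add: Ric_contraction)
qed

lemma linear_Ric: "linear (Ric u)"
  unfolding Ric_def
  by (rule linearI) (simp_all add: linear_add[OF lin3] linear_cmul[OF lin3] endo_trace_add endo_trace_scaleR)

text \<open>By the Bianchi identity the trace of \<open>R(u, v) I\<^sub>i\<close> is a contraction of Ricci type of
  \<open>R(u, e) I\<^sub>i e\<close>; moving \<open>I\<^sub>i\<close> to the front gives the Ricci tensor and the other two \<open>r\<^sub>j\<close>.\<close>

lemma r_Ric:
  "real DIM('e) * r i u v = 2 * Ric u (I i v) + 4 * r (i + 2) u (I (i + 1) v) - 4 * r (i + 1) u (I (i + 2) v)"
proof -
  define S where "S = (\<Sum>b\<in>Basis. q (R u (onb b) (I i (onb b))) v)"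
  have "bilinear (\<lambda>x y. q (R u (I i x) y) v)"
    unfolding bilinear_def
    by (auto intro!: linearI simp: linear_add[OF I_linear] linear_cmul[OF I_linear] linear_add[OF lin2]
        linear_cmul[OF lin2] linear_add[OF lin3] linear_cmul[OF lin3] form_simps)
  from sum_onb_isometry[OF this I_linear[of i] isometry[of i] I_sq[of i]]
  have rot: "(\<Sum>b\<in>Basis. q (R u (I i (onb b)) (onb b)) v) = - S"
    by (simp add: I_sq linear_neg[OF lin2] form_simps S_def sum_negf)
  have "endo_trace (R u v \<circ> I i) = (\<Sum>b\<in>Basis. q (R u v (I i (onb b))) (onb b))"
    by (subst endo_trace_onb[OF linear_compose[OF I_linear lin3]]) simp
  also have "\<dots> = (\<Sum>b\<in>Basis. q (R u (onb b) (I i (onb b))) v - q (R u (I i (onb b)) (onb b)) v)"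
  proof (intro sum.cong refl)
    fix b
    let ?e = "onb b"
    have "q (R u v (I i ?e)) ?e = q (R (I i ?e) ?e u) v" by (rule pair_sym)
    also have "R (I i ?e) ?e u = R u ?e (I i ?e) - R u (I i ?e) ?e"
      using bianchi[of "I i ?e" ?e u] skew[of ?e u "I i ?e"] by (simp add: algebra_simps add_eq_0_iff)
    finally show "q (R u v (I i ?e)) ?e = q (R u ?e (I i ?e)) v - q (R u (I i ?e) ?e) v"
      by (simp add: form_simps)
  qed
  also have "\<dots> = 2 * S" by (simp add: sum_subtractf rot) (simp add: S_def)
  finally have "real DIM('e) * r i u v = - 2 * S" by (simp add: r_def)
  moreover have "S = - Ric u (I i v) - 2 * r (i + 2) u (I (i + 1) v) + 2 * r (i + 1) u (I (i + 2) v)"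
  proof -
    have contr: "(\<Sum>b\<in>Basis. r k u (onb b) * q (I j (onb b)) v) = - r k u (I j v)" for j k
    proof -
      have "(\<Sum>b\<in>Basis. r k u (onb b) * q (I j (onb b)) v) =
          - (\<Sum>b\<in>Basis. q (I j v) (onb b) *\<^sub>R r k u (onb b))"
        using I_skew sym[of "I j v"] by (simp add: sum_negf mult.commute)
      then show ?thesis using linear_onb_expansion[OF linear_r] by simp
    qed
    have "q (R u e (I i e)) v = - q (R u e e) (I i v) + 2 * (r (i + 2) u e * q (I (i + 1) e) v)
        - 2 * (r (i + 1) u e * q (I (i + 2) e) v)" for e
    proof -
      have "R u e (I i e) = I i (R u e e) + ((2 * r (i + 2) u e) *\<^sub>R I (i + 1) e - (2 * r (i + 1) u e) *\<^sub>R I (i + 2) e)"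
        using commutator[of u e i e] by (simp add: algebra_simps)
      then show ?thesis by (simp add: form_simps I_skew[of i "R u e e"])
    qed
    then have "S = - (\<Sum>b\<in>Basis. q (R u (onb b) (onb b)) (I i v))
        + 2 * (\<Sum>b\<in>Basis. r (i + 2) u (onb b) * q (I (i + 1) (onb b)) v)
        - 2 * (\<Sum>b\<in>Basis. r (i + 1) u (onb b) * q (I (i + 2) (onb b)) v)"
      unfolding S_def by (simp add: sum.distrib sum_subtractf sum_negf sum_distrib_left)
    then show ?thesis unfolding contr Ric_contraction by simp
  qed
  ultimately show ?thesis by simp
qed

text \<open>The three equations for \<open>T\<^sub>i(u, v) = r\<^sub>i(u, I\<^sub>i v)\<close> form a linear system that is regular
  for \<open>n > 1\<close>.\<close>

lemma r_eq: "r i u v = Ric u (I i v) / (2 * (real n + 2))"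
proof -
  have eq: "real n * r j u (I j w) + r (j + 1) u (I (j + 1) w) + r (j + 2) u (I (j + 2) w) = - Ric u w / 2" for j w
  proof -
    have "real DIM('e) * r j u (I j w) =
        2 * Ric u (- w) + 4 * r (j + 2) u (- I (j + 2) w) - 4 * r (j + 1) u (I (j + 1) w)"
      using r_Ric[of j u "I j w"] I_mult[of j w] by (simp add: I_sq)
    then show ?thesis by (simp add: dim linear_neg[OF linear_r] linear_neg[OF linear_Ric])
  qed
  \<comment> \<open>so that \<open>I\<^sub>i w = v\<close>\<close>
  define w where "w = - I i v"
  let ?x = "r i u (I i w)" and ?y = "r (i + 1) u (I (i + 1) w)" and ?z = "r (i + 2) u (I (i + 2) w)"
  have e: "real n * ?x + ?y + ?z = - Ric u w / 2" "real n * ?y + ?z + ?x = - Ric u w / 2"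
    "real n * ?z + ?x + ?y = - Ric u w / 2"
    using eq[of i w] eq[of "i + 1" w] eq[of "i + 2" w] by (simp_all only: index3_shift)
  have "(real n - 1) * (?x - ?y) = 0" "(real n - 1) * (?x - ?z) = 0"
    using e by (simp_all add: algebra_simps)
  then have "?y = ?x" "?z = ?x" using dim(2) by auto
  then have "(real n + 2) * ?x = - Ric u w / 2" using e(1) by (simp add: algebra_simps)
  moreover have "I i w = v" by (simp add: w_def linear_neg[OF I_linear] I_sq)
  ultimately have "(real n + 2) * r i u v = Ric u (I i v) / 2"
    by (simp add: w_def linear_neg[OF linear_Ric])
  then show ?thesis by (simp add: field_simps)
qed

definition ric_endo :: "'e \<Rightarrow> 'e" where "ric_endo v = (THE z. \<forall>w. q z w = Ric v w)"

lemma ric_endo: "q (ric_endo v) w = Ric v w"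
  using theI'[OF riesz[OF linear_Ric]] unfolding ric_endo_def by blast

lemma ric_endo_commute: "I i (ric_endo u) = ric_endo (I i u)"
proof (rule form_eqI)
  fix v
  have "Ric x y = 2 * (real n + 2) * (Ric x y / (2 * (real n + 2)))" for x y by simp
  then have "Ric u (I i v) = - Ric v (I i u)"
    using r_skew[of i u v] unfolding r_eq by (metis mult_minus_right)
  then show "q (I i (ric_endo u)) v = q (ric_endo (I i u)) v"
    using Ric_sym[of v] by (simp add: I_skew ric_endo)
qed

text \<open>The endomorphism \<open>E = \<Sum>\<^sub>a R(e\<^sub>a, I\<^sub>1 e\<^sub>a)\<close> is by the above a nonzero multiple of
  \<open>I\<^sub>1 \<circ> Ric\<close>.  Its commutator with \<open>I\<^sub>2\<close>, a multiple of \<open>I\<^sub>3 \<circ> Ric\<close>, is in the span of the \<open>I\<^sub>i\<close>.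
  A symmetric endomorphism of this kind is a multiple of the identity.\<close>

lemma einstein: "\<exists>l. \<forall>v. ric_endo v = l *\<^sub>R v"
proof -
  define E where "E w = (\<Sum>b\<in>Basis. R (onb b) (I 1 (onb b)) w)" for w
  define k where "k = real DIM('e) / (2 * (real n + 2))"
  have k: "k > 0" using dim by (simp add: k_def)
  have "E w = (- k) *\<^sub>R I 1 (ric_endo w)" for w
  proof (rule form_eqI)
    fix z
    have "q (E w) z = (\<Sum>b\<in>Basis. q (R (onb b) (I 1 (onb b)) w) z)" by (simp add: E_def form_simps)
    also have "\<dots> = (\<Sum>b\<in>Basis. - q ((I 1 \<circ> R w z) (onb b)) (onb b))"
    proof (intro sum.cong refl)
      fix b
      have "q (R (onb b) (I 1 (onb b)) w) z = q (R w z (onb b)) (I 1 (onb b))" by (rule pair_sym)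
      then show "q (R (onb b) (I 1 (onb b)) w) z = - q ((I 1 \<circ> R w z) (onb b)) (onb b)"
        by (simp add: I_skew)
    qed
    also have "\<dots> = - endo_trace (I 1 \<circ> R w z)"
      by (simp add: endo_trace_onb[OF linear_compose[OF lin3 I_linear]] sum_negf)
    also have "\<dots> = - endo_trace (R w z \<circ> I 1)"
      by (simp add: endo_trace_commute[OF I_linear lin3])
    also have "\<dots> = real DIM('e) * r 1 w z" by (simp add: r_def)
    also have "\<dots> = k * q (ric_endo w) (I 1 z)" by (simp add: k_def ric_endo r_eq)
    finally show "q (E w) z = q ((- k) *\<^sub>R I 1 (ric_endo w)) z" by (simp add: form_simps I_skew)
  qed
  then have "E (I 2 w) - I 2 (E w) = (- 2 * k) *\<^sub>R I 3 (ric_endo w)" for w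
    using quat_mult_numerals[OF triple, of "ric_endo w"]
    by (simp add: linear_cmul[OF I_linear] linear_neg[OF I_linear] flip: ric_endo_commute)
      (simp add: algebra_simps flip: scaleR_2)
  moreover have "(\<lambda>w. E (I 2 w) - I 2 (E w)) \<in> quat_span I"
  proof -
    have "(\<lambda>w. \<Sum>b\<in>Basis. 1 *\<^sub>R (R (onb b) (I 1 (onb b)) (I 2 w) - I 2 (R (onb b) (I 1 (onb b)) w)))
        \<in> quat_span I" by (rule quat_span_sum) (rule preserves)
    then show ?thesis by (simp add: E_def linear_sum[OF I_linear] sum_subtractf)
  qed
  ultimately have "(\<lambda>w. (- 2 * k) *\<^sub>R I 3 (ric_endo w)) \<in> quat_span I" by simp
  from quat_span_combination[OF this quat_span_zero, of "- 1 / (2 * k)" 0]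
  have "(\<lambda>w. I 3 (ric_endo w)) \<in> quat_span I" using k by simp
  then obtain c :: "real^3" where c: "\<And>w. I 3 (ric_endo w) = (\<Sum>i\<in>UNIV. c $ i *\<^sub>R I i w)"
    unfolding quat_span_def by (auto simp: fun_eq_iff)
  have ric: "ric_endo w = c $ 3 *\<^sub>R w - c $ 1 *\<^sub>R I 2 w + c $ 2 *\<^sub>R I 1 w" for w
  proof -
    have "ric_endo w = - I 3 (I 3 (ric_endo w))" by (simp add: I_sq)
    also have "\<dots> = c $ 3 *\<^sub>R w - c $ 1 *\<^sub>R I 2 w + c $ 2 *\<^sub>R I 1 w"
      by (simp add: c sum_3 linear_add[OF I_linear] linear_cmul[OF I_linear]
          quat_mult_numerals[OF triple] I_sq)
    finally show ?thesis .
  qed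
  have "ric_endo w = c $ 3 *\<^sub>R w" for w
  proof (rule form_eqI)
    fix z
    have "q (ric_endo w) z = q (ric_endo z) w" using Ric_sym by (simp add: ric_endo)
    then have "- c $ 1 * q (I 2 w) z + c $ 2 * q (I 1 w) z = - (- c $ 1 * q (I 2 w) z + c $ 2 * q (I 1 w) z)"
      using I_skew sym[of z] unfolding ric by (simp add: form_simps)
    then show "q (ric_endo w) z = q (c $ 3 *\<^sub>R w) z" unfolding ric by (simp add: form_simps)
  qed
  then show ?thesis by blast
qed

theorem curvature_S2H:
  obtains \<nu> where "\<And>i u v. r i u v = \<nu> * q u (I i v)"
    "endo_trace ric_endo \<noteq> 0 \<Longrightarrow> \<nu> \<noteq> 0"
proof -
  obtain l where l: "\<And>v. ric_endo v = l *\<^sub>R v" using einstein by blast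
  have "Ric u v = l * q u v" for u v using ric_endo[of u v] by (simp add: l form_simps)
  then have "r i u v = l / (2 * (real n + 2)) * q u (I i v)" for i u v by (simp add: r_eq)
  moreover have "endo_trace ric_endo = 0" if "l = 0"
    using that by (simp add: endo_trace_def l)
  ultimately show ?thesis using that[of "l / (2 * (real n + 2))"] by auto
qed

end

section \<open>Projection to the quaternionic endomorphisms\<close>

lemma S2H_component:
  fixes I :: "3 \<Rightarrow> 'e::euclidean_space \<Rightarrow> 'e"
  assumes I: "quaternion_triple I" and Q: "Q c x = quat_span I" and T: "linear T"
  shows "S2H_component Q c x T \<in> Q c x"
    and "J \<in> Q c x \<Longrightarrow> endo_trace (S2H_component Q c x T \<circ> J) = endo_trace (T \<circ> J)"
proof -
  define S where "S = qcomb (\<chi> i. - endo_trace (T \<circ> I i) / DIM('e)) I"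
  have S: "S \<in> quat_span I" by (auto simp: S_def quat_span_eq)
  have SI: "endo_trace (S \<circ> I i) = endo_trace (T \<circ> I i)" for i
    using trace_qcomb[OF I, of "\<chi> i. - endo_trace (T \<circ> I i) / DIM('e)" "axis i 1"]
    by (simp add: S_def qcomb_axis inner_axis)
  have lin: "linear S" unfolding S_def by (rule linear_qcomb[OF I])
  have SJ: "endo_trace (S \<circ> J) = endo_trace (T \<circ> J)" if JI: "J \<in> quat_span I" for J
  proof -
    obtain a :: "real^3" where J: "J = (\<lambda>u. \<Sum>i\<in>UNIV. a $ i *\<^sub>R I i u)"
      using JI by (auto simp: quat_span_def)
    have "endo_trace (F \<circ> J) = (\<Sum>i\<in>UNIV. a $ i * endo_trace (F \<circ> I i))" if "linear F" for F
      by (simp add: J comp_def linear_sum[OF that] linear_cmul[OF that] endo_trace_sum endo_trace_scaleR)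
    then show ?thesis using lin T SI by simp
  qed
  have "S2H_component Q c x T = S"
    unfolding S2H_component_def Q
  proof (rule the_equality)
    show "S \<in> quat_span I \<and> (\<forall>J\<in>quat_span I. endo_trace (T \<circ> J) = endo_trace (S \<circ> J))"
      using S SJ by simp
    fix S' assume "S' \<in> quat_span I \<and> (\<forall>J\<in>quat_span I. endo_trace (T \<circ> J) = endo_trace (S' \<circ> J))"
    then show "S' = S"
      using S SI by (intro quat_span_eqI[OF I]) (auto simp: quat_span_base)
  qed
  then show "S2H_component Q c x T \<in> Q c x"
    and "J \<in> Q c x \<Longrightarrow> endo_trace (S2H_component Q c x T \<circ> J) = endo_trace (T \<circ> J)"
    using S SJ by (simp_all add: Q)
qed

lemma S2H_coords:
  fixes I :: "3 \<Rightarrow> 'e::euclidean_space \<Rightarrow> 'e"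
  assumes I: "quaternion_triple I" and S: "S \<in> quat_span I"
  shows "S2H_coords I S $ i = - endo_trace (S \<circ> I i) / DIM('e)"
proof -
  obtain a where a: "S = qcomb a I" using S by (auto simp: quat_span_eq)
  have "S2H_coords I S = a"
    unfolding S2H_coords_def
  proof (rule the_equality)
    show "\<forall>u. S u = (\<Sum>i\<in>UNIV. a $ i *\<^sub>R I i u)" by (simp add: a qcomb_def)
    fix b assume "\<forall>u. S u = (\<Sum>i\<in>UNIV. b $ i *\<^sub>R I i u)"
    then have "qcomb a I = qcomb b I" by (auto simp: a qcomb_def fun_eq_iff)
    then show "b = a" using qcomb_inject[OF I, of a b] by simp
  qed
  then show ?thesis using qcomb_coefficient[OF I, of a i] by (simp add: a)
qed

section \<open>The derivative of the moment map\<close>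

lemma smooth_on_endo_trace:
  fixes S T :: "'a::real_normed_vector \<Rightarrow> 'e::euclidean_space \<Rightarrow> 'e"
  assumes "open W" "\<And>v. smooth_on W (\<lambda>y. S y v)" "\<And>v. smooth_on W (\<lambda>y. T y v)"
    "\<And>y. y \<in> W \<Longrightarrow> linear (S y)"
  shows "smooth_on W (\<lambda>y. endo_trace (S y \<circ> T y))"
proof -
  have "smooth_on W (\<lambda>y. S y (T y b))" for b
    by (rule smooth_on_linear_family[of W S]) (rule assms, assumption?)+
  then show ?thesis
    unfolding endo_trace_def comp_def
    by (intro smooth_on_sum smooth_on_inner assms(1) smooth_on_const)
qed

locale qk_frame = chart_metric g c W
  for g :: "('m, 'e::euclidean_space) metric" and c :: "('m, 'e) chart" and W :: "'e set" +
  fixes Q :: "('m, 'e) end_bundle" and I :: "'e \<Rightarrow> 3 \<Rightarrow> 'e \<Rightarrow> 'e" and n :: nat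
  assumes smooth_I: "smooth_on W (\<lambda>y. I y i v)"
    and triple: "y \<in> W \<Longrightarrow> quaternion_triple (I y)"
    and isometry: "y \<in> W \<Longrightarrow> g c y (I y i u) (I y i v) = g c y u v"
    and Q_span: "y \<in> W \<Longrightarrow> Q c y = quat_span (I y)"
    and parallel: "y \<in> W \<Longrightarrow> nabla_end g c (\<lambda>z. I z i) y u \<in> Q c y"
    and dim: "DIM('e) = 4 * n" "2 \<le> n"
begin

lemma smooth_endo_I: "smooth_endo W (\<lambda>y. I y i)"
  unfolding smooth_endo_def using open_U smooth_I quat_linear[OF triple] by auto

text \<open>By the product rule: the coefficients with respect to the frame are traces, hence smooth.\<close>

lemma nabla_in_Q:
  assumes S: "smooth_endo W S" and SQ: "\<And>y. y \<in> W \<Longrightarrow> S y \<in> Q c y" and x: "x \<in> W"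
  shows "cov S x u \<in> Q c x"
proof -
  have Sv: "smooth_on W (\<lambda>y. S y v)" and lin: "\<And>y. y \<in> W \<Longrightarrow> linear (S y)" for v
    using S by (simp_all add: smooth_endo_def)
  define a where "a i y = - endo_trace (S y \<circ> I y i) / DIM('e)" for i y
  have sa: "smooth_on W (a i)" for i
    unfolding a_def
    by (intro smooth_on_divide smooth_on_minus smooth_on_endo_trace open_U Sv smooth_I lin smooth_on_const)
      (assumption | simp)+
  have Sa: "S y v = (\<Sum>i\<in>UNIV. a i y *\<^sub>R I y i v)" if y: "y \<in> W" for y v
  proof -
    obtain b where b: "S y = qcomb b (I y)" using SQ[OF y] Q_span[OF y] by (auto simp: quat_span_eq)
    then have "a i y = b $ i" for i using qcomb_coefficient[OF triple[OF that], of b i] by (simp add: a_def)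
    then show ?thesis by (simp add: b qcomb_def)
  qed
  note da = smooth_on_differentiable[OF sa x] and dI = smooth_endo_diff[OF smooth_endo_I x]
  have pdS: "pd (\<lambda>y. S y v) x u = (\<Sum>i\<in>UNIV. a i x *\<^sub>R pd (\<lambda>y. I y i v) x u + pd (a i) x u *\<^sub>R I x i v)" for v
  proof -
    have "pd (\<lambda>y. S y v) x u = pd (\<lambda>y. \<Sum>i\<in>UNIV. a i y *\<^sub>R I y i v) x u"
      by (rule pd_cong[OF open_U x smooth_endo_diff[OF S x] Sa])
    also have "\<dots> = (\<Sum>i\<in>UNIV. pd (\<lambda>y. a i y *\<^sub>R I y i v) x u)"
      by (rule pd_sum) (intro differentiable_scaleR da dI)
    also have "\<dots> = (\<Sum>i\<in>UNIV. a i x *\<^sub>R pd (\<lambda>y. I y i v) x u + pd (a i) x u *\<^sub>R I x i v)"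
      by (intro sum.cong refl pd_bilinear[OF bounded_bilinear_scaleR da dI])
    finally show ?thesis .
  qed
  note lG = linear_christoffel(1)[OF x, of u]
  have eq: "cov S x u v = (\<Sum>i\<in>UNIV. a i x *\<^sub>R cov (\<lambda>y. I y i) x u v) + (\<Sum>i\<in>UNIV. pd (a i) x u *\<^sub>R I x i v)" for v
    unfolding nabla_end_def pdS Sa[OF x]
    by (simp add: linear_sum[OF lG] linear_cmul[OF lG] sum.distrib sum_subtractf algebra_simps)
  have "(\<lambda>v. 1 *\<^sub>R (\<Sum>i\<in>UNIV. a i x *\<^sub>R cov (\<lambda>y. I y i) x u v) + 1 *\<^sub>R (\<Sum>i\<in>UNIV. pd (a i) x u *\<^sub>R I x i v))
      \<in> quat_span (I x)"
    using parallel[OF x] quat_span_base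
    by (intro quat_span_combination quat_span_sum) (auto simp: Q_span[OF x])
  moreover have "cov S x u = (\<lambda>v. 1 *\<^sub>R (\<Sum>i\<in>UNIV. a i x *\<^sub>R cov (\<lambda>y. I y i) x u v)
      + 1 *\<^sub>R (\<Sum>i\<in>UNIV. pd (a i) x u *\<^sub>R I x i v))"
    unfolding scaleR_one by (rule ext, rule eq)
  ultimately show ?thesis by (simp only: Q_span[OF x])
qed

text \<open>The commutator \<open>[R(u, v), I\<^sub>i]\<close> is the difference of two second covariant derivatives of \<open>I\<^sub>i\<close>, and
  these stay in the bundle.\<close>

lemma curvature_preserves:
  assumes x: "x \<in> W"
  shows "(\<lambda>w. R x u v (I x i w) - I x i (R x u v w)) \<in> quat_span (I x)"
proof -
  have "cov (\<lambda>y. cov (\<lambda>y. I y i) y v) x u \<in> quat_span (I x)" for u v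
    using nabla_in_Q[OF smooth_endo_nabla[OF smooth_endo_I] parallel x] Q_span[OF x] by simp
  from quat_span_combination[OF this[of v u] this[of u v], of 1 "- 1"] show ?thesis
    using ricci_identity_endo[OF smooth_endo_I x, of i v u] by simp
qed

lemma qk_curvature_at:
  assumes x: "x \<in> W" shows "qk_curvature (g c x) (I x) (R x) n"
  by (intro qk_curvature.intro qk_curvature_axioms.intro form[OF x] triple[OF x] isometry[OF x]
      linear_curvature[OF x] curvature_preserves[OF x] dim)
    (rule curvature_skew first_bianchi[OF x] curvature_metric_skew[OF x] curvature_pair_sym[OF x])+

lemma curvature_trace:
  assumes x: "x \<in> W" and scal: "scalar_curvature g c x \<noteq> 0"
  obtains \<nu> where "\<nu> \<noteq> 0" "\<And>i u v. endo_trace (R x u v \<circ> I x i) = \<nu> * g c x u (I x i v)"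
proof -
  interpret qk: qk_curvature "g c x" "I x" "R x" n by (rule qk_curvature_at[OF x])
  obtain \<nu> where \<nu>: "\<And>i u v. qk.r i u v = \<nu> * g c x u (I x i v)" "endo_trace qk.ric_endo \<noteq> 0 \<Longrightarrow> \<nu> \<noteq> 0"
    using qk.curvature_S2H by metis
  have "endo_trace qk.ric_endo = scalar_curvature g c x"
    by (simp add: scalar_curvature_def ricci_def endo_trace_def[of qk.ric_endo] qk.ric_endo_def qk.Ric_def)
      (simp add: endo_trace_def)
  then have "- real DIM('e) * \<nu> \<noteq> 0" using scal \<nu>(2) by simp
  moreover have "endo_trace (R x u v \<circ> I x i) = - real DIM('e) * \<nu> * g c x u (I x i v)" for i u v
    using \<nu>(1)[of i u v] by (simp add: qk.r_def field_simps)
  ultimately show ?thesis using that by blast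
qed

text \<open>By Kostant's formula the derivative of the \<open>S\<^sup>2H\<close>-component of \<open>\<nabla>X\<close> is the \<open>S\<^sup>2H\<close>-component
  of \<open>R(u, X)\<close>, hence a multiple of \<open>\<Sum>\<^sub>i \<langle>X, I\<^sub>i u\<rangle> I\<^sub>i\<close>.\<close>

lemma nabla_moment:
  assumes x: "x \<in> W" and scal: "scalar_curvature g c x \<noteq> 0" and k: "k \<noteq> 0"
    and X: "smooth_on W X"
    and killing: "\<And>y v w. y \<in> W \<Longrightarrow> g c y (nabla_vec g c X y v) w = - g c y v (nabla_vec g c X y w)"
    and S: "smooth_endo W S" "\<And>y. y \<in> W \<Longrightarrow> S y \<in> Q c y"
    and trace: "\<And>y J. y \<in> W \<Longrightarrow> J \<in> Q c y \<Longrightarrow> endo_trace (S y \<circ> J) = k * endo_trace (nabla_vec g c X y \<circ> J)"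
  obtains l where "l \<noteq> 0" "\<And>u J. J \<in> Q c x \<Longrightarrow> endo_trace (cov S x u \<circ> J) = l * g c x (X x) (J u)"
proof -
  obtain \<nu> where \<nu>: "\<nu> \<noteq> 0" "\<And>i u v. endo_trace (R x u v \<circ> I x i) = \<nu> * g c x u (I x i v)"
    using curvature_trace[OF x scal] by metis
  let ?N = "nabla_vec g c X"
  have N: "smooth_endo W ?N" by (rule smooth_endo_nabla_vec[OF open_U order_refl X])
  have base: "endo_trace (cov S x u \<circ> I x i) = (- k * \<nu>) * g c x (X x) (I x i u)" for i u
  proof -
    have IQ: "I y i \<in> Q c y" if "y \<in> W" for y using that by (simp add: Q_span quat_span_base)
    have dif: "(\<lambda>y. endo_trace (T y \<circ> I y i)) differentiable (at x)" if "smooth_endo W T" for T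
      using that x smooth_I open_U unfolding smooth_endo_def
      by (intro smooth_on_differentiable[OF smooth_on_endo_trace]) auto
    have "pd (\<lambda>y. endo_trace (S y \<circ> I y i)) x u = pd (\<lambda>y. k * endo_trace (?N y \<circ> I y i)) x u"
      by (rule pd_cong[OF open_U x dif[OF S(1)]]) (simp add: trace IQ)
    also have "\<dots> = k * pd (\<lambda>y. endo_trace (?N y \<circ> I y i)) x u"
      by (rule pd_bounded_linear[OF bounded_linear_mult_right dif[OF N]])
    finally have "endo_trace (cov S x u \<circ> I x i) + endo_trace (S x \<circ> cov (\<lambda>y. I y i) x u) =
        k * (endo_trace (cov ?N x u \<circ> I x i) + endo_trace (?N x \<circ> cov (\<lambda>y. I y i) x u))"
      by (simp only: pd_endo_trace[OF S(1) smooth_endo_I x] pd_endo_trace[OF N smooth_endo_I x])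
    then have "endo_trace (cov S x u \<circ> I x i) = k * endo_trace (cov ?N x u \<circ> I x i)"
      using trace[OF x parallel[OF x]] by (simp add: algebra_simps)
    also have "cov ?N x u \<circ> I x i = (\<lambda>w. - (R x (X x) u \<circ> I x i) w)"
      using kostant[OF open_U order_refl X x killing] by (simp add: fun_eq_iff)
    finally show ?thesis by (simp only: endo_trace_minus \<nu>(2) mult_minus_right mult_minus_left mult.assoc)
  qed
  have lin: "linear (cov S x u)" for u
    using smooth_endo_nabla[OF S(1)] x by (simp add: smooth_endo_def)
  have "endo_trace (cov S x u \<circ> J) = (- k * \<nu>) * g c x (X x) (J u)" if JQ: "J \<in> Q c x" for J u
  proof -
    obtain a :: "real^3" where J: "J = (\<lambda>u. \<Sum>i\<in>UNIV. a $ i *\<^sub>R I x i u)"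
      using JQ by (auto simp: quat_span_def Q_span[OF x])
    have "endo_trace (cov S x u \<circ> J) = (\<Sum>i\<in>UNIV. a $ i * endo_trace (cov S x u \<circ> I x i))"
      by (simp add: J comp_def linear_sum[OF lin] linear_cmul[OF lin] endo_trace_sum endo_trace_scaleR)
    then show ?thesis unfolding base by (simp add: J fs[OF x] sum_distrib_left algebra_simps)
  qed
  then show ?thesis using that[of "- k * \<nu>"] k \<nu>(1) by auto
qed

end

section \<open>The twistor equation\<close>

text \<open>In terms of \<open>\<phi> = \<langle>X, -\<rangle> \<in> E \<otimes> H\<close>, the form \<open>\<Sum>\<^sub>i (\<phi> \<circ> I\<^sub>i) \<otimes> I\<^sub>i\<close> has the components
  \<open>\<Sum>\<^sub>i (\<tau>\<^sub>i \<phi>)\<^sub>A \<tau>\<^sub>i\<^sub>B\<^sub>C\<close>.  Up to a factor \<open>\<Sum>\<^sub>i \<tau>\<^sub>i \<otimes> \<tau>\<^sub>i\<close> is twice the flip minus the identity, so all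
  terms contain the skew tensor \<open>\<epsilon>\<close> and symmetrization kills them.\<close>

lemma tau_symmetrization:
  fixes t :: "2 \<Rightarrow> complex"
  defines "T \<equiv> \<lambda>A B C. \<Sum>i\<in>UNIV. (- (\<Sum>D\<in>UNIV. tau i A D * t D)) * tau_sym i B C"
  shows "T A B C + T A C B + T B A C + T B C A + T C A B + T C B A = 0"
  using exhaust_2[of A] exhaust_2[of B] exhaust_2[of C]
  by (auto simp: T_def tau_sym_def tau_def eps_def sum_2 sum_3 algebra_simps)

text \<open>The action of \<open>I\<^sub>i\<close> on covectors is given by \<open>\<tau>\<^sub>i\<close> on the coefficients, by the definition of an
  EH coframe.\<close>

lemma EH_coeff_rotated:
  fixes \<theta> :: "nat \<Rightarrow> 2 \<Rightarrow> 'e::euclidean_space \<Rightarrow> complex"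
  assumes \<theta>: "EH_coframe n I \<theta>" and I: "quaternion_triple I" and \<phi>: "linear \<phi>"
  obtains t where "\<And>i a A. a < 2 * n \<Longrightarrow> EH_coeff n \<theta> (\<lambda>u. \<phi> (I i u)) a A = - (\<Sum>D\<in>UNIV. tau i A D * t a D)"
proof -
  have uniq: "\<exists>!t. (\<forall>a\<ge>2*n. \<forall>A. t a A = 0) \<and> (\<forall>u. \<psi> u = (\<Sum>a<2*n. \<Sum>A\<in>UNIV. t a A * \<theta> a A u))"
    if "linear \<psi>" for \<psi>
    using \<theta> that unfolding EH_coframe_def by blast
  obtain t where t: "\<And>u. \<phi> u = (\<Sum>a<2*n. \<Sum>A\<in>UNIV. t a A * \<theta> a A u)"
    using ex1_implies_ex[OF uniq[OF \<phi>]] by blast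
  define s where "s i = (\<lambda>a A. if a < 2*n then - (\<Sum>D\<in>UNIV. tau i A D * t a D) else 0)" for i
  have rep: "\<phi> (I i u) = (\<Sum>a<2*n. \<Sum>B\<in>UNIV. s i a B * \<theta> a B u)" for i u
  proof -
    have "\<phi> (I i u) = (\<Sum>a<2*n. \<Sum>A\<in>UNIV. t a A * \<theta> a A (I i u))" by (rule t)
    also have "\<dots> = (\<Sum>a<2*n. \<Sum>B\<in>UNIV. s i a B * \<theta> a B u)"
    proof (rule sum.cong[OF refl])
      fix a assume a: "a \<in> {..<2*n}"
      then have "\<theta> a A (I i u) = - (\<Sum>B\<in>UNIV. tau i B A * \<theta> a B u)" for A
        using \<theta> unfolding EH_coframe_def by (metis lessThan_iff minus_minus)
      then show "(\<Sum>A\<in>UNIV. t a A * \<theta> a A (I i u)) = (\<Sum>B\<in>UNIV. s i a B * \<theta> a B u)"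
        using a by (simp add: sum_2 s_def) (simp add: algebra_simps)
    qed
    finally show ?thesis .
  qed
  have "EH_coeff n \<theta> (\<lambda>u. \<phi> (I i u)) = s i" for i
    unfolding EH_coeff_def
  proof (rule the1_equality)
    have "linear (\<lambda>u. \<phi> (I i u))" using linear_compose[OF quat_linear[OF I] \<phi>] by (simp add: comp_def)
    from uniq[OF this] show "\<exists>!t. (\<forall>a\<ge>2*n. \<forall>A. t a A = 0) \<and>
        (\<forall>u. \<phi> (I i u) = (\<Sum>a<2*n. \<Sum>A\<in>UNIV. t a A * \<theta> a A u))" .
    show "(\<forall>a\<ge>2*n. \<forall>A. s i a A = 0) \<and> (\<forall>u. \<phi> (I i u) = (\<Sum>a<2*n. \<Sum>A\<in>UNIV. s i a A * \<theta> a A u))"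
      using rep by (auto simp: s_def[of i])
  qed
  then show ?thesis using that[of t] by (simp add: s_def)
qed

lemma twistor_op_zero:
  fixes \<sigma> :: "('m, 'e::euclidean_space) end_field"
  assumes I: "quaternion_triple I" and \<theta>: "EH_coframe n I \<theta>" and a: "a < 2 * n"
    and \<phi>: "linear \<phi>" "\<And>i u. S2H_coords I (nabla_end g c (\<sigma> c) x u) $ i = \<phi> (I i u)"
  shows "twistor_op n g c x I \<theta> \<sigma> a A B C = 0"
proof -
  have "linear (\<lambda>u. complex_of_real (\<phi> u))"
    by (rule linearI) (simp_all add: linear_add[OF \<phi>(1)] linear_cmul[OF \<phi>(1)] scaleR_conv_of_real)
  from EH_coeff_rotated[OF \<theta> I this] obtain t where
    t: "\<And>i a A. a < 2 * n \<Longrightarrow> EH_coeff n \<theta> (\<lambda>u. of_real (\<phi> (I i u))) a A = - (\<Sum>D\<in>UNIV. tau i A D * t a D)"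
    by blast
  show ?thesis
    unfolding twistor_op_def nabla_EHHH_def \<phi>(2) t[OF a] Let_def
    by (subst tau_symmetrization) simp
qed

section \<open>Charts\<close>

lemma atlas_chart:
  assumes "smooth_atlas \<A>" "c \<in> \<A>"
  shows "open (fst c)" "open (chart_image c)"
    "p \<in> fst c \<Longrightarrow> snd c p \<in> chart_image c" "p \<in> fst c \<Longrightarrow> chart_inv c (snd c p) = p"
    "x \<in> chart_image c \<Longrightarrow> chart_inv c x \<in> fst c" "x \<in> chart_image c \<Longrightarrow> snd c (chart_inv c x) = x"
    "continuous_on (chart_image c) (chart_inv c)"
proof -
  have "homeomorphism (fst c) (chart_image c) (snd c) (chart_inv c)"
    and "open (fst c)" "open (chart_image c)"
    using assms by (auto simp: smooth_atlas_def)
  then show "open (fst c)" "open (chart_image c)"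
    "p \<in> fst c \<Longrightarrow> snd c p \<in> chart_image c" "p \<in> fst c \<Longrightarrow> chart_inv c (snd c p) = p"
    "x \<in> chart_image c \<Longrightarrow> chart_inv c x \<in> fst c" "x \<in> chart_image c \<Longrightarrow> snd c (chart_inv c x) = x"
    "continuous_on (chart_image c) (chart_inv c)"
    unfolding homeomorphism_def by blast+
qed

lemma atlas_covers: "smooth_atlas \<A> \<Longrightarrow> \<exists>c\<in>\<A>. p \<in> fst c"
  unfolding smooth_atlas_def by (metis UNIV_I UN_E)

lemma chart_set_eq:
  assumes "smooth_atlas \<A>" "c \<in> \<A>"
  shows "snd c ` (fst c \<inter> V) = {x \<in> chart_image c. chart_inv c x \<in> V}"
  using atlas_chart[OF assms] by (auto simp: image_iff) (metis IntI)

lemma open_chart_set: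
  assumes "smooth_atlas \<A>" "c \<in> \<A>" "open V"
  shows "open (snd c ` (fst c \<inter> V))"
  unfolding chart_set_eq[OF assms(1,2)]
  using continuous_open_preimage[OF atlas_chart(7,2)[OF assms(1,2)] assms(3)]
  by (simp add: vimage_def Int_def)

lemma smooth_map_product_chart:
  fixes \<B> :: "('g::topological_space, 'h::euclidean_space) chart set"
    and \<A> :: "('m::topological_space, 'e::euclidean_space) chart set"
    and \<C> :: "('k::topological_space, 'f::euclidean_space) chart set"
  assumes B: "smooth_atlas \<B>" "b \<in> \<B>" and A: "smooth_atlas \<A>" "c \<in> \<A>" and C: "smooth_atlas \<C>" "d \<in> \<C>"
    and h: "smooth_map (product_atlas \<B> \<A>) \<C> h"
  defines "D \<equiv> {(z, x). z \<in> chart_image b \<and> x \<in> chart_image c \<and> h (chart_inv b z, chart_inv c x) \<in> fst d}"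
  shows "open D" "smooth_on D (\<lambda>(z, x). snd d (h (chart_inv b z, chart_inv c x)))"
proof -
  note bf = atlas_chart[OF B] and cf = atlas_chart[OF A] and df = atlas_chart[OF C]
  let ?U = "chart_image b \<times> chart_image c"
  let ?k = "\<lambda>zx. h (chart_inv b (fst zx), chart_inv c (snd zx))"
  have "continuous_on ?U (\<lambda>zx. (chart_inv b (fst zx), chart_inv c (snd zx)))"
    by (intro continuous_on_Pair continuous_on_compose2[OF bf(7) continuous_on_fst]
        continuous_on_compose2[OF cf(7) continuous_on_snd] continuous_on_id) auto
  then have "continuous_on ?U ?k"
    by (rule continuous_on_compose2[of UNIV h, rotated]) (use h in \<open>auto simp: smooth_map_def\<close>)
  then have "open (?U \<inter> ?k -` fst d)"
    by (rule continuous_open_preimage[OF _ open_Times[OF bf(2) cf(2)] df(1)])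
  also have "?U \<inter> ?k -` fst d = D" by (auto simp: D_def)
  finally show oD: "open D" .
  let ?p = "(fst b \<times> fst c, \<lambda>(p, q). (snd b p, snd c q))"
  have "?p \<in> product_atlas \<B> \<A>" using B(2) A(2) unfolding product_atlas_def by blast
  then have sm: "smooth_on (snd ?p ` {r \<in> fst ?p. h r \<in> fst d}) (in_charts ?p d h)"
    using h C(2) unfolding smooth_map_def by blast
  have "snd ?p ` {r \<in> fst ?p. h r \<in> fst d} = D"
  proof
    show "snd ?p ` {r \<in> fst ?p. h r \<in> fst d} \<subseteq> D"
      using bf(3,4) cf(3,4) by (auto simp: D_def)
    show "D \<subseteq> snd ?p ` {r \<in> fst ?p. h r \<in> fst d}"
    proof clarify
      fix z x assume "(z, x) \<in> D"
      then show "(z, x) \<in> snd ?p ` {r \<in> fst ?p. h r \<in> fst d}"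
        using bf(5,6) cf(5,6) by (intro image_eqI[of _ _ "(chart_inv b z, chart_inv c x)"]) (auto simp: D_def)
    qed
  qed
  with sm have sm: "smooth_on D (in_charts ?p d h)" by simp
  show "smooth_on D (\<lambda>(z, x). snd d (h (chart_inv b z, chart_inv c x)))"
  proof (rule smooth_on_transform[OF oD sm])
    fix zx assume zx: "zx \<in> D"
    obtain z x where e: "zx = (z, x)" by (cases zx)
    have i: "z \<in> chart_image b" "x \<in> chart_image c" using zx by (auto simp: D_def e)
    have "chart_inv ?p (z, x) = (chart_inv b z, chart_inv c x)"
      unfolding chart_inv_def[of ?p]
    proof (rule inv_into_f_eq)
      show "inj_on (snd ?p) (fst ?p)"
        using bf(4) cf(4) by (auto simp: inj_on_def) metis+
    qed (use i bf(5,6) cf(5,6) in auto)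
    then show "(case zx of (z, x) \<Rightarrow> snd d (h (chart_inv b z, chart_inv c x))) = in_charts ?p d h zx"
      by (simp add: e in_charts_def)
  qed
qed

lemma pd_slice_snd:
  assumes "f differentiable (at (z, x))"
  shows "pd (\<lambda>x. f (z, x)) x u = pd f (z, x) (0, u)"
proof -
  have "((\<lambda>x. (z, x)) has_derivative (\<lambda>u. (0, u))) (at x)" by (auto intro!: derivative_eq_intros)
  from has_derivative_compose[OF this has_derivative_frechet[OF assms]] show ?thesis
    using frechet_derivative_eqI by metis
qed

lemma pd_slice_fst:
  assumes "f differentiable (at (z, x))"
  shows "pd (\<lambda>z. f (z, x)) z u = pd f (z, x) (u, 0)"
proof -
  have "((\<lambda>z. (z, x)) has_derivative (\<lambda>u. (u, 0))) (at z)" by (auto intro!: derivative_eq_intros)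
  from has_derivative_compose[OF this has_derivative_frechet[OF assms]] show ?thesis
    using frechet_derivative_eqI by metis
qed

lemma smooth_slice_snd:
  assumes "open D" "smooth_on D f" "open U" "\<And>x. x \<in> U \<Longrightarrow> (z, x) \<in> D"
  shows "smooth_on U (\<lambda>x. f (z, x))"
proof -
  have "bounded_linear (\<lambda>x. (0, x))"
    by (intro bounded_linear_Pair bounded_linear_zero bounded_linear_ident)
  from smooth_on_affine[OF this assms(1,3) _ assms(2), of "(z, 0)"] assms(4) show ?thesis by simp
qed

lemma smooth_slice_fst:
  assumes "open D" "smooth_on D f" "open U" "\<And>z. z \<in> U \<Longrightarrow> (z, x) \<in> D"
  shows "smooth_on U (\<lambda>z. f (z, x))"
proof -
  have "bounded_linear (\<lambda>z. (z, 0))"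
    by (intro bounded_linear_Pair bounded_linear_zero bounded_linear_ident)
  from smooth_on_affine[OF this assms(1,3) _ assms(2), of "(0, x)"] assms(4) show ?thesis by simp
qed

section \<open>The Killing form\<close>

text \<open>In terms of the multiplication \<open>m\<close> in the chart the left invariant field is a partial derivative of
  \<open>m\<close>, so the bracket is a difference of mixed second partial derivatives of \<open>m\<close> at the unit.\<close>

lemma lie_bracket_bilinear:
  fixes \<B> :: "('g::topological_space, 'h::euclidean_space) chart set"
  assumes G: "lie_group G \<B>" and b: "b \<in> \<B>" "\<one>\<^bsub>G\<^esub> \<in> fst b"
  shows "linear (\<lambda>A. lie_bracket G b A B)" "linear (lie_bracket G b A)"
proof -
  interpret group G using G by (simp add: lie_group_def)
  have car: "carrier G = UNIV" and B: "smooth_atlas \<B>"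
    and mult: "smooth_map (product_atlas \<B> \<B>) \<B> (\<lambda>(x, y). x \<otimes>\<^bsub>G\<^esub> y)"
    using G by (simp_all add: lie_group_def)
  define e where "e = snd b \<one>\<^bsub>G\<^esub>"
  define D where "D = {(z, x). z \<in> chart_image b \<and> x \<in> chart_image b \<and> chart_inv b z \<otimes>\<^bsub>G\<^esub> chart_inv b x \<in> fst b}"
  define m where "m = (\<lambda>(z, x). snd b (chart_inv b z \<otimes>\<^bsub>G\<^esub> chart_inv b x))"
  have D: "open D" "smooth_on D m"
    using smooth_map_product_chart[OF B b(1) B b(1) B b(1) mult] by (simp_all add: D_def m_def)
  have eD: "(e, e) \<in> D"
    using atlas_chart(3,4)[OF B b(1) b(2)] b(2) car by (simp add: D_def e_def)
  define N where "N = {y. (y, e) \<in> D}"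
  have "open ((\<lambda>y. (y, e)) -` D)"
    by (rule open_vimage[OF D(1)]) (intro continuous_intros)
  then have N: "open N" by (simp add: N_def vimage_def)
  have eN: "e \<in> N" using eD by (simp add: N_def)
  have field: "left_invariant_field G b A y = pd m (y, e) (0, A)" if "y \<in> N" for A y
    using pd_slice_snd[OF smooth_on_differentiable[OF D(2)], of y e A] that
    by (simp add: left_invariant_field_def N_def e_def m_def)
  have sf: "smooth_on N (\<lambda>y. pd m (y, e) (0, A))" for A
    using smooth_slice_fst[OF D(1) smooth_on_derivative[OF D(2)] N] by (simp add: N_def)
  note df = smooth_on_differentiable[OF sf eN]
  have lin1: "linear (\<lambda>B. pd (\<lambda>y. pd m (y, e) (0, B)) e A)" for A
  proof (rule pd_linear_parameter[OF N eN _ df])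
    fix y assume "y \<in> N"
    then have l: "linear (pd m (y, e))" using smooth_on_linear_derivative[OF D(2)] by (simp add: N_def)
    show "linear (\<lambda>B. pd m (y, e) (0, B))"
      using linear_compose[of "\<lambda>B. (0, B)", OF _ l] by (simp add: comp_def linear_iff)
  qed
  have lin2: "linear (\<lambda>A. pd (\<lambda>y. pd m (y, e) (0, B)) e A)" for B
    by (rule linear_frechet_derivative[OF df])
  have "pd (left_invariant_field G b B) e A = pd (\<lambda>y. pd m (y, e) (0, B)) e A" for A B
    by (rule pd_cong[OF N eN df, symmetric]) (simp add: field)
  then have br: "lie_bracket G b A B = pd (\<lambda>y. pd m (y, e) (0, B)) e A - pd (\<lambda>y. pd m (y, e) (0, A)) e B" for A B
    by (simp add: lie_bracket_def e_def)
  show "linear (\<lambda>A. lie_bracket G b A B)" unfolding br by (rule linear_compose_sub[OF lin2 lin1])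
  show "linear (lie_bracket G b A)" unfolding br by (rule linear_compose_sub[OF lin1 lin2])
qed

lemma inner_form_neg_killing:
  fixes \<B> :: "('g::topological_space, 'h::euclidean_space) chart set"
  assumes G: "lie_group G \<B>" and b: "b \<in> \<B>" "\<one>\<^bsub>G\<^esub> \<in> fst b"
    and pos: "\<And>A. A \<noteq> 0 \<Longrightarrow> neg_killing G b A A > 0"
  shows "inner_form (neg_killing G b)"
proof
  note l1 = lie_bracket_bilinear(1)[OF G b] and l2 = lie_bracket_bilinear(2)[OF G b]
  show "bilinear (neg_killing G b)"
    unfolding bilinear_def neg_killing_def killing_form_def
    by (auto intro!: linearI simp: linear_add[OF l1] linear_cmul[OF l1] linear_add[OF l2] linear_cmul[OF l2]
        endo_trace_add endo_trace_scaleR)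
  show "neg_killing G b A B = neg_killing G b B A" for A B
    using endo_trace_commute[OF l2 l2, of A B] by (simp add: neg_killing_def killing_form_def comp_def)
qed (rule pos)

section \<open>Killing fields of isometric actions\<close>

text \<open>Differentiating the isometry condition along the group at the unit gives Killing's equation;
  Schwarz' theorem exchanges the derivative along the group and the derivative on the manifold.\<close>

lemma (in chart_metric) killing_field:
  fixes f :: "'h::euclidean_space \<times> 'e \<Rightarrow> 'e" and z0 A :: 'h
  assumes D: "open D" "smooth_on D f"
    and unit: "\<And>x. x \<in> U \<Longrightarrow> (z0, x) \<in> D" "\<And>x. x \<in> U \<Longrightarrow> f (z0, x) = x"
    and fU: "\<And>z x. (z, x) \<in> D \<Longrightarrow> f (z, x) \<in> U"
    and isom: "\<And>z x u v. (z, x) \<in> D \<Longrightarrow> g c (f (z, x)) (pd f (z, x) (0, u)) (pd f (z, x) (0, v)) = g c x u v"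
    and x: "x \<in> U"
  defines "X \<equiv> \<lambda>x. pd f (z0, x) (A, 0)"
  shows "g c x (nabla_vec g c X x u) v = - g c x u (nabla_vec g c X x v)"
proof -
  have sX: "smooth_on U X"
    unfolding X_def by (rule smooth_slice_snd[OF D(1) smooth_on_derivative[OF D(2)] open_U unit(1)])
  define Z where "Z = {z. (z, x) \<in> D}"
  have "open ((\<lambda>z. (z, x)) -` D)" by (rule open_vimage[OF D(1)]) (intro continuous_intros)
  then have Z: "open Z" by (simp add: Z_def vimage_def)
  have z0: "z0 \<in> Z" using unit(1)[OF x] by (simp add: Z_def)
  note dfx = smooth_on_differentiable[OF D(2) unit(1)]
  have id: "pd f (z0, y) (0, u) = u" if "y \<in> U" for y u
  proof -
    have "pd f (z0, y) (0, u) = pd (\<lambda>x. f (z0, x)) y u" by (rule pd_slice_snd[OF dfx[OF that], symmetric])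
    also have "\<dots> = pd (\<lambda>x. x) y u"
      using smooth_on_differentiable[OF smooth_slice_snd[OF D open_U unit(1)] that]
      by (rule pd_cong[OF open_U that]) (simp_all add: unit(2))
    finally show ?thesis by simp
  qed
  let ?B = "\<lambda>z. g c (f (z, x))" and ?P = "\<lambda>u z. pd f (z, x) (0, u)"
  have sf: "smooth_on Z (\<lambda>z. f (z, x))"
    by (rule smooth_slice_fst[OF D Z]) (simp add: Z_def)
  have dP: "?P u differentiable (at z0)" for u
    by (rule smooth_on_differentiable[OF smooth_slice_fst[OF D(1) smooth_on_derivative[OF D(2)] Z] z0])
      (simp add: Z_def)
  have hB: "((\<lambda>z. ?B z u v) has_derivative (\<lambda>A. pd (\<lambda>y. g c y u v) x (pd f (z0, x) (A, 0)))) (at z0)" for u v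
  proof -
    have "((\<lambda>z. f (z, x)) has_derivative (\<lambda>A. pd f (z0, x) (A, 0))) (at z0)"
      using smooth_on_has_derivative[OF sf z0] unfolding pd_slice_fst[OF dfx[OF x], abs_def] .
    moreover have "((\<lambda>y. g c y u v) has_derivative pd (\<lambda>y. g c y u v) x) (at (f (z0, x)))"
      using has_derivative_frechet[OF diff_g[OF x]] unit(2)[OF x] by simp
    ultimately show ?thesis by (rule has_derivative_compose)
  qed
  have mixed: "pd (?P u) z0 A = pd X x u" for u
  proof -
    have "pd (?P u) z0 A = pd (\<lambda>w. pd f w (0, u)) (z0, x) (A, 0)"
      by (rule pd_slice_fst[OF smooth_on_differentiable[OF smooth_on_derivative[OF D(2)] unit(1)[OF x]]])
    also have "\<dots> = pd (\<lambda>w. pd f w (A, 0)) (z0, x) (0, u)"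
      by (rule mixed_partials[OF D unit(1)[OF x]])
    also have "\<dots> = pd X x u"
      unfolding X_def
      by (rule pd_slice_snd[OF smooth_on_differentiable[OF smooth_on_derivative[OF D(2)] unit(1)[OF x]], symmetric])
    finally show ?thesis .
  qed
  have "pd (\<lambda>z. ?B z (?P u z) (?P v z)) z0 A =
      pd (\<lambda>z. ?B z (?P u z0) (?P v z0)) z0 A + ?B z0 (pd (?P u) z0 A) (?P v z0) + ?B z0 (?P u z0) (pd (?P v) z0 A)"
    by (rule pd_bilinear_family[OF Z z0 _ differentiableI[OF hB] dP dP])
      (use fU g_bil in \<open>auto simp: Z_def\<close>)
  also have "\<dots> = pd (\<lambda>y. g c y u v) x (X x) + g c x (pd X x u) v + g c x u (pd X x v)"
    using frechet_derivative_eqI[OF hB[of u v]] by (simp add: mixed id[OF x] unit(2)[OF x] X_def)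
  finally have eq: "pd (\<lambda>z. ?B z (?P u z) (?P v z)) z0 A =
      pd (\<lambda>y. g c y u v) x (X x) + g c x (pd X x u) v + g c x u (pd X x v)" .
  have "pd (\<lambda>z. g c x u v) z0 A = pd (\<lambda>z. ?B z (?P u z) (?P v z)) z0 A"
    by (rule pd_cong[OF Z z0 differentiable_const]) (simp add: Z_def isom)
  then have "pd (\<lambda>y. g c y u v) x (X x) + g c x (pd X x u) v + g c x u (pd X x v) = 0"
    by (simp add: eq)
  then have "g c x (\<Gamma> x (X x) u) v + g c x u (\<Gamma> x (X x) v) + g c x (pd X x u) v + g c x u (pd X x v) = 0"
    by (simp add: metric_compatible[OF x])
  then show ?thesis
    by (simp add: nabla_vec_def fs[OF x] christoffel_sym[OF x, of _ "X x"])
qed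

section \<open>The moment map\<close>

locale moment_setup =
  fixes \<A> :: "('m::{t2_space, second_countable_topology}, 'e::euclidean_space) chart set"
    and g :: "('m, 'e) metric"
    and Q :: "('m, 'e) end_bundle"
    and G :: "'g::{t2_space, second_countable_topology} monoid"
    and \<B> :: "('g, 'h::euclidean_space) chart set"
    and b :: "('g, 'h) chart"
    and act :: "'g \<Rightarrow> 'm \<Rightarrow> 'm"
    and \<mu> :: "'h \<Rightarrow> ('m, 'e) end_field"
    and ip :: "'h \<Rightarrow> 'h \<Rightarrow> real"
    and n :: nat
  assumes qk: "quaternion_kaehler n \<A> g Q"
    and scal: "c \<in> \<A> \<Longrightarrow> x \<in> chart_image c \<Longrightarrow> scalar_curvature g c x \<noteq> 0"
    and G: "lie_group G \<B>"
    and b: "b \<in> \<B>" "\<one>\<^bsub>G\<^esub> \<in> fst b"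
    and ip: "inner_form ip"
    and action: "quaternionic_isometric_action G \<B> \<A> g Q act"
    and effective: "infinitesimally_effective G b \<A> act"
    and moment: "moment_map G b \<A> g Q act \<mu>"
begin

lemma atlas: "smooth_atlas \<A>" and metric: "riemannian_metric \<A> g"
  and parallel_Q: "parallel_quaternionic_structure \<A> g Q"
  and dim: "DIM('e) = 4 * n" "2 \<le> n"
  using qk by (simp_all add: quaternion_kaehler_def)

lemma atlas_G: "smooth_atlas \<B>" using G by (simp add: lie_group_def)

lemmas chart = atlas_chart[OF atlas]

abbreviation X :: "'h \<Rightarrow> ('m, 'e) chart \<Rightarrow> 'e \<Rightarrow> 'e" where "X \<equiv> fundamental_field G b act"

lemma chart_metric_on:
  assumes "c \<in> \<A>" "open W" "W \<subseteq> chart_image c" shows "chart_metric g c W"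
proof (rule chart_metric.intro[OF assms(2)])
  have m: "\<forall>x\<in>chart_image c. bilinear (g c x) \<and> (\<forall>u v. g c x u v = g c x v u) \<and> (\<forall>u. u \<noteq> 0 \<longrightarrow> g c x u u > 0)"
    "\<forall>u v. smooth_on (chart_image c) (\<lambda>x. g c x u v)"
    using metric assms(1) by (simp_all add: riemannian_metric_def)
  show "inner_form (g c x)" if "x \<in> W" for x
  proof -
    have "x \<in> chart_image c" using assms(3) that by blast
    then show ?thesis using m(1) unfolding inner_form_def by simp
  qed
  show "smooth_on W (\<lambda>x. g c x u v)" for u v
    by (rule smooth_on_subset[OF m(2)[rule_format] assms(3)])
qed

lemma frame_at:
  assumes c: "c \<in> \<A>" and x: "x \<in> chart_image c"
  obtains W I where "x \<in> W" "W \<subseteq> chart_image c" "qk_frame g c W Q I n"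
proof -
  have "\<forall>c\<in>\<A>. \<forall>x\<in>chart_image c. \<exists>U I. open U \<and> x \<in> U \<and> U \<subseteq> chart_image c \<and>
        (\<forall>i v. smooth_on U (\<lambda>y. I y i v)) \<and>
        (\<forall>y\<in>U. quaternion_triple (I y) \<and> (\<forall>i u v. g c y (I y i u) (I y i v) = g c y u v) \<and>
           Q c y = quat_span (I y) \<and> (\<forall>i u. nabla_end g c (\<lambda>z. I z i) y u \<in> Q c y))"
    using parallel_Q unfolding parallel_quaternionic_structure_def quat_span_def by (rule conjunct1)
  from this[rule_format, OF c x] obtain W I where W: "open W" "x \<in> W" "W \<subseteq> chart_image c"
    "\<forall>i v. smooth_on W (\<lambda>y. I y i v)"
    and I: "\<forall>y\<in>W. quaternion_triple (I y) \<and> (\<forall>i u v. g c y (I y i u) (I y i v) = g c y u v) \<and>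
           Q c y = quat_span (I y) \<and> (\<forall>i u. nabla_end g c (\<lambda>z. I z i) y u \<in> Q c y)"
    by (elim exE conjE)
  have "qk_frame g c W Q I n"
  proof (intro qk_frame.intro qk_frame_axioms.intro chart_metric_on[OF c W(1,3)] dim)
    show "smooth_on W (\<lambda>y. I y i v)" for i v using W(4) by simp
    fix y assume y: "y \<in> W"
    show "quaternion_triple (I y)" "Q c y = quat_span (I y)" using I y by simp_all
    show "g c y (I y i u) (I y i v) = g c y u v" for i u v using I y by simp
    show "nabla_end g c (\<lambda>z. I z i) y u \<in> Q c y" for i u using I y by blast
  qed
  then show ?thesis using that W(2,3) by blast
qed

text \<open>The local frame spans the fibre, and a second triple differs from it by a rotation.\<close>

lemma S2H_basis_span:
  assumes "c \<in> \<A>" "x \<in> chart_image c" "S2H_basis Q c x I"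
  shows "quaternion_triple I" "Q c x = quat_span I"
proof -
  obtain W K where W: "x \<in> W" "qk_frame g c W Q K n" using frame_at[OF assms(1,2)] by metis
  then have K: "quaternion_triple (K x)" "Q c x = quat_span (K x)"
    using qk_frame.triple qk_frame.Q_span by blast+
  show I: "quaternion_triple I" using assms(3) by (simp add: S2H_basis_def)
  have "I i \<in> quat_span (K x)" for i using assms(3) K(2) by (simp add: S2H_basis_def)
  from quat_span_basis_change[OF K(1) I this] show "Q c x = quat_span I" using K(2) by simp
qed

lemma S2H_basis_exists:
  assumes "c \<in> \<A>" "x \<in> chart_image c" obtains I where "S2H_basis Q c x I"
proof -
  obtain W K where W: "x \<in> W" "qk_frame g c W Q K n" using frame_at[OF assms(1,2)] by metis
  then have "quaternion_triple (K x)" "Q c x = quat_span (K x)"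
    using qk_frame.triple qk_frame.Q_span by blast+
  then have "S2H_basis Q c x (K x)" by (simp add: S2H_basis_def quat_span_base)
  then show ?thesis by (rule that)
qed

lemma linear_Q:
  assumes "c \<in> \<A>" "x \<in> chart_image c" "S \<in> Q c x" shows "linear S"
proof -
  obtain I where "S2H_basis Q c x I" using S2H_basis_exists[OF assms(1,2)] .
  then have "quaternion_triple I" "Q c x = quat_span I"
    using S2H_basis_span[OF assms(1,2)] by simp_all
  with assms(3) obtain a where "S = qcomb a I" by (auto simp: quat_span_eq)
  then show ?thesis using linear_qcomb[OF \<open>quaternion_triple I\<close>] by simp
qed

lemma killing_fields:
  assumes c: "c \<in> \<A>"
  shows "smooth_on (chart_image c) (X A c)"
    and "x \<in> chart_image c \<Longrightarrow> linear (\<lambda>A. X A c x)"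
    and "x \<in> chart_image c \<Longrightarrow> g c x (nabla_vec g c (X A c) x u) v = - g c x u (nabla_vec g c (X A c) x v)"
proof -
  let ?U = "chart_image c"
  note bf = atlas_chart[OF atlas_G b(1)] and cf = chart[OF c]
  define D where "D = {(z, x). z \<in> chart_image b \<and> x \<in> ?U \<and> act (chart_inv b z) (chart_inv c x) \<in> fst c}"
  define f where "f = (\<lambda>(z, x). snd c (act (chart_inv b z) (chart_inv c x)))"
  define e where "e = snd b \<one>\<^bsub>G\<^esub>"
  have ga: "group_action G UNIV act" and sm: "smooth_map (product_atlas \<B> \<A>) \<A> (\<lambda>(a, p). act a p)"
    using action by (simp_all add: quaternionic_isometric_action_def)
  have one: "act \<one>\<^bsub>G\<^esub> p = p" for p
    using group_action.id_eq_one[OF ga] by (metis UNIV_I restrict_apply)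
  have D: "open D" "smooth_on D f"
    using smooth_map_product_chart[OF atlas_G b(1) atlas c atlas c sm] by (simp_all add: D_def f_def)
  have unit: "(e, x) \<in> D" "f (e, x) = x" if "x \<in> ?U" for x
    using that bf(3,4)[OF b(2)] cf(5,6)[OF that] by (simp_all add: D_def f_def e_def one)
  have fU: "f (z, x) \<in> ?U" if "(z, x) \<in> D" for z x
    using that cf(3) by (simp add: D_def f_def)
  have Xf: "X A c x = pd f (e, x) (A, 0)" if "x \<in> ?U" for A x
    using pd_slice_fst[OF smooth_on_differentiable[OF D(2) unit(1)[OF that]], of A]
    by (simp add: fundamental_field_def f_def e_def)
  have slice: "smooth_on ?U (\<lambda>x. pd f (e, x) (A, 0))" for A
    by (rule smooth_slice_snd[OF D(1) smooth_on_derivative[OF D(2)] cf(2) unit(1)])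
  show "smooth_on ?U (X A c)" by (rule smooth_on_transform[OF cf(2) slice Xf])
  show "linear (\<lambda>A. X A c x)" if "x \<in> ?U"
  proof -
    have l: "linear (pd f (e, x))" by (rule smooth_on_linear_derivative[OF D(2) unit(1)[OF that]])
    have "linear (\<lambda>A. pd f (e, x) (A, 0))"
      using linear_compose[of "\<lambda>A. (A, 0)", OF _ l] by (simp add: comp_def linear_iff)
    then show ?thesis by (simp add: Xf[OF that])
  qed
  interpret cm: chart_metric g c ?U by (rule chart_metric_on[OF c cf(2) order_refl])
  have isom: "g c (f (z, x)) (pd f (z, x) (0, u)) (pd f (z, x) (0, v)) = g c x u v" if zx: "(z, x) \<in> D" for z x u v
  proof -
    have x: "x \<in> ?U" "act (chart_inv b z) (chart_inv c x) \<in> fst c" using zx by (auto simp: D_def)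
    have "\<forall>c\<in>\<A>. \<forall>d\<in>\<A>. \<forall>p\<in>fst c. act a p \<in> fst d \<longrightarrow>
        (let T = tangent_map c d (act a) (snd c p); y = snd d (act a p)
         in (\<forall>u v. g d y (T u) (T v) = g c (snd c p) u v) \<and> Q d y = {S'. \<exists>S\<in>Q c (snd c p). S' \<circ> T = T \<circ> S})" for a
      using action unfolding quaternionic_isometric_action_def by blast
    from this[of "chart_inv b z", THEN bspec, OF c, THEN bspec, OF c, THEN bspec, OF cf(5)[OF x(1)], THEN mp, OF x(2)]
    have "g c (f (z, x)) (tangent_map c c (act (chart_inv b z)) x u) (tangent_map c c (act (chart_inv b z)) x v) = g c x u v"
      by (simp add: Let_def cf(6)[OF x(1)] f_def)
    moreover have "tangent_map c c (act (chart_inv b z)) x u = pd f (z, x) (0, u)" for u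
    proof -
      have "in_charts c c (act (chart_inv b z)) = (\<lambda>x. f (z, x))"
        by (simp add: in_charts_def f_def fun_eq_iff)
      then show ?thesis
        unfolding tangent_map_def using pd_slice_snd[OF smooth_on_differentiable[OF D(2) zx]] by simp
    qed
    ultimately show ?thesis by simp
  qed
  show "g c x (nabla_vec g c (X A c) x u) v = - g c x u (nabla_vec g c (X A c) x v)" if x: "x \<in> ?U"
  proof -
    have "pd (X A c) x u = pd (\<lambda>x. pd f (e, x) (A, 0)) x u" for u
      by (rule pd_cong[OF cf(2) x smooth_on_differentiable[OF slice x], symmetric]) (simp add: Xf)
    then have "nabla_vec g c (X A c) x u = nabla_vec g c (\<lambda>x. pd f (e, x) (A, 0)) x u" for u
      by (simp add: nabla_vec_def Xf[OF x])
    then show ?thesis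
      using cm.killing_field[OF D unit fU isom x, of A u v] by simp
  qed
qed

lemma linear_nabla_X:
  assumes c: "c \<in> \<A>" and x: "x \<in> chart_image c"
  shows "linear (nabla_vec g c (X A c) x)" "linear (\<lambda>A. nabla_vec g c (X A c) x u)"
proof -
  interpret cm: chart_metric g c "chart_image c" by (rule chart_metric_on[OF c chart(2)[OF c] order_refl])
  note sX = killing_fields(1)[OF c] and lX = killing_fields(2)[OF c]
  show "linear (nabla_vec g c (X A c) x)"
    using cm.smooth_endo_nabla_vec[OF chart(2)[OF c] order_refl sX] x by (simp add: cm.smooth_endo_def)
  have l: "linear (\<lambda>A. pd (\<lambda>y. X A c y) x u)"
    by (rule pd_linear_parameter[OF chart(2)[OF c] x, of "\<lambda>y A. X A c y"])
      (use lX smooth_on_differentiable[OF sX x] in auto)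
  have "linear (\<lambda>A. christoffel g c x u (X A c x))"
    using linear_compose[OF lX[OF x] cm.linear_christoffel(1)[OF x]] by (simp add: comp_def)
  with l show "linear (\<lambda>A. nabla_vec g c (X A c) x u)"
    unfolding nabla_vec_def by (intro linear_compose_add)
qed

definition k :: real where
  "k = (SOME k. k \<noteq> 0 \<and> (\<forall>A. \<forall>c\<in>\<A>. \<forall>x\<in>chart_image c.
        \<mu> A c x = (\<lambda>u. k *\<^sub>R S2H_component Q c x (nabla_vec g c (X A c) x) u)))"

lemma k: "k \<noteq> 0"
  and moment_eq: "c \<in> \<A> \<Longrightarrow> x \<in> chart_image c \<Longrightarrow>
        \<mu> A c x = (\<lambda>u. k *\<^sub>R S2H_component Q c x (nabla_vec g c (X A c) x) u)"
  and moment_section: "S2H_section \<A> Q (\<mu> A)"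
proof -
  have "\<exists>k. k \<noteq> 0 \<and> (\<forall>A. \<forall>c\<in>\<A>. \<forall>x\<in>chart_image c.
        \<mu> A c x = (\<lambda>u. k *\<^sub>R S2H_component Q c x (nabla_vec g c (X A c) x) u))"
    and "S2H_section \<A> Q (\<mu> A)"
    using moment by (simp_all add: moment_map_def)
  from someI_ex[OF this(1)] this(2) show "k \<noteq> 0" "c \<in> \<A> \<Longrightarrow> x \<in> chart_image c \<Longrightarrow>
        \<mu> A c x = (\<lambda>u. k *\<^sub>R S2H_component Q c x (nabla_vec g c (X A c) x) u)" "S2H_section \<A> Q (\<mu> A)"
    unfolding k_def by blast+
qed

lemma moment_in_Q: "c \<in> \<A> \<Longrightarrow> x \<in> chart_image c \<Longrightarrow> \<mu> A c x \<in> Q c x"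
  and moment_smooth: "c \<in> \<A> \<Longrightarrow> smooth_on (chart_image c) (\<lambda>x. \<mu> A c x u)"
  and moment_outside: "\<not> (c \<in> \<A> \<and> x \<in> chart_image c) \<Longrightarrow> \<mu> A c x = (\<lambda>u. 0)"
  and moment_transform: "c \<in> \<A> \<Longrightarrow> d \<in> \<A> \<Longrightarrow> p \<in> fst c \<inter> fst d \<Longrightarrow>
        \<mu> A d (snd d p) \<circ> tangent_map c d id (snd c p) = tangent_map c d id (snd c p) \<circ> \<mu> A c (snd c p)"
  using moment_section[of A] unfolding S2H_section_def by blast+

lemma moment_trace:
  assumes c: "c \<in> \<A>" and x: "x \<in> chart_image c" and J: "J \<in> Q c x"
  shows "endo_trace (\<mu> A c x \<circ> J) = k * endo_trace (nabla_vec g c (X A c) x \<circ> J)"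
proof -
  obtain I where I: "S2H_basis Q c x I" using S2H_basis_exists[OF c x] .
  note * = S2H_component(2)[where Q = Q, OF S2H_basis_span[OF c x I] linear_nabla_X(1)[OF c x, of A] J]
  show ?thesis unfolding moment_eq[OF c x] comp_def using * by (simp add: endo_trace_scaleR comp_def)
qed

text \<open>Elements of a fibre of \<open>S\<^sup>2H\<close> are determined by their traces against the \<open>I\<^sub>i\<close>, and these are linear
  in the Killing field.\<close>

lemma moment_linear: "\<mu> (r *\<^sub>R A + s *\<^sub>R B) = (\<lambda>c x u. r *\<^sub>R \<mu> A c x u + s *\<^sub>R \<mu> B c x u)"
proof (intro ext)
  fix c x u
  show "\<mu> (r *\<^sub>R A + s *\<^sub>R B) c x u = r *\<^sub>R \<mu> A c x u + s *\<^sub>R \<mu> B c x u"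
  proof (cases "c \<in> \<A> \<and> x \<in> chart_image c")
    case True
    then have cx: "c \<in> \<A>" "x \<in> chart_image c" by auto
    obtain I where I: "S2H_basis Q c x I" using S2H_basis_exists[OF cx] .
    note sp = S2H_basis_span[OF cx I]
    have "\<mu> (r *\<^sub>R A + s *\<^sub>R B) c x = (\<lambda>u. r *\<^sub>R \<mu> A c x u + s *\<^sub>R \<mu> B c x u)"
    proof (rule quat_span_eqI[OF sp(1)])
      show "\<mu> (r *\<^sub>R A + s *\<^sub>R B) c x \<in> quat_span I" using moment_in_Q[OF cx] sp(2) by simp
      show "(\<lambda>u. r *\<^sub>R \<mu> A c x u + s *\<^sub>R \<mu> B c x u) \<in> quat_span I"
        using moment_in_Q[OF cx] sp(2) by (intro quat_span_combination) simp_all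
      fix i
      have IQ: "I i \<in> Q c x" using sp(2) quat_span_base by simp
      have "nabla_vec g c (X (r *\<^sub>R A + s *\<^sub>R B) c) x v =
          r *\<^sub>R nabla_vec g c (X A c) x v + s *\<^sub>R nabla_vec g c (X B c) x v" for v
        by (simp add: linear_add[OF linear_nabla_X(2)[OF cx]] linear_cmul[OF linear_nabla_X(2)[OF cx]])
      then show "endo_trace (\<mu> (r *\<^sub>R A + s *\<^sub>R B) c x \<circ> I i) =
          endo_trace ((\<lambda>u. r *\<^sub>R \<mu> A c x u + s *\<^sub>R \<mu> B c x u) \<circ> I i)"
        using moment_trace[OF cx IQ, of A] moment_trace[OF cx IQ, of B]
          moment_trace[OF cx IQ, of "r *\<^sub>R A + s *\<^sub>R B"]
        by (simp add: comp_def endo_trace_add endo_trace_scaleR algebra_simps)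
    qed
    then show ?thesis by simp
  qed (simp add: moment_outside)
qed

lemma nabla_moment_at:
  assumes c: "c \<in> \<A>" and x: "x \<in> chart_image c"
  obtains l where "l \<noteq> 0" "\<And>u. nabla_end g c (\<mu> A c) x u \<in> Q c x"
    "\<And>u J. J \<in> Q c x \<Longrightarrow> endo_trace (nabla_end g c (\<mu> A c) x u \<circ> J) = l * g c x (X A c x) (J u)"
proof -
  obtain W I where W: "x \<in> W" "W \<subseteq> chart_image c" "qk_frame g c W Q I n" using frame_at[OF c x] .
  interpret fr: qk_frame g c W Q I n by (rule W(3))
  have in_U: "y \<in> chart_image c" if "y \<in> W" for y using W(2) that by blast
  have S: "fr.smooth_endo W (\<mu> A c)"
    unfolding fr.smooth_endo_def
    using fr.open_U linear_Q[OF c in_U moment_in_Q[OF c in_U]] smooth_on_subset[OF moment_smooth[OF c] W(2)]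
    by blast
  have SQ: "\<mu> A c y \<in> Q c y" if "y \<in> W" for y by (rule moment_in_Q[OF c in_U[OF that]])
  obtain l where l: "l \<noteq> 0"
    "\<And>u J. J \<in> Q c x \<Longrightarrow> endo_trace (nabla_end g c (\<mu> A c) x u \<circ> J) = l * g c x (X A c x) (J u)"
    using fr.nabla_moment[OF W(1) scal[OF c x] k smooth_on_subset[OF killing_fields(1)[OF c] W(2)]
        killing_fields(3)[OF c in_U] S SQ moment_trace[OF c in_U]] by blast
  show ?thesis by (rule that[OF l(1) fr.nabla_in_Q[OF S SQ W(1)] l(2)])
qed

text \<open>The covector \<open>\<phi>\<close> with \<open>\<nabla>\<^sub>u\<mu>\<^sub>A = \<Sum>\<^sub>i \<phi>(I\<^sub>i u) I\<^sub>i\<close> is a multiple of \<open>\<langle>X, -\<rangle>\<close>.\<close>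

lemma moment_twistor: "\<mu> A \<in> ker_twistor n \<A> g Q"
proof -
  have "twistor_op n g c x I \<theta> (\<mu> A) a B C D = 0"
    if c: "c \<in> \<A>" and x: "x \<in> chart_image c" and I: "S2H_basis Q c x I" and \<theta>: "EH_coframe n I \<theta>"
      and a: "a < 2 * n" for c x I \<theta> a B C D
  proof -
    note sp = S2H_basis_span[OF c x I]
    interpret cm: chart_metric g c "chart_image c" by (rule chart_metric_on[OF c chart(2)[OF c] order_refl])
    obtain l where l: "\<And>u. nabla_end g c (\<mu> A c) x u \<in> Q c x"
      "\<And>u J. J \<in> Q c x \<Longrightarrow> endo_trace (nabla_end g c (\<mu> A c) x u \<circ> J) = l * g c x (X A c x) (J u)"
      using nabla_moment_at[OF c x, of A] by metis
    let ?\<phi> = "\<lambda>u. - (l / DIM('e)) * g c x (X A c x) u"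
    show ?thesis
    proof (rule twistor_op_zero[OF sp(1) \<theta> a])
      show "linear ?\<phi>"
        using inner_form.linear_right[OF cm.form[OF x], of "X A c x"]
        by (intro linearI) (simp_all add: linear_add linear_cmul algebra_simps)
      have "I i \<in> Q c x" for i using sp(2) quat_span_base by simp
      then show "S2H_coords I (nabla_end g c (\<mu> A c) x u) $ i = ?\<phi> (I i u)" for i u
        using S2H_coords[OF sp(1), of "nabla_end g c (\<mu> A c) x u" i] l sp(2) by simp
    qed
  qed
  then show ?thesis using moment_section by (auto simp: ker_twistor_def)
qed

text \<open>If \<open>\<mu>\<^sub>A = 0\<close>, then its derivative vanishes, hence so does the Killing field.\<close>

lemma moment_kernel:
  assumes "\<And>c x. c \<in> \<A> \<Longrightarrow> x \<in> chart_image c \<Longrightarrow> \<mu> A c x = (\<lambda>u. 0)" shows "A = 0"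
proof -
  have "X A c x = 0" if c: "c \<in> \<A>" and x: "x \<in> chart_image c" for c x
  proof -
    interpret cm: chart_metric g c "chart_image c" by (rule chart_metric_on[OF c chart(2)[OF c] order_refl])
    obtain l where l: "l \<noteq> 0"
      "\<And>u J. J \<in> Q c x \<Longrightarrow> endo_trace (nabla_end g c (\<mu> A c) x u \<circ> J) = l * g c x (X A c x) (J u)"
      using nabla_moment_at[OF c x, of A] by metis
    have "pd (\<lambda>y. \<mu> A c y v) x u = 0" for u v
      using pd_cong[OF chart(2)[OF c] x differentiable_const[of 0], of "\<lambda>y. \<mu> A c y v" u] assms[OF c] by simp
    then have z: "nabla_end g c (\<mu> A c) x u = (\<lambda>v. 0)" for u
      by (simp add: nabla_end_def fun_eq_iff assms[OF c x] linear_0[OF cm.linear_christoffel(1)[OF x]])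
    obtain I where I: "S2H_basis Q c x I" using S2H_basis_exists[OF c x] .
    note sp = S2H_basis_span[OF c x I]
    have "I 1 \<in> Q c x" using sp(2) quat_span_base by simp
    from l(2)[OF this, of "- I 1 (X A c x)"] have "g c x (X A c x) (X A c x) = 0"
      using l(1) by (simp add: z linear_neg[OF quat_linear[OF sp(1)]] quat_sq[OF sp(1)] endo_trace_def comp_def)
    then show ?thesis by (simp add: inner_form.eq_0_iff[OF cm.form[OF x]])
  qed
  then show ?thesis using effective by (simp add: infinitesimally_effective_def)
qed

lemma moment_inj: "\<mu> A = \<mu> B \<Longrightarrow> A = B"
proof -
  assume "\<mu> A = \<mu> B"
  then have "\<mu> (1 *\<^sub>R A + (- 1) *\<^sub>R B) c x = (\<lambda>u. 0)" for c x
    unfolding moment_linear by simp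
  then have "1 *\<^sub>R A + (- 1) *\<^sub>R B = 0" by (rule moment_kernel)
  then show "A = B" by simp
qed

lemma ker_twistor_lie_eq: "ker_twistor_lie n \<A> g Q \<mu> = range \<mu>"
  using moment_twistor by (auto simp: ker_twistor_lie_def)

end

section \<open>Change of charts\<close>

lemma tangent_map_inverse:
  assumes A: "smooth_atlas \<A>" and c: "c \<in> \<A>" and d: "d \<in> \<A>" and p: "p \<in> fst c \<inter> fst d"
  shows "linear (tangent_map c d id (snd c p))"
    and "tangent_map d c id (snd d p) \<circ> tangent_map c d id (snd c p) = id"
proof -
  note cf = atlas_chart[OF A c] and df = atlas_chart[OF A d]
  have tr: "smooth_on (snd c ` (fst c \<inter> fst d)) (in_charts c d id)"
    if "c \<in> \<A>" "d \<in> \<A>" for c d using A that unfolding smooth_atlas_def by blast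
  let ?S = "snd c ` (fst c \<inter> fst d)"
  have S: "open ?S" "snd c p \<in> ?S" using open_chart_set[OF A c df(1)] p by auto
  have 1: "(in_charts c d id has_derivative tangent_map c d id (snd c p)) (at (snd c p))"
    unfolding tangent_map_def by (rule smooth_on_has_derivative[OF tr[OF c d] S(2)])
  have 2: "(in_charts d c id has_derivative tangent_map d c id (snd d p)) (at (in_charts c d id (snd c p)))"
  proof -
    have "in_charts c d id (snd c p) = snd d p" using cf(4) p by (simp add: in_charts_def)
    moreover have "snd d p \<in> snd d ` (fst d \<inter> fst c)" using p by auto
    ultimately show ?thesis
      unfolding tangent_map_def using smooth_on_has_derivative[OF tr[OF d c]] by simp
  qed
  show "linear (tangent_map c d id (snd c p))"
    using 1 has_derivative_linear by blast
  have "((\<lambda>x. in_charts d c id (in_charts c d id x)) has_derivative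
      (\<lambda>u. tangent_map d c id (snd d p) (tangent_map c d id (snd c p) u))) (at (snd c p))"
    by (rule has_derivative_compose[OF 1 2])
  then have "((\<lambda>x. x) has_derivative
      (\<lambda>u. tangent_map d c id (snd d p) (tangent_map c d id (snd c p) u))) (at (snd c p))"
    by (rule has_derivative_transform_within_open[OF _ S])
      (use cf(4) df(4) in \<open>auto simp: in_charts_def\<close>)
  then show "tangent_map d c id (snd d p) \<circ> tangent_map c d id (snd c p) = id"
    using has_derivative_unique[OF _ has_derivative_ident] by (auto simp: fun_eq_iff)
qed

section \<open>The map to the Grassmannian\<close>

context moment_setup
begin

lemmas ip_simps = inner_form.form_simps[OF ip]

text \<open>The natural metric of \<open>S\<^sup>2H\<close>, for which quaternion triples are orthonormal.\<close>

definition S2H_form :: "('e \<Rightarrow> 'e) \<Rightarrow> ('e \<Rightarrow> 'e) \<Rightarrow> real" where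
  "S2H_form S T = - endo_trace (S \<circ> T) / DIM('e)"

lemma S2H_form_qcomb: "quaternion_triple I \<Longrightarrow> S2H_form (qcomb a I) (qcomb a' I) = a \<bullet> a'"
  by (simp add: S2H_form_def trace_qcomb)

abbreviation f :: "'h \<Rightarrow> 'h" where "f \<equiv> inner_form.onb ip"

text \<open>The vectors \<open>B\<^sub>i\<close> with \<open>\<mu> = \<Sum>\<^sub>i I\<^sub>i \<otimes> B\<^sub>i\<close>.\<close>

definition moment_frame :: "('m, 'e) chart \<Rightarrow> 'e \<Rightarrow> (3 \<Rightarrow> 'e \<Rightarrow> 'e) \<Rightarrow> 'h^3" where
  "moment_frame c x I = (\<chi> i. \<Sum>b\<in>Basis. S2H_form (I i) (\<mu> (f b) c x) *\<^sub>R f b)"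

text \<open>The formula for the lift refers to the sections \<open>\<mu>\<^sub>A\<close> only, not to a frame of \<open>S\<^sup>2H\<close>, and is
  therefore smooth and independent of charts.  If \<open>\<mu> = \<Sum>\<^sub>i I\<^sub>i \<otimes> B\<^sub>i\<close>, then it maps \<open>I\<^sub>i\<close> to
  \<open>3 B\<^sub>i / \<Sum>\<^sub>j \<langle>B\<^sub>j, B\<^sub>j\<rangle>\<close>, which is \<open>B\<^sub>i / \<lambda>\<^sup>2\<close> under the conformality assumption.\<close>

definition lift :: "('m, 'e) chart \<Rightarrow> 'e \<Rightarrow> ('e \<Rightarrow> 'e) \<Rightarrow> 'h" where
  "lift c x S = (3 / (\<Sum>b\<in>Basis. S2H_form (\<mu> (f b) c x) (\<mu> (f b) c x))) *\<^sub>R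
     (\<Sum>b\<in>Basis. S2H_form S (\<mu> (f b) c x) *\<^sub>R f b)"

lemma form_moment:
  assumes cx: "c \<in> \<A>" "x \<in> chart_image c" and S: "S \<in> Q c x"
  shows "ip (\<Sum>b\<in>Basis. S2H_form S (\<mu> (f b) c x) *\<^sub>R f b) A = S2H_form S (\<mu> A c x)"
proof -
  note lin = linear_Q[OF cx S]
  have "linear (\<lambda>A. S2H_form S (\<mu> A c x))"
  proof (rule linearI)
    fix A B r
    have "\<mu> (A + B) c x = (\<lambda>u. \<mu> A c x u + \<mu> B c x u)" using moment_linear[of 1 A 1 B] by simp
    then show "S2H_form S (\<mu> (A + B) c x) = S2H_form S (\<mu> A c x) + S2H_form S (\<mu> B c x)"
      by (simp add: S2H_form_def comp_def linear_add[OF lin] endo_trace_add diff_divide_distrib)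
    have "\<mu> (r *\<^sub>R A) c x = (\<lambda>u. r *\<^sub>R \<mu> A c x u)" using moment_linear[of r A 0 A] by simp
    then show "S2H_form S (\<mu> (r *\<^sub>R A) c x) = r *\<^sub>R S2H_form S (\<mu> A c x)"
      by (simp add: S2H_form_def comp_def linear_cmul[OF lin] endo_trace_scaleR)
  qed
  from inner_form.linear_onb_expansion[OF ip this, of A] show ?thesis
    by (simp add: ip_simps inner_form.sym[OF ip, of _ A] mult.commute)
qed

lemma moment_frame_form:
  assumes "c \<in> \<A>" "x \<in> chart_image c" "S2H_basis Q c x I"
  shows "ip (moment_frame c x I $ i) A = S2H_form (I i) (\<mu> A c x)"
  using form_moment[OF assms(1,2)] assms(3) by (simp add: moment_frame_def S2H_basis_def)

lemma moment_qcomb: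
  assumes cx: "c \<in> \<A>" "x \<in> chart_image c" and I: "S2H_basis Q c x I"
  shows "\<mu> A c x = qcomb (\<chi> i. ip (moment_frame c x I $ i) A) I"
proof -
  note sp = S2H_basis_span[OF cx I]
  obtain a where a: "\<mu> A c x = qcomb a I"
    using moment_in_Q[OF cx, of A] sp(2) by (auto simp: quat_span_eq)
  have "S2H_form (I i) (\<mu> A c x) = a $ i" for i
    using S2H_form_qcomb[OF sp(1), of "axis i 1" a] by (simp add: a qcomb_axis inner_axis')
  then have "a = (\<chi> i. ip (moment_frame c x I $ i) A)" by (simp add: moment_frame_form[OF cx I] vec_eq_iff)
  then show ?thesis by (simp add: a)
qed

lemma moment_components_iff:
  assumes cx: "c \<in> \<A>" "x \<in> chart_image c" and I: "S2H_basis Q c x I"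
  shows "moment_components ip \<mu> c x I B \<longleftrightarrow> B = moment_frame c x I"
proof -
  note sp = S2H_basis_span[OF cx I]
  have "moment_components ip \<mu> c x I B \<longleftrightarrow> (\<forall>A. \<mu> A c x = qcomb (\<chi> i. ip (B $ i) A) I)"
    by (simp add: moment_components_def qcomb_def fun_eq_iff)
  also have "\<dots> \<longleftrightarrow> (\<forall>A i. ip (moment_frame c x I $ i) A = ip (B $ i) A)"
    by (simp add: moment_qcomb[OF cx I] qcomb_inject[OF sp(1)] vec_eq_iff)
  also have "\<dots> \<longleftrightarrow> B = moment_frame c x I"
    unfolding vec_eq_iff using inner_form.form_eqI[OF ip] by metis
  finally show ?thesis .
qed

text \<open>The vectors \<open>B\<^sub>i\<close> are rotated together with the \<open>I\<^sub>i\<close>, so they span the same oriented plane.\<close>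

lemma moment_frame_rotation:
  assumes cx: "c \<in> \<A>" "x \<in> chart_image c" and I: "S2H_basis Q c x I" and J: "S2H_basis Q c x J"
  shows "moment_frame c x J \<in> ospan (moment_frame c x I)"
proof -
  note sp = S2H_basis_span[OF cx I] and sp' = S2H_basis_span[OF cx J]
  have "J i \<in> quat_span I" for i using J sp(2) by (simp add: S2H_basis_def)
  from quat_rotation[OF sp(1) sp'(1) this] obtain a :: "real^3^3"
    where a: "\<And>i. J i = qcomb (a $ i) I" "det a = 1" by metis
  have "moment_frame c x J = frame_act a (moment_frame c x I)"
  proof (subst vec_eq_iff, rule allI, rule inner_form.form_eqI[OF ip])
    fix i A
    have "ip (moment_frame c x J $ i) A = S2H_form (qcomb (a $ i) I) (qcomb (\<chi> i. ip (moment_frame c x I $ i) A) I)"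
      by (simp only: moment_frame_form[OF cx J] a(1) moment_qcomb[OF cx I])
    also have "\<dots> = ip (frame_act a (moment_frame c x I) $ i) A"
      by (simp add: S2H_form_qcomb[OF sp(1)] inner_vec_def frame_comb_def ip_simps)
    finally show "ip (moment_frame c x J $ i) A = ip (frame_act a (moment_frame c x I) $ i) A" .
  qed
  then show ?thesis using a(2) by (auto simp: ospan_eq)
qed

lemma S2H_form_transform:
  assumes c: "c \<in> \<A>" and d: "d \<in> \<A>" and p: "p \<in> fst c \<inter> fst d"
    and S: "linear S1" "linear S2" "linear T1" "linear T2"
    and T: "T1 \<circ> tangent_map c d id (snd c p) = tangent_map c d id (snd c p) \<circ> S1"
      "T2 \<circ> tangent_map c d id (snd c p) = tangent_map c d id (snd c p) \<circ> S2"
  shows "S2H_form T1 T2 = S2H_form S1 S2"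
proof -
  let ?t = "tangent_map c d id (snd c p)" and ?t' = "tangent_map d c id (snd d p)"
  have p': "p \<in> fst d \<inter> fst c" using p by blast
  have "(T1 \<circ> T2) \<circ> ?t = ?t \<circ> (S1 \<circ> S2)" using T by (metis comp_assoc)
  then have "endo_trace (T1 \<circ> T2) = endo_trace (S1 \<circ> S2)"
    by (intro endo_trace_conj[of _ _ ?t ?t'] linear_compose S tangent_map_inverse[OF atlas c d p]
        tangent_map_inverse[OF atlas d c p'])
  then show ?thesis by (simp add: S2H_form_def)
qed

lemma snd_in_image: "c \<in> \<A> \<Longrightarrow> p \<in> fst c \<Longrightarrow> snd c p \<in> chart_image c"
  using chart(3) .

text \<open>The tangent map of the change of charts conjugates a basis over one chart to a basis over the
  other, and traces are invariant under conjugation.\<close>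

lemma moment_frame_chart_change:
  assumes c: "c \<in> \<A>" and d: "d \<in> \<A>" and p: "p \<in> fst c \<inter> fst d" and I: "S2H_basis Q c (snd c p) I"
  obtains J where "S2H_basis Q d (snd d p) J" "moment_frame d (snd d p) J = moment_frame c (snd c p) I"
proof -
  let ?t = "tangent_map c d id (snd c p)" and ?t' = "tangent_map d c id (snd d p)"
  have p': "p \<in> fst d \<inter> fst c" using p by blast
  have cx: "snd c p \<in> chart_image c" and dx: "snd d p \<in> chart_image d"
    using snd_in_image c d p by auto
  note t = tangent_map_inverse[OF atlas c d p] and t' = tangent_map_inverse[OF atlas d c p']
  have tt: "?t' (?t u) = u" "?t (?t' u) = u" for u using t(2) t'(2) by (metis comp_apply id_apply)+
  note sp = S2H_basis_span[OF c cx I]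
  define J where "J i = ?t \<circ> I i \<circ> ?t'" for i
  have lin: "linear (J i)" for i
    unfolding J_def by (intro linear_compose t(1) t'(1) quat_linear[OF sp(1)])
  have "quaternion_triple J"
    using sp(1) lin unfolding quaternion_triple_def
    by (simp add: J_def tt linear_neg[OF t(1)])
  moreover have JT: "J i \<circ> ?t = ?t \<circ> I i" for i by (simp add: J_def fun_eq_iff tt)
  have "Q d (snd d p) = {T. \<exists>S\<in>Q c (snd c p). T \<circ> ?t = ?t \<circ> S}"
    using parallel_Q c d p unfolding parallel_quaternionic_structure_def by blast
  then have "J i \<in> Q d (snd d p)" for i using JT[of i] I by (auto simp: S2H_basis_def)
  ultimately have J: "S2H_basis Q d (snd d p) J" by (simp add: S2H_basis_def)
  have "S2H_form (J i) (\<mu> A d (snd d p)) = S2H_form (I i) (\<mu> A c (snd c p))" for i A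
    by (rule S2H_form_transform[OF c d p quat_linear[OF sp(1)] linear_Q[OF c cx moment_in_Q[OF c cx]] lin
          linear_Q[OF d dx moment_in_Q[OF d dx]] JT moment_transform[OF c d p]])
  then have "moment_frame d (snd d p) J = moment_frame c (snd c p) I" by (simp add: moment_frame_def)
  with J show ?thesis using that by blast
qed

lemma moment_frame_ospan:
  assumes c: "c \<in> \<A>" and d: "d \<in> \<A>" and p: "p \<in> fst c" "p \<in> fst d"
    and I: "S2H_basis Q c (snd c p) I" and J: "S2H_basis Q d (snd d p) J"
  shows "ospan (moment_frame d (snd d p) J) = ospan (moment_frame c (snd c p) I)"
    and "moment_frame d (snd d p) J \<in> ospan (moment_frame c (snd c p) I)"
proof -
  obtain K where "S2H_basis Q d (snd d p) K" "moment_frame d (snd d p) K = moment_frame c (snd c p) I"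
    using moment_frame_chart_change[OF c d _ I] p by auto
  then show "moment_frame d (snd d p) J \<in> ospan (moment_frame c (snd c p) I)"
    using moment_frame_rotation[OF d snd_in_image[OF d p(2)] _ J] by metis
  then show "ospan (moment_frame d (snd d p) J) = ospan (moment_frame c (snd c p) I)" by (rule ospan_cong)
qed

lemma Psi_eq:
  assumes c: "c \<in> \<A>" and p: "p \<in> fst c" and I: "S2H_basis Q c (snd c p) I"
  shows "Psi ip \<A> Q \<mu> p = ospan (moment_frame c (snd c p) I)"
  unfolding Psi_def
proof (rule the_equality)
  show "\<exists>c'\<in>\<A>. p \<in> fst c' \<and> (\<exists>I' B. S2H_basis Q c' (snd c' p) I' \<and>
     moment_components ip \<mu> c' (snd c' p) I' B \<and> ospan (moment_frame c (snd c p) I) = ospan B)"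
    using c p I moment_components_iff[OF c snd_in_image[OF c p] I] by blast
  fix P assume "\<exists>c'\<in>\<A>. p \<in> fst c' \<and> (\<exists>I' B. S2H_basis Q c' (snd c' p) I' \<and>
     moment_components ip \<mu> c' (snd c' p) I' B \<and> P = ospan B)"
  then obtain c' I' B where d: "c' \<in> \<A>" "p \<in> fst c'" "S2H_basis Q c' (snd c' p) I'"
    "moment_components ip \<mu> c' (snd c' p) I' B" "P = ospan B" by blast
  then have "B = moment_frame c' (snd c' p) I'"
    using moment_components_iff[OF d(1) snd_in_image[OF d(1,2)] d(3)] by simp
  then show "P = ospan (moment_frame c (snd c p) I)"
    using moment_frame_ospan(1)[OF c d(1) p d(2) I d(3)] d(5) by simp
qed

lemma M0_iff:
  assumes c: "c \<in> \<A>" and p: "p \<in> fst c" and I: "S2H_basis Q c (snd c p) I"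
  shows "p \<in> M0 ip \<A> Q \<mu> \<longleftrightarrow> frame3 (moment_frame c (snd c p) I)"
proof
  assume "frame3 (moment_frame c (snd c p) I)"
  then show "p \<in> M0 ip \<A> Q \<mu>"
    unfolding M0_def using c p I moment_components_iff[OF c snd_in_image[OF c p] I] by blast
next
  assume "p \<in> M0 ip \<A> Q \<mu>"
  then obtain d J B where d: "d \<in> \<A>" "p \<in> fst d" "S2H_basis Q d (snd d p) J"
    "moment_components ip \<mu> d (snd d p) J B" "frame3 B" unfolding M0_def by blast
  then have "B = moment_frame d (snd d p) J"
    using moment_components_iff[OF d(1) snd_in_image[OF d(1,2)] d(3)] by simp
  then show "frame3 (moment_frame c (snd c p) I)"
    using moment_frame_ospan(2)[OF d(1) c d(2) p d(3) I] d(5) frame3_ospan by blast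
qed

section \<open>The lift\<close>

lemma norm_moment_frame:
  assumes cx: "c \<in> \<A>" "x \<in> chart_image c" and I: "S2H_basis Q c x I"
  shows "(\<Sum>b\<in>Basis. S2H_form (\<mu> (f b) c x) (\<mu> (f b) c x)) =
    (\<Sum>i\<in>UNIV. ip (moment_frame c x I $ i) (moment_frame c x I $ i))"
proof -
  note sp = S2H_basis_span[OF cx I]
  let ?B = "moment_frame c x I"
  have "S2H_form (\<mu> A c x) (\<mu> A c x) = (\<Sum>i\<in>UNIV. ip (?B $ i) A * ip (?B $ i) A)" for A
    unfolding moment_qcomb[OF cx I, of A] by (simp add: S2H_form_qcomb[OF sp(1)] inner_vec_def)
  then have "(\<Sum>b\<in>Basis. S2H_form (\<mu> (f b) c x) (\<mu> (f b) c x)) =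
      (\<Sum>i\<in>UNIV. \<Sum>b\<in>Basis. ip (?B $ i) (f b) * ip (?B $ i) (f b))"
    by (simp add: sum.swap[of _ Basis])
  then show ?thesis by (simp add: inner_form.parseval[OF ip])
qed

lemma lift_components:
  assumes cx: "c \<in> \<A>" "x \<in> chart_image c" and I: "S2H_basis Q c x I"
  shows "lift c x (qcomb a I) =
    (3 / (\<Sum>i\<in>UNIV. ip (moment_frame c x I $ i) (moment_frame c x I $ i))) *\<^sub>R frame_comb a (moment_frame c x I)"
proof -
  note sp = S2H_basis_span[OF cx I]
  let ?B = "moment_frame c x I"
  have S: "qcomb a I \<in> Q c x" using sp(2) by (auto simp: quat_span_eq)
  have "(\<Sum>b\<in>Basis. S2H_form (qcomb a I) (\<mu> (f b) c x) *\<^sub>R f b) = frame_comb a ?B"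
  proof (rule inner_form.form_eqI[OF ip])
    fix A
    show "ip (\<Sum>b\<in>Basis. S2H_form (qcomb a I) (\<mu> (f b) c x) *\<^sub>R f b) A = ip (frame_comb a ?B) A"
      unfolding form_moment[OF cx S] moment_qcomb[OF cx I, of A]
      by (simp add: S2H_form_qcomb[OF sp(1)] inner_vec_def frame_comb_def ip_simps)
  qed
  then show ?thesis by (simp add: lift_def norm_moment_frame[OF cx I])
qed

lemma frame_norm_pos: "frame3 B \<Longrightarrow> (\<Sum>i\<in>UNIV. ip (B $ i) (B $ i)) > 0"
proof -
  assume B: "frame3 B"
  have nz: "B $ i \<noteq> 0" for i
    using B frame_comb_axis[of i B] unfolding frame3_iff by (metis axis_eq_0_iff zero_neq_one)
  show ?thesis using inner_form.pos[OF ip nz] by (intro sum_pos) auto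
qed

lemma lift_linear:
  assumes cx: "c \<in> \<A>" "x \<in> chart_image c" and S: "S \<in> Q c x" "T \<in> Q c x"
  shows "lift c x (\<lambda>u. r *\<^sub>R S u + s *\<^sub>R T u) = r *\<^sub>R lift c x S + s *\<^sub>R lift c x T"
proof -
  have "S2H_form (\<lambda>u. r *\<^sub>R S u + s *\<^sub>R T u) K = r * S2H_form S K + s * S2H_form T K" for K
    by (simp add: S2H_form_def comp_def endo_trace_add endo_trace_scaleR diff_divide_distrib)
  then show ?thesis
    by (simp add: lift_def scaleR_add_left sum.distrib scaleR_sum_right scaleR_add_right mult_ac)
qed

lemma lift_chart_change:
  assumes c: "c \<in> \<A>" and d: "d \<in> \<A>" and p: "p \<in> fst c \<inter> fst d"
    and S: "S \<in> Q c (snd c p)" and T: "T \<in> Q d (snd d p)"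
    and ST: "T \<circ> tangent_map c d id (snd c p) = tangent_map c d id (snd c p) \<circ> S"
  shows "lift d (snd d p) T = lift c (snd c p) S"
proof -
  have cx: "snd c p \<in> chart_image c" and dx: "snd d p \<in> chart_image d"
    using snd_in_image c d p by auto
  note lc = linear_Q[OF c cx] and ld = linear_Q[OF d dx]
  note mc = lc[OF moment_in_Q[OF c cx]] and md = ld[OF moment_in_Q[OF d dx]]
  have "S2H_form T (\<mu> A d (snd d p)) = S2H_form S (\<mu> A c (snd c p))" for A
    by (rule S2H_form_transform[OF c d p lc[OF S] mc ld[OF T] md ST moment_transform[OF c d p]])
  moreover have "S2H_form (\<mu> A d (snd d p)) (\<mu> A d (snd d p)) = S2H_form (\<mu> A c (snd c p)) (\<mu> A c (snd c p))" for A
    by (rule S2H_form_transform[OF c d p mc mc md md moment_transform[OF c d p] moment_transform[OF c d p]])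
  ultimately show ?thesis by (simp add: lift_def)
qed

lemma smooth_S2H_form:
  assumes "c \<in> \<A>" "open U" "U \<subseteq> chart_image c" "\<And>u. smooth_on U (\<lambda>y. \<sigma> y u)" "\<And>y. y \<in> U \<Longrightarrow> linear (\<sigma> y)"
  shows "smooth_on U (\<lambda>y. S2H_form (\<sigma> y) (\<mu> A c y))"
  unfolding S2H_form_def
  using smooth_on_subset[OF moment_smooth[OF assms(1)] assms(3)]
  by (intro smooth_on_divide smooth_on_minus smooth_on_endo_trace assms smooth_on_const) auto

lemma M0_norm_pos:
  assumes c: "c \<in> \<A>" and y: "y \<in> snd c ` (fst c \<inter> M0 ip \<A> Q \<mu>)"
  shows "(\<Sum>b\<in>Basis. S2H_form (\<mu> (f b) c y) (\<mu> (f b) c y)) > 0"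
proof -
  obtain p where p: "p \<in> fst c" "p \<in> M0 ip \<A> Q \<mu>" "y = snd c p" using y by blast
  have cy: "y \<in> chart_image c" using snd_in_image[OF c p(1)] p(3) by simp
  obtain I where I: "S2H_basis Q c y I" using S2H_basis_exists[OF c cy] .
  have "frame3 (moment_frame c y I)" using M0_iff[OF c p(1)] I p by simp
  then show ?thesis using frame_norm_pos by (simp add: norm_moment_frame[OF c cy I])
qed

text \<open>\<open>M\<^sub>0\<close> is open because the \<open>B\<^sub>i\<close> with respect to a smooth local frame \<open>I\<close> are smooth; they are the
  required local lift of \<open>\<Psi>\<close> to the space of frames.\<close>

lemma lift_bundle_morphism: "bundle_morphism \<A> Q (M0 ip \<A> Q \<mu>) (Psi ip \<A> Q \<mu>) lift"
  unfolding bundle_morphism_def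
proof (intro conjI ballI allI impI)
  fix c p assume c: "c \<in> \<A>" and p: "p \<in> fst c \<inter> M0 ip \<A> Q \<mu>"
  then have pc: "p \<in> fst c" and cx: "snd c p \<in> chart_image c" using snd_in_image by auto
  obtain W I where W: "snd c p \<in> W" "W \<subseteq> chart_image c" "qk_frame g c W Q I n" using frame_at[OF c cx] .
  interpret fr: qk_frame g c W Q I n by (rule W(3))
  have basis: "S2H_basis Q c y (I y)" if "y \<in> W" for y
    using fr.triple[OF that] fr.Q_span[OF that] by (simp add: S2H_basis_def quat_span_base)
  let ?v = "\<lambda>y. moment_frame c y (I y)"
  have v: "smooth_on W ?v"
  proof (rule smooth_on_vec_nth[OF fr.open_U])
    show "smooth_on W (\<lambda>y. ?v y $ i)" for i
      unfolding moment_frame_def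
      by (simp, intro smooth_on_sum smooth_on_scaleR smooth_S2H_form[OF c] fr.open_U W(2) fr.smooth_I
          quat_linear[OF fr.triple] smooth_on_const; assumption?)
  qed
  let ?U = "W \<inter> ?v -` {v. frame3 v}"
  have U: "open ?U"
    by (rule continuous_open_preimage[OF smooth_on_continuous[OF v] fr.open_U inner_form.open_frames[OF ip]])
  have iff: "chart_inv c y \<in> fst c" "snd c (chart_inv c y) = y"
    "chart_inv c y \<in> M0 ip \<A> Q \<mu> \<longleftrightarrow> frame3 (?v y)" "Psi ip \<A> Q \<mu> (chart_inv c y) = ospan (?v y)"
    if "y \<in> W" for y
  proof -
    have y: "y \<in> chart_image c" using W(2) that by blast
    show i: "chart_inv c y \<in> fst c" "snd c (chart_inv c y) = y" using chart(5,6)[OF c y] by auto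
    show "chart_inv c y \<in> M0 ip \<A> Q \<mu> \<longleftrightarrow> frame3 (?v y)" "Psi ip \<A> Q \<mu> (chart_inv c y) = ospan (?v y)"
      using M0_iff[OF c i(1), of "I y"] Psi_eq[OF c i(1), of "I y"] basis[OF that] by (simp_all add: i(2))
  qed
  show "\<exists>U v. open U \<and> snd c p \<in> U \<and> U \<subseteq> snd c ` (fst c \<inter> M0 ip \<A> Q \<mu>) \<and>
        smooth_on U v \<and> (\<forall>y\<in>U. frame3 (v y) \<and> Psi ip \<A> Q \<mu> (chart_inv c y) = ospan (v y))"
  proof (intro exI[of _ ?U] exI[of _ ?v] conjI U)
    show "snd c p \<in> ?U" using W(1) p iff(3)[OF W(1)] chart(4)[OF c pc] by simp
    show "?U \<subseteq> snd c ` (fst c \<inter> M0 ip \<A> Q \<mu>)"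
    proof
      fix y assume "y \<in> ?U"
      then have y: "y \<in> W" "frame3 (?v y)" by auto
      show "y \<in> snd c ` (fst c \<inter> M0 ip \<A> Q \<mu>)"
        by (rule image_eqI[of _ _ "chart_inv c y"]) (use iff[OF y(1)] y(2) in auto)
    qed
    show "smooth_on ?U ?v" by (rule smooth_on_subset[OF v]) blast
    show "\<forall>y\<in>?U. frame3 (?v y) \<and> Psi ip \<A> Q \<mu> (chart_inv c y) = ospan (?v y)" using iff(4) by blast
  qed
next
  fix c p S assume c: "c \<in> \<A>" and p: "p \<in> fst c \<inter> M0 ip \<A> Q \<mu>" and S: "S \<in> Q c (snd c p)"
  then have pc: "p \<in> fst c" and cx: "snd c p \<in> chart_image c" using snd_in_image by auto
  obtain I where I: "S2H_basis Q c (snd c p) I" using S2H_basis_exists[OF c cx] .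
  note sp = S2H_basis_span[OF c cx I]
  obtain a where "S = qcomb a I" using S sp(2) by (auto simp: quat_span_eq)
  moreover have "Psi ip \<A> Q \<mu> p \<in> Gr3"
    using Psi_eq[OF c pc I] M0_iff[OF c pc I] p by (simp add: ospan_Gr3)
  from subspace_scale[OF subspace_taut[OF this]]
  have "r *\<^sub>R frame_comb a (moment_frame c (snd c p) I) \<in> taut (Psi ip \<A> Q \<mu> p)" for r
    by (simp add: Psi_eq[OF c pc I] taut_ospan)
  ultimately show "lift c (snd c p) S \<in> taut (Psi ip \<A> Q \<mu> p)"
    using lift_components[OF c cx I] by simp
next
  fix c p S T and r s :: real
  assume "c \<in> \<A>" "p \<in> fst c \<inter> M0 ip \<A> Q \<mu>" "S \<in> Q c (snd c p)" "T \<in> Q c (snd c p)"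
  then show "lift c (snd c p) (\<lambda>u. r *\<^sub>R S u + s *\<^sub>R T u) = r *\<^sub>R lift c (snd c p) S + s *\<^sub>R lift c (snd c p) T"
    using lift_linear snd_in_image by auto
next
  fix c d p S T
  assume "c \<in> \<A>" "d \<in> \<A>" "p \<in> fst c \<inter> fst d \<inter> M0 ip \<A> Q \<mu>" "S \<in> Q c (snd c p)" "T \<in> Q d (snd d p)"
    "T \<circ> tangent_map c d id (snd c p) = tangent_map c d id (snd c p) \<circ> S"
  then show "lift d (snd d p) T = lift c (snd c p) S" by (intro lift_chart_change) auto
next
  fix c U \<sigma>
  assume c: "c \<in> \<A>" and U: "open U \<and> U \<subseteq> snd c ` (fst c \<inter> M0 ip \<A> Q \<mu>) \<and>
        (\<forall>y\<in>U. \<sigma> y \<in> Q c y) \<and> (\<forall>u. smooth_on U (\<lambda>y. \<sigma> y u))"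
  have Uc: "U \<subseteq> chart_image c" using U snd_in_image[OF c] by blast
  then have lin: "linear (\<sigma> y)" "linear (\<mu> A c y)" if "y \<in> U" for y A
    using linear_Q[OF c] moment_in_Q[OF c] U that by blast+
  have nz: "(\<Sum>b\<in>Basis. S2H_form (\<mu> (f b) c y) (\<mu> (f b) c y)) \<noteq> 0" if "y \<in> U" for y
  proof -
    have "y \<in> snd c ` (fst c \<inter> M0 ip \<A> Q \<mu>)" using U that by blast
    from M0_norm_pos[OF c this] show ?thesis by simp
  qed
  have mu: "smooth_on U (\<lambda>y. \<mu> A c y u)" for A u
    using smooth_on_subset[OF moment_smooth[OF c] Uc] .
  have oU: "open U" and s\<sigma>: "\<And>u. smooth_on U (\<lambda>y. \<sigma> y u)" using U by auto
  show "smooth_on U (\<lambda>y. lift c y (\<sigma> y))"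
    unfolding lift_def
    by (intro smooth_on_scaleR smooth_on_divide smooth_on_sum smooth_S2H_form[OF c oU Uc] oU mu s\<sigma> lin nz
        smooth_on_const; assumption?)
qed

text \<open>With \<open>B\<^sub>i = \<lambda> v\<^sub>i\<close> the sum \<open>\<Sum>\<^sub>j \<langle>B\<^sub>j, B\<^sub>j\<rangle>\<close> is \<open>3 \<lambda>\<^sup>2\<close>, and \<open>\<mu>\<^sub>A = \<Sum>\<^sub>i \<langle>B\<^sub>i, A\<rangle> I\<^sub>i\<close> is mapped to \<open>\<Sum>\<^sub>i \<langle>v\<^sub>i, A\<rangle> v\<^sub>i\<close>.\<close>

lemma lift_moment:
  assumes conf: "conformal ip \<A> Q \<mu>" and c: "c \<in> \<A>" and p: "p \<in> fst c \<inter> M0 ip \<A> Q \<mu>"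
  shows "lift c (snd c p) (\<mu> A c (snd c p)) = const_proj ip A (Psi ip \<A> Q \<mu> p)"
proof -
  have pc: "p \<in> fst c" "p \<in> M0 ip \<A> Q \<mu>" and cx: "snd c p \<in> chart_image c"
    using c p snd_in_image by auto
  obtain I where I: "S2H_basis Q c (snd c p) I" using S2H_basis_exists[OF c cx] .
  let ?B = "moment_frame c (snd c p) I" and ?P = "Psi ip \<A> Q \<mu> p"
  have P: "?P = ospan ?B" and B: "frame3 ?B" using Psi_eq[OF c pc(1) I] M0_iff[OF c pc(1) I] pc(2) by auto
  have Gr: "?P \<in> Gr3" using P B ospan_Gr3 by simp
  have mc: "moment_components ip \<mu> c (snd c p) I ?B" using moment_components_iff[OF c cx I] by simp
  obtain \<rho> :: "'m \<Rightarrow> real" where "\<forall>p\<in>M0 ip \<A> Q \<mu>. \<forall>c\<in>\<A>. p \<in> fst c \<longrightarrow>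
     (\<forall>I B. S2H_basis Q c (snd c p) I \<and> moment_components ip \<mu> c (snd c p) I B \<longrightarrow>
        (\<exists>v. orthonormal3 ip v \<and> span (range (($) v)) = taut (Psi ip \<A> Q \<mu> p) \<and> (\<forall>i. B $ i = \<rho> p *\<^sub>R v $ i)))"
    using conf unfolding conformal_def by blast
  then obtain v where v: "orthonormal3 ip v" "span (range (($) v)) = taut ?P" "\<And>i. ?B $ i = \<rho> p *\<^sub>R v $ i"
    using pc c I mc by metis
  let ?r = "\<rho> p"
  have on: "ip (v $ i) (v $ j) = (if i = j then 1 else 0)" for i j using v(1) by (simp add: orthonormal3_def)
  have "ip (?B $ i) (?B $ i) = ?r * ?r" for i by (simp add: v(3) ip_simps on)
  then have norm: "(\<Sum>i\<in>UNIV. ip (?B $ i) (?B $ i)) = 3 * (?r * ?r)" by simp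
  then have r: "?r \<noteq> 0" using frame_norm_pos[OF B] by auto
  have fc: "frame_comb (\<chi> i. ip (?B $ i) A) ?B = (?r * ?r) *\<^sub>R frame_comb (\<chi> i. ip (v $ i) A) v"
    by (simp add: frame_comb_def v(3) ip_simps scaleR_sum_right mult_ac)
  have "lift c (snd c p) (\<mu> A c (snd c p)) = frame_comb (\<chi> i. ip (v $ i) A) v"
    unfolding moment_qcomb[OF c cx I, of A] lift_components[OF c cx I] norm fc using r by simp
  also have "\<dots> = proj_taut ip ?P A"
  proof (rule inner_form.proj_tautI[OF ip Gr, symmetric])
    show "frame_comb (\<chi> i. ip (v $ i) A) v \<in> taut ?P" by (simp add: v(2)[symmetric] span_frame)
    fix z assume "z \<in> taut ?P"
    then obtain a where z: "z = frame_comb a v" by (auto simp: v(2)[symmetric] span_frame)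
    have "ip (frame_comb (\<chi> i. ip (v $ i) A) v) (v $ j) = ip (v $ j) A" for j
    proof -
      have "ip (frame_comb (\<chi> i. ip (v $ i) A) v) (v $ j) = (\<Sum>i\<in>UNIV. if i = j then ip (v $ i) A else 0)"
        unfolding frame_comb_def ip_simps by (intro sum.cong) (auto simp: on)
      then show ?thesis by (simp add: sum.delta)
    qed
    then have "ip (A - frame_comb (\<chi> i. ip (v $ i) A) v) (v $ j) = 0" for j
      using inner_form.sym[OF ip, of A "v $ j"] by (simp add: ip_simps(9))
    then show "ip (A - frame_comb (\<chi> i. ip (v $ i) A) v) z = 0"
      unfolding z frame_comb_def[of a] ip_simps(12) ip_simps(4) by simp
  qed
  finally show ?thesis by (simp add: const_proj_def Gr)
qed

definition section_map :: "('m, 'e) end_field \<Rightarrow> ('h^3) set \<Rightarrow> 'h" where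
  "section_map \<sigma> = const_proj ip (inv_into UNIV \<mu> \<sigma>)"

lemma section_map_moment: "section_map (\<mu> A) = const_proj ip A"
  unfolding section_map_def using moment_inj by (simp add: inv_f_f inj_def)

lemma section_map_bij:
  assumes "DIM('h) > 3"
  shows "linear_bij_sections (ker_twistor_lie n \<A> g Q \<mu>) (ker_D ip) section_map"
  unfolding linear_bij_sections_def ker_twistor_lie_eq
proof (intro conjI ballI allI)
  have "section_map ` range \<mu> = ker_D ip"
    by (simp add: image_image section_map_moment inner_form.ker_D_eq[OF ip assms])
  moreover have "inj_on section_map (range \<mu>)"
    using inner_form.const_proj_inj[OF ip] assms by (auto simp: inj_on_def section_map_moment)
  ultimately show "bij_betw section_map (range \<mu>) (ker_D ip)" by (simp add: bij_betw_def)
  fix \<sigma> \<tau> and r s :: real assume "\<sigma> \<in> range \<mu>" "\<tau> \<in> range \<mu>"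
  then obtain A B where e: "\<sigma> = \<mu> A" "\<tau> = \<mu> B" by blast
  have lin: "(\<lambda>c x u. r *\<^sub>R \<sigma> c x u + s *\<^sub>R \<tau> c x u) = \<mu> (r *\<^sub>R A + s *\<^sub>R B)"
    by (simp add: e moment_linear)
  show "(\<lambda>c x u. r *\<^sub>R \<sigma> c x u + s *\<^sub>R \<tau> c x u) \<in> range \<mu>" unfolding lin by blast
  show "section_map (\<lambda>c x u. r *\<^sub>R \<sigma> c x u + s *\<^sub>R \<tau> c x u) = (\<lambda>P. r *\<^sub>R section_map \<sigma> P + s *\<^sub>R section_map \<tau> P)"
    unfolding lin by (simp add: e section_map_moment inner_form.const_proj_linear[OF ip] fun_eq_iff)
qed

end

section \<open>The bijection of the kernels\<close>

theorem proposition3p2: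
  fixes \<A> :: "('m::{t2_space, second_countable_topology}, 'e::euclidean_space) chart set"
    and g :: "('m, 'e) metric"
    and Q :: "('m, 'e) end_bundle"
    and G :: "'g::{t2_space, second_countable_topology} monoid"
    and \<B> :: "('g, 'h::euclidean_space) chart set"
    and b :: "('g, 'h) chart"
    and act :: "'g \<Rightarrow> 'm \<Rightarrow> 'm"
    and \<mu> :: "'h \<Rightarrow> ('m, 'e) end_field"
    and ip :: "'h \<Rightarrow> 'h \<Rightarrow> real"
    and n :: nat
  assumes "quaternion_kaehler n \<A> g Q"
    and "\<And>c x. c \<in> \<A> \<Longrightarrow> x \<in> chart_image c \<Longrightarrow> scalar_curvature g c x \<noteq> 0"
    and "lie_group G \<B>"
    and "compact (UNIV :: 'g set)"
    and "b \<in> \<B>" and "\<one>\<^bsub>G\<^esub> \<in> fst b"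
    and "ip = neg_killing G b"
    and "\<And>A. A \<noteq> 0 \<Longrightarrow> ip A A > 0"
    and "DIM('h) > 3"
    and "quaternionic_isometric_action G \<B> \<A> g Q act"
    and "infinitesimally_effective G b \<A> act"
    and "moment_map G b \<A> g Q act \<mu>"
    and "conformal ip \<A> Q \<mu>"
  shows "\<exists>\<Psi>.
    bundle_morphism \<A> Q (M0 ip \<A> Q \<mu>) (Psi ip \<A> Q \<mu>) \<Psi> \<and>
    (\<forall>A. \<forall>c\<in>\<A>. \<forall>p\<in>fst c \<inter> M0 ip \<A> Q \<mu>.
       \<Psi> c (snd c p) (\<mu> A c (snd c p)) = const_proj ip A (Psi ip \<A> Q \<mu> p)) \<and>
    (\<exists>F. linear_bij_sections (ker_twistor_lie n \<A> g Q \<mu>) (ker_D ip) F \<and>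
       (\<forall>A. F (\<mu> A) = const_proj ip A) \<and>
       (\<forall>\<sigma>\<in>ker_twistor_lie n \<A> g Q \<mu>. \<forall>c\<in>\<A>. \<forall>p\<in>fst c \<inter> M0 ip \<A> Q \<mu>.
          \<Psi> c (snd c p) (\<sigma> c (snd c p)) = F \<sigma> (Psi ip \<A> Q \<mu> p)))"
proof -
  have ip: "inner_form ip"
    using inner_form_neg_killing[OF assms(3,5,6)] assms(7,8) by simp
  interpret moment_setup \<A> g Q G \<B> b act \<mu> ip n
    by (rule moment_setup.intro[OF assms(1,2,3,5,6) ip assms(10-12)])
  show ?thesis
  proof (rule exI[of _ lift], intro conjI exI[of _ section_map] allI ballI)
    show "bundle_morphism \<A> Q (M0 ip \<A> Q \<mu>) (Psi ip \<A> Q \<mu>) lift" by (rule lift_bundle_morphism)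
    show "linear_bij_sections (ker_twistor_lie n \<A> g Q \<mu>) (ker_D ip) section_map"
      by (rule section_map_bij[OF assms(9)])
    show "section_map (\<mu> A) = const_proj ip A" for A by (rule section_map_moment)
    fix c p assume c: "c \<in> \<A>" and p: "p \<in> fst c \<inter> M0 ip \<A> Q \<mu>"
    show lift: "lift c (snd c p) (\<mu> A c (snd c p)) = const_proj ip A (Psi ip \<A> Q \<mu> p)" for A
      by (rule lift_moment[OF assms(13) c p])
    fix \<sigma> assume "\<sigma> \<in> ker_twistor_lie n \<A> g Q \<mu>"
    then obtain A where "\<sigma> = \<mu> A" unfolding ker_twistor_lie_eq by blast
    then show "lift c (snd c p) (\<sigma> c (snd c p)) = section_map \<sigma> (Psi ip \<A> Q \<mu> p)"
      using lift by (simp add: section_map_moment)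
  qed
qed

end
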